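(* Let $f$ be a holomorphic selfmap of the unit disk $\mathbb{D}$ and $B$ a maximal Blaschke product such that $f'/B'$ has a holomorphic extension to $\mathbb{D}$. If $$\frac{f^h(z_n)}{B^h(z_n)}=1+o\big((1-|z_n|)^2\big)$$ for some sequence $(z_n)$ in $\mathbb{D}$ such that $|z_n|\to 1$, then $f=T\circ B$ for some $T\in\mathrm{Aut}(\mathbb{D})$, and $f$ is a maximal Blaschke product.
   Context: For a holomorphic selfmap $g$ of $\mathbb{D}=\{|z|<1\}$, $g^h(z):=(1-|z|^2)\frac{|g'(z)|}{1-|g(z)|^2}$. $\mathrm{Aut}(\mathbb{D})$ is the group of conformal automorphisms of $\mathbb{D}$. A maximal Blaschke product is a nonconstant (finite or infinite) Blaschke product $B$ such that $g^h(z)\le B^h(z)$ for all $z\in\mathbb{D}$ and every nonconstant holomorphic selfmap $g$ of $\mathbb{D}$ for which $g'$ and $B'$ have the same zeros counting multiplicities. At critical points $z_0$ of $B$ the quotient $f^h(z_0)/B^h(z_0)$ is understood as $\lim_{z\to z_0}f^h(z)/B^h(z)$. *)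

theory Defs
  imports "HOL-Complex_Analysis.Complex_Analysis" "HOL-Library.Landau_Symbols"
begin

abbreviation unit_disc :: "complex set" ("\<D>") where
  "\<D> \<equiv> ball 0 1"

text \<open>All functions on the disc are total functions of which only the values on \<open>\<D>\<close> matter.\<close>

definition holomorphic_selfmap :: "(complex \<Rightarrow> complex) \<Rightarrow> bool" where
  "holomorphic_selfmap g \<longleftrightarrow> g holomorphic_on \<D> \<and> g ` \<D> \<subseteq> \<D>"

definition disc_automorphism :: "(complex \<Rightarrow> complex) \<Rightarrow> bool" where
  "disc_automorphism T \<longleftrightarrow>
     bij_betw T \<D> \<D> \<and> T holomorphic_on \<D> \<and> inv_into \<D> T holomorphic_on \<D>"

definition hyp_deriv :: "(complex \<Rightarrow> complex) \<Rightarrow> complex \<Rightarrow> real" where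
  "hyp_deriv g z = (1 - (cmod z)\<^sup>2) * (cmod (deriv g z) / (1 - (cmod (g z))\<^sup>2))"

text \<open>At a critical point of \<open>B\<close> the quotient is read as a limit. For nonconstant \<open>B\<close> it exists as
  soon as \<open>f' / B'\<close> extends holomorphically; otherwise the value of \<^const>\<open>Lim\<close> may be arbitrary.\<close>

definition hyp_deriv_quotient ::
    "(complex \<Rightarrow> complex) \<Rightarrow> (complex \<Rightarrow> complex) \<Rightarrow> complex \<Rightarrow> real" where
  "hyp_deriv_quotient f B z =
     (if deriv B z = 0 then Lim (at z) (\<lambda>w. hyp_deriv f w / hyp_deriv B w)
      else hyp_deriv f z / hyp_deriv B z)"

definition blaschke_factor :: "complex \<Rightarrow> complex \<Rightarrow> complex" where
  "blaschke_factor a z =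
     (if a = 0 then z else (of_real (cmod a) / a) * ((a - z) / (1 - cnj a * z)))"

definition finite_blaschke_product :: "(complex \<Rightarrow> complex) \<Rightarrow> bool" where
  "finite_blaschke_product B \<longleftrightarrow>
     (\<exists>c (a :: nat \<Rightarrow> complex) N. cmod c = 1 \<and> (\<forall>n<N. a n \<in> \<D>) \<and>
        (\<forall>z\<in>\<D>. B z = c * (\<Prod>n<N. blaschke_factor (a n) z)))"

text \<open>By the Blaschke condition only finitely many factors vanish at a given point of \<open>\<D>\<close>; the
  library's notion of infinite product admits finitely many zero factors.\<close>

definition infinite_blaschke_product :: "(complex \<Rightarrow> complex) \<Rightarrow> bool" where
  "infinite_blaschke_product B \<longleftrightarrow>
     (\<exists>c (a :: nat \<Rightarrow> complex). cmod c = 1 \<and> (\<forall>n. a n \<in> \<D>) \<and>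
        summable (\<lambda>n. 1 - cmod (a n)) \<and>
        (\<forall>z\<in>\<D>. B z = c * (\<Prod>n. blaschke_factor (a n) z)))"

definition blaschke_product :: "(complex \<Rightarrow> complex) \<Rightarrow> bool" where
  "blaschke_product B \<longleftrightarrow> finite_blaschke_product B \<or> infinite_blaschke_product B"

text \<open>For nonconstant holomorphic \<open>g\<close> the derivative does not vanish identically on \<open>\<D>\<close>, so
  \<open>zorder (deriv g) z\<close> is the multiplicity of \<open>z\<close> as a zero of \<open>g'\<close>, being \<open>0\<close> where
  \<open>g'\<close> does not vanish.\<close>

definition same_critical_points :: "(complex \<Rightarrow> complex) \<Rightarrow> (complex \<Rightarrow> complex) \<Rightarrow> bool" where
  "same_critical_points g B \<longleftrightarrow> (\<forall>z\<in>\<D>. zorder (deriv g) z = zorder (deriv B) z)"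

definition maximal_blaschke_product :: "(complex \<Rightarrow> complex) \<Rightarrow> bool" where
  "maximal_blaschke_product B \<longleftrightarrow>
     blaschke_product B \<and> \<not> B constant_on \<D> \<and>
     (\<forall>g. holomorphic_selfmap g \<and> \<not> g constant_on \<D> \<and> same_critical_points g B \<longrightarrow>
        (\<forall>z\<in>\<D>. hyp_deriv g z \<le> hyp_deriv B z))"

end

theory Submission
  imports Defs "HOL-Real_Asymp.Real_Asymp"
begin

text \<open>
  Write \<open>\<lambda>\<^sub>g = |g'| / (1 - |g|\<^sup>2)\<close>, a conformal pseudometric of curvature \<open>-4\<close>.

  \<^item> Maximality of \<open>B\<close> is assumed only against maps with exactly the same critical points, but it
    implies \<open>\<sigma> \<le> \<lambda>\<^sub>B\<close> for every pseudometric \<open>\<sigma>\<close> of curvature at most \<open>-4\<close> that vanishes at the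
    critical points of \<open>B\<close>. Finitely many critical points are the critical points of a finite
    Blaschke product \<open>F\<close>, and Ahlfors' lemma gives \<open>\<sigma> \<le> \<lambda>\<^sub>F\<close>, because \<open>\<lambda>\<^sub>F\<close> is asymptotic to the
    hyperbolic metric at the unit circle. Exhausting the critical points of \<open>B\<close>, the maps \<open>F\<close>
    converge along a subsequence to a map with the critical points of \<open>B\<close>, a competitor of \<open>B\<close>.
  \<^item> Hence \<open>q = \<lambda>\<^sub>f / \<lambda>\<^sub>B \<le> 1\<close>. If \<open>q < 1\<close> somewhere, a barrier decaying like \<open>(1 - |z|)\<^sup>2\<close> gives
    \<open>q \<le> 1 - c (1 - |z|)\<^sup>2\<close> near the circle. So under the hypothesis \<open>q = 1\<close>, and \<open>f = T \<circ> B\<close>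
    by the rigidity of local hyperbolic isometries.
  \<^item> To see that \<open>f\<close> is a Blaschke product, write \<open>f = b S\<close> with a Blaschke product \<open>b\<close> and
    \<open>|S| = exp (- p)\<close>, \<open>p \<ge> 0\<close> harmonic. Replacing the target disc of \<open>f\<close> by the disc of radius
    \<open>exp (- \<alpha>)\<close>, for a convex function \<open>\<alpha>\<close> of \<open>p\<close>, gives a pseudometric of curvature at most \<open>-4\<close>;
    comparison with \<open>\<lambda>\<^sub>f = \<lambda>\<^sub>B\<close> bounds \<open>p\<close>. Then a multiple of \<open>p\<close> is a minorant of \<open>- ln |B|\<close>,
    so \<open>p = 0\<close> as \<open>B\<close> is a Blaschke product.
\<close>

section \<open>Laplacians of functions on the plane\<close>

text \<open>The exponent 2 is dictated by the boundary. At distance d from the circle, 1 - |z|^2 is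
  about 2 d, so the inequality for ln q has the model w'' = 2 w / d^2. Its power solutions d^s
  satisfy s (s - 1) = 2, so s = 2 or s = -1: a quotient that is somewhere below 1 stays below 1 by a
  multiple of d^2, which the little-o hypothesis contradicts. The first obstacle is that f' may have
  more zeros than B', so f is not itself a competitor of B and a dominating competitor has to be
  manufactured. Instead of solving the curvature equation with prescribed zeros, an extremal problem
  for points on the circle yields finite products as Cayley transforms of Herglotz sums, with their
  boundary asymptotics. The second obstacle is that a Moebius image of an infinite Blaschke product
  may acquire a singular inner factor. Hence f = T o B alone does not make f a Blaschke product, and
  maximality of B has to enter once more. Common zeros are cancelled before any maximum principle is
  applied: with f' = h B', q is handled as |h| (1 - |B|^2) / (1 - |f|^2), which is continuous
  through the critical points.\<close>

definition twice_diff :: "(real \<Rightarrow> real) \<Rightarrow> real \<Rightarrow> real \<Rightarrow> bool" where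
  "twice_diff \<phi> d1 d2 \<longleftrightarrow> (\<exists>\<phi>'. (\<forall>\<^sub>F t in nhds 0. (\<phi> has_real_derivative \<phi>' t) (at t)) \<and>
     \<phi>' 0 = d1 \<and> (\<phi>' has_real_derivative d2) (at 0))"

lemma twice_diff_add:
  assumes "twice_diff \<phi> a1 a2" "twice_diff \<psi> b1 b2"
  shows "twice_diff (\<lambda>t. \<phi> t + \<psi> t) (a1 + b1) (a2 + b2)"
proof -
  obtain p where p: "\<forall>\<^sub>F t in nhds 0. (\<phi> has_real_derivative p t) (at t)" "p 0 = a1"
      "(p has_real_derivative a2) (at 0)"
    using assms(1) unfolding twice_diff_def by blast
  obtain q where q: "\<forall>\<^sub>F t in nhds 0. (\<psi> has_real_derivative q t) (at t)" "q 0 = b1"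
      "(q has_real_derivative b2) (at 0)"
    using assms(2) unfolding twice_diff_def by blast
  have "\<forall>\<^sub>F t in nhds 0. ((\<lambda>t. \<phi> t + \<psi> t) has_real_derivative p t + q t) (at t)"
    using p(1) q(1) by eventually_elim (rule DERIV_add)
  then show ?thesis unfolding twice_diff_def
    using p q by (intro exI[of _ "\<lambda>t. p t + q t"]) (auto intro: DERIV_add)
qed

lemma twice_diff_mult:
  assumes "twice_diff \<phi> a1 a2" "twice_diff \<psi> b1 b2"
  shows "twice_diff (\<lambda>t. \<phi> t * \<psi> t) (a1 * \<psi> 0 + \<phi> 0 * b1) (a2 * \<psi> 0 + 2 * a1 * b1 + \<phi> 0 * b2)"
proof -
  obtain p where p: "\<forall>\<^sub>F t in nhds 0. (\<phi> has_real_derivative p t) (at t)" "p 0 = a1"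
      "(p has_real_derivative a2) (at 0)"
    using assms(1) unfolding twice_diff_def by blast
  obtain q where q: "\<forall>\<^sub>F t in nhds 0. (\<psi> has_real_derivative q t) (at t)" "q 0 = b1"
      "(q has_real_derivative b2) (at 0)"
    using assms(2) unfolding twice_diff_def by blast
  have 1: "\<forall>\<^sub>F t in nhds 0. ((\<lambda>t. \<phi> t * \<psi> t) has_real_derivative p t * \<psi> t + \<phi> t * q t) (at t)"
    using p(1) q(1) by eventually_elim (auto intro!: derivative_eq_intros)
  have "(\<phi> has_real_derivative a1) (at 0)" "(\<psi> has_real_derivative b1) (at 0)"
    using eventually_nhds_x_imp_x[OF p(1)] eventually_nhds_x_imp_x[OF q(1)] p(2) q(2) by auto
  then have "((\<lambda>t. p t * \<psi> t + \<phi> t * q t) has_real_derivative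
      a2 * \<psi> 0 + 2 * a1 * b1 + \<phi> 0 * b2) (at 0)"
    using p q by (auto intro!: derivative_eq_intros)
  with 1 show ?thesis unfolding twice_diff_def
    using p q by (intro exI[of _ "\<lambda>t. p t * \<psi> t + \<phi> t * q t"]) auto
qed

lemma twice_diff_compose:
  assumes "twice_diff \<phi> a1 a2"
    and "\<forall>\<^sub>F s in nhds (\<phi> 0). (G has_real_derivative G' s) (at s)"
    and "(G' has_real_derivative G2) (at (\<phi> 0))"
  shows "twice_diff (\<lambda>t. G (\<phi> t)) (G' (\<phi> 0) * a1) (G' (\<phi> 0) * a2 + G2 * a1\<^sup>2)"
proof -
  obtain p where p: "\<forall>\<^sub>F t in nhds 0. (\<phi> has_real_derivative p t) (at t)" "p 0 = a1"
      "(p has_real_derivative a2) (at 0)"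
    using assms(1) unfolding twice_diff_def by blast
  have d0: "(\<phi> has_real_derivative a1) (at 0)"
    using eventually_nhds_x_imp_x[OF p(1)] p(2) by auto
  then have "isCont \<phi> 0" by (rule DERIV_isCont)
  then have "(\<phi> \<longlongrightarrow> \<phi> 0) (nhds 0)" by (simp add: isCont_def tendsto_at_iff_tendsto_nhds)
  then have "\<forall>\<^sub>F t in nhds 0. (G has_real_derivative G' (\<phi> t)) (at (\<phi> t))"
    using assms(2) by (rule eventually_compose_filterlim[rotated])
  then have 1: "\<forall>\<^sub>F t in nhds 0. ((\<lambda>t. G (\<phi> t)) has_real_derivative G' (\<phi> t) * p t) (at t)"
    using p(1) by eventually_elim (rule DERIV_chain2)
  have "((\<lambda>t. G' (\<phi> t) * p t) has_real_derivative G' (\<phi> 0) * a2 + (G2 * a1) * p 0) (at 0)"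
    by (rule DERIV_mult'[OF DERIV_chain2[OF assms(3) d0] p(3)])
  then have "((\<lambda>t. G' (\<phi> t) * p t) has_real_derivative G' (\<phi> 0) * a2 + G2 * a1\<^sup>2) (at 0)"
    by (simp add: p(2) power2_eq_square mult.assoc)
  with 1 show ?thesis unfolding twice_diff_def
    using p by (intro exI[of _ "\<lambda>t. G' (\<phi> t) * p t"]) auto
qed

lemma twice_diff_local_max:
  assumes "twice_diff \<phi> d1 d2" "\<forall>\<^sub>F t in nhds 0. \<phi> t \<le> \<phi> 0"
  shows "d2 \<le> 0"
proof (rule ccontr)
  assume "\<not> d2 \<le> 0"
  then have d2: "d2 > 0" by simp
  obtain p where p: "\<forall>\<^sub>F t in nhds 0. (\<phi> has_real_derivative p t) (at t)" "p 0 = d1"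
      "(p has_real_derivative d2) (at 0)"
    using assms(1) unfolding twice_diff_def by blast
  obtain e where e: "e > 0" "\<And>t. \<bar>t\<bar> < e \<Longrightarrow> (\<phi> has_real_derivative p t) (at t) \<and> \<phi> t \<le> \<phi> 0"
    using eventually_conj[OF p(1) assms(2)]
    unfolding eventually_nhds_metric by (auto simp: dist_real_def)
  have "p 0 = 0"
    using DERIV_local_max[of \<phi> "p 0" 0 e] e by auto
  obtain d where d: "d > 0" "\<And>h. 0 < h \<Longrightarrow> h < d \<Longrightarrow> p 0 < p (0 + h)"
    using DERIV_pos_inc_right[OF p(3) d2] by auto
  define t where "t = min (e/2) (d/2)"
  have t: "0 < t" "t < e" "t < d" using e(1) d(1) by (auto simp: t_def)
  have "\<exists>z. 0 < z \<and> z < t \<and> \<phi> t - \<phi> 0 = (t - 0) * p z"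
    by (rule MVT2) (use t e(2) in auto)
  then obtain z where z: "0 < z" "z < t" "\<phi> t - \<phi> 0 = t * p z" by auto
  have "p z > 0" using d(2)[of z] z t \<open>p 0 = 0\<close> by auto
  then have "\<phi> t > \<phi> 0" using z t by (smt (verit) mult_pos_pos)
  with e(2)[of t] t show False by auto
qed

text \<open>\<open>g\<close> encodes the gradient: the derivative of \<open>u\<close> at \<open>z\<close> in the direction \<open>e\<close> is \<open>Re (g * e)\<close>.\<close>

definition has_lap :: "(complex \<Rightarrow> real) \<Rightarrow> complex \<Rightarrow> real \<Rightarrow> complex \<Rightarrow> bool" where
  "has_lap u g L z \<longleftrightarrow> (\<exists>p q. twice_diff (\<lambda>t. u (z + of_real t)) (Re g) p \<and>
     twice_diff (\<lambda>t. u (z + \<i> * of_real t)) (Re (\<i> * g)) q \<and> p + q = L)"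

lemma has_lapI:
  assumes "twice_diff (\<lambda>t. u (z + of_real t)) d p" "twice_diff (\<lambda>t. u (z + \<i> * of_real t)) e q"
    and "d = Re g" "e = - Im g" "p + q = L"
  shows "has_lap u g L z"
  using assms unfolding has_lap_def by auto

lemma has_lapE:
  assumes "has_lap u g L z"
  obtains p q where "twice_diff (\<lambda>t. u (z + of_real t)) (Re g) p"
    "twice_diff (\<lambda>t. u (z + \<i> * of_real t)) (- Im g) q" "L = p + q"
  using assms unfolding has_lap_def by auto

lemma has_lap_add:
  assumes "has_lap u g L z" "has_lap v h M z"
  shows "has_lap (\<lambda>w. u w + v w) (g + h) (L + M) z"
proof (rule has_lapE[OF assms(1)], rule has_lapE[OF assms(2)])
  fix p q r s
  assume a: "twice_diff (\<lambda>t. u (z + of_real t)) (Re g) p"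
    "twice_diff (\<lambda>t. u (z + \<i> * of_real t)) (- Im g) q" "L = p + q"
    "twice_diff (\<lambda>t. v (z + of_real t)) (Re h) r"
    "twice_diff (\<lambda>t. v (z + \<i> * of_real t)) (- Im h) s" "M = r + s"
  show ?thesis
    by (rule has_lapI[OF twice_diff_add[OF a(1) a(4)] twice_diff_add[OF a(2) a(5)]])
       (simp_all add: a(3,6))
qed

text \<open>With gradients encoded as complex numbers, \<open>Re (g * cnj h)\<close> is the inner
  product of two gradients and \<open>(cmod g)\<^sup>2\<close> the squared length of one. The mixed
  terms of the product rule, and the second-order term of the chain rule below, take this
  form.\<close>

lemma has_lap_mult:
  assumes "has_lap u g L z" "has_lap v h M z"
  shows "has_lap (\<lambda>w. u w * v w) (of_real (v z) * g + of_real (u z) * h)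
           (v z * L + u z * M + 2 * Re (g * cnj h)) z"
proof (rule has_lapE[OF assms(1)], rule has_lapE[OF assms(2)])
  fix p q r s
  assume a: "twice_diff (\<lambda>t. u (z + of_real t)) (Re g) p"
    "twice_diff (\<lambda>t. u (z + \<i> * of_real t)) (- Im g) q" "L = p + q"
    "twice_diff (\<lambda>t. v (z + of_real t)) (Re h) r"
    "twice_diff (\<lambda>t. v (z + \<i> * of_real t)) (- Im h) s" "M = r + s"
  show ?thesis
    by (rule has_lapI[OF twice_diff_mult[OF a(1) a(4)] twice_diff_mult[OF a(2) a(5)]])
       (simp_all add: a(3,6) algebra_simps)
qed

lemma has_lap_compose:
  assumes "has_lap u g L z"
    and "\<forall>\<^sub>F s in nhds (u z). (G has_real_derivative G' s) (at s)"
    and "(G' has_real_derivative G2) (at (u z))"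
  shows "has_lap (\<lambda>w. G (u w)) (of_real (G' (u z)) * g) (G' (u z) * L + G2 * (cmod g)\<^sup>2) z"
proof (rule has_lapE[OF assms(1)])
  fix p q
  assume a: "twice_diff (\<lambda>t. u (z + of_real t)) (Re g) p"
    "twice_diff (\<lambda>t. u (z + \<i> * of_real t)) (- Im g) q" "L = p + q"
  have 0: "u (z + of_real 0) = u z" "u (z + \<i> * of_real 0) = u z" by simp_all
  show ?thesis
    by (rule has_lapI[OF twice_diff_compose[OF a(1), of G G' G2, unfolded 0, OF assms(2,3)]
          twice_diff_compose[OF a(2), of G G' G2, unfolded 0, OF assms(2,3)]])
       (simp_all add: a(3) algebra_simps cmod_power2)
qed

lemma has_lap_cmult:
  assumes "has_lap u g L z"
  shows "has_lap (\<lambda>w. c * u w) (of_real c * g) (c * L) z"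
  using has_lap_compose[OF assms, of "\<lambda>s. c * s" "\<lambda>_. c" 0]
  by (auto intro!: derivative_eq_intros)

lemma has_lap_const: "has_lap (\<lambda>_. c) 0 0 z"
proof -
  have "twice_diff (\<lambda>_. c) 0 0" unfolding twice_diff_def by (intro exI[of _ "\<lambda>_. 0"]) auto
  then show ?thesis unfolding has_lap_def by force
qed

lemma has_lap_uminus:
  assumes "has_lap u g L z"
  shows "has_lap (\<lambda>w. - u w) (- g) (- L) z"
  using has_lap_cmult[OF assms, of "-1"] by simp

lemma has_lap_cong:
  assumes "has_lap u g L z" "\<forall>\<^sub>F w in nhds z. u w = v w"
  shows "has_lap v g L z"
proof -
  have aux: "twice_diff (\<lambda>t. v (z + c * of_real t)) d1 d2"
    if td: "twice_diff (\<lambda>t. u (z + c * of_real t)) d1 d2" for c d1 d2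
  proof -
    obtain p where p: "\<forall>\<^sub>F t in nhds 0. ((\<lambda>t. u (z + c * of_real t)) has_real_derivative p t) (at t)"
        "p 0 = d1" "(p has_real_derivative d2) (at 0)"
      using td unfolding twice_diff_def by blast
    have "filterlim (\<lambda>t::real. z + c * of_real t) (nhds (z + c * of_real 0)) (nhds 0)"
      by (intro tendsto_intros filterlim_ident)
    then have "filterlim (\<lambda>t::real. z + c * of_real t) (nhds z) (nhds 0)" by simp
    then have "\<forall>\<^sub>F t in nhds (0::real). u (z + c * of_real t) = v (z + c * of_real t)"
      by (rule eventually_compose_filterlim[OF assms(2)])
    then have "\<forall>\<^sub>F t in nhds (0::real). \<forall>\<^sub>F s in nhds t. u (z + c * of_real s) = v (z + c * of_real s)"
      by (simp add: eventually_eventually)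
    with p(1) have "\<forall>\<^sub>F t in nhds 0. ((\<lambda>t. v (z + c * of_real t)) has_real_derivative p t) (at t)"
    proof eventually_elim
      case (elim t)
      then show ?case using DERIV_cong_ev[OF refl elim(2) refl] by blast
    qed
    with p show ?thesis unfolding twice_diff_def by blast
  qed
  show ?thesis
  proof (rule has_lapE[OF assms(1)])
    fix p q
    assume a: "twice_diff (\<lambda>t. u (z + of_real t)) (Re g) p"
      "twice_diff (\<lambda>t. u (z + \<i> * of_real t)) (- Im g) q" "L = p + q"
    show ?thesis
      by (rule has_lapI[OF _ aux[OF a(2)]]) (use aux[of 1] a in simp_all)
  qed
qed

text \<open>Restriction to the two coordinate lines through z reduces this to the second derivative
  test. All later arguments reach a contradiction through this lemma, so \<open>has_lap\<close>
  records second derivatives at one point only and no smoothness is carried around.\<close>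

lemma has_lap_local_max:
  assumes "has_lap u g L z" "\<forall>\<^sub>F w in nhds z. u w \<le> u z"
  shows "L \<le> 0"
proof -
  obtain p q where 1: "twice_diff (\<lambda>t. u (z + of_real t)) (Re g) p"
     "twice_diff (\<lambda>t. u (z + \<i> * of_real t)) (Re (\<i> * g)) q" "p + q = L"
    using assms(1) unfolding has_lap_def by blast
  have aux: "\<forall>\<^sub>F t in nhds (0::real). u (z + c * of_real t) \<le> u z" for c
  proof -
    have "filterlim (\<lambda>t::real. z + c * of_real t) (nhds (z + c * of_real 0)) (nhds 0)"
      by (intro tendsto_intros filterlim_ident)
    then have "filterlim (\<lambda>t::real. z + c * of_real t) (nhds z) (nhds 0)" by simp
    then show ?thesis
      by (rule eventually_compose_filterlim[OF assms(2)])
  qed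
  have "p \<le> 0" by (rule twice_diff_local_max[OF 1(1)]) (use aux[of 1] in simp)
  moreover have "q \<le> 0" by (rule twice_diff_local_max[OF 1(2)]) (use aux[of \<i>] in simp)
  ultimately show ?thesis using 1(3) by simp
qed

section \<open>Laplacians of functions built from holomorphic maps\<close>

lemma twice_diff_Re_holomorphic:
  assumes "f holomorphic_on S" "open S" "z \<in> S"
  shows "twice_diff (\<lambda>t. Re (f (z + c * of_real t))) (Re (c * deriv f z)) (Re (c\<^sup>2 * deriv (deriv f) z))"
proof -
  have lim: "filterlim (\<lambda>t::real. z + c * of_real t) (nhds z) (nhds 0)"
  proof -
    have "filterlim (\<lambda>t::real. z + c * of_real t) (nhds (z + c * of_real 0)) (nhds 0)"
      by (intro tendsto_intros filterlim_ident)
    then show ?thesis by simp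
  qed
  have S: "\<forall>\<^sub>F t in nhds (0::real). z + c * of_real t \<in> S"
    by (rule eventually_compose_filterlim[OF _ lim]) (use assms in \<open>auto intro: eventually_nhds_in_open\<close>)
  have D: "((\<lambda>t. Re (a * g (z + c * of_real t))) has_real_derivative
       Re (c * (a * deriv g (z + c * of_real t)))) (at t)"
    if g: "g holomorphic_on S" and t: "z + c * of_real t \<in> S" for g t a
  proof -
    have "(g has_field_derivative deriv g (z + c * of_real t)) (at (z + c * of_real t))"
      using g t assms(2) holomorphic_derivI by blast
    moreover have "((\<lambda>w. z + c * w) has_field_derivative c) (at (of_real t))"
      by (auto intro!: derivative_eq_intros)
    ultimately have "((\<lambda>w. a * g (z + c * w)) has_field_derivative (a * (deriv g (z + c * of_real t) * c))) (at (of_real t))"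
      by (intro DERIV_cmult DERIV_chain2[where f = g])
    then have "((\<lambda>w. a * g (z + c * w)) has_field_derivative (a * (c * deriv g (z + c * of_real t)))) (at (of_real t))"
      by (simp add: mult.commute)
    then have "((\<lambda>t. a * g (z + c * of_real t)) has_vector_derivative (a * (c * deriv g (z + c * of_real t)))) (at t)"
      using has_vector_derivative_real_field by blast
    then have "((\<lambda>t. Re (a * g (z + c * of_real t))) has_vector_derivative Re (a * (c * deriv g (z + c * of_real t)))) (at t)"
      by (intro bounded_linear.has_vector_derivative[OF bounded_linear_Re])
    then show ?thesis
      by (simp add: has_real_derivative_iff_has_vector_derivative mult_ac)
  qed
  have hd: "deriv f holomorphic_on S" using assms by (intro holomorphic_deriv)
  have "\<forall>\<^sub>F t in nhds 0. ((\<lambda>t. Re (f (z + c * of_real t))) has_real_derivative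
       Re (c * deriv f (z + c * of_real t))) (at t)"
    using S by eventually_elim (use D[OF assms(1), of _ 1] in simp)
  moreover have "((\<lambda>t. Re (c * deriv f (z + c * of_real t))) has_real_derivative Re (c\<^sup>2 * deriv (deriv f) z)) (at 0)"
    using D[OF hd, of 0 c] assms(3) by (simp add: power2_eq_square mult_ac)
  ultimately show ?thesis unfolding twice_diff_def
    by (intro exI[of _ "\<lambda>t. Re (c * deriv f (z + c * of_real t))"]) simp
qed

text \<open>The second derivative in direction c is the real part of c^2 f''. The directions 1 and
  \<i> contribute opposite values, which is harmonicity.\<close>

lemma has_lap_Re:
  assumes "f holomorphic_on S" "open S" "z \<in> S"
  shows "has_lap (\<lambda>w. Re (f w)) (deriv f z) 0 z"
  using twice_diff_Re_holomorphic[OF assms, of 1] twice_diff_Re_holomorphic[OF assms, of \<i>]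
  unfolding has_lap_def by (intro exI conjI) auto

lemma has_lap_norm2:
  assumes "f holomorphic_on S" "open S" "z \<in> S"
  shows "has_lap (\<lambda>w. (cmod (f w))\<^sup>2) (2 * cnj (f z) * deriv f z) (4 * (cmod (deriv f z))\<^sup>2) z"
proof -
  have d: "(f has_field_derivative deriv f z) (at z)" using assms holomorphic_derivI by blast
  have d': "deriv (\<lambda>w. -\<i> * f w) z = -\<i> * deriv f z"
    using d by (intro DERIV_imp_deriv) (auto intro!: derivative_eq_intros)
  have 1: "has_lap (\<lambda>w. Re (f w)) (deriv f z) 0 z" by (rule has_lap_Re[OF assms])
  \<comment> \<open>The imaginary part of f is the real part of -\<i> f, so the harmonicity lemma
    covers it too.\<close>
  have "(\<lambda>w. -\<i> * f w) holomorphic_on S" using assms by (intro holomorphic_intros)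
  from has_lap_Re[OF this assms(2,3)] d'
  have 2: "has_lap (\<lambda>w. Im (f w)) (-\<i> * deriv f z) 0 z" by simp
  have g: "of_real (Re (f z)) * deriv f z + of_real (Re (f z)) * deriv f z +
      (of_real (Im (f z)) * (-\<i> * deriv f z) + of_real (Im (f z)) * (-\<i> * deriv f z))
      = 2 * cnj (f z) * deriv f z"
    by (simp add: complex_eq_iff algebra_simps)
  have L: "Re (f z) * 0 + Re (f z) * 0 + 2 * Re (deriv f z * cnj (deriv f z)) +
     (Im (f z) * 0 + Im (f z) * 0 + 2 * Re ((-\<i> * deriv f z) * cnj (-\<i> * deriv f z))) =
     4 * (cmod (deriv f z))\<^sup>2"
    unfolding cmod_power2 by (simp add: algebra_simps power2_eq_square)
  have fn: "(\<lambda>w. Re (f w) * Re (f w) + Im (f w) * Im (f w)) = (\<lambda>w. (cmod (f w))\<^sup>2)"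
    unfolding cmod_power2 by (simp add: power2_eq_square)
  show ?thesis
    using has_lap_add[OF has_lap_mult[OF 1 1] has_lap_mult[OF 2 2]] unfolding g L fn .
qed

text \<open>The detour through ln |k|^2 stays within the available rules: the term 4 |k'|^2 / |k|^2
  from the Laplacian of |k|^2 is cancelled by its squared gradient divided by |k|^4.\<close>

lemma has_lap_ln_norm:
  assumes "k holomorphic_on S" "open S" "z \<in> S" "k z \<noteq> 0"
  shows "\<exists>g. has_lap (\<lambda>w. ln (cmod (k w))) g 0 z"
proof -
  have pos: "(cmod (k z))\<^sup>2 > 0" using assms by simp
  have ev: "\<forall>\<^sub>F s in nhds ((cmod (k z))\<^sup>2). (ln has_real_derivative inverse s) (at s)"
    using eventually_nhds_in_open[of "{0<..}" "(cmod (k z))\<^sup>2"] pos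
    by (auto elim!: eventually_mono intro!: derivative_eq_intros simp: divide_inverse)
  have d2: "(inverse has_real_derivative - (1 / ((cmod (k z))\<^sup>2)\<^sup>2)) (at ((cmod (k z))\<^sup>2))"
    using pos assms(4) by (auto intro!: derivative_eq_intros simp: field_simps power2_eq_square)
  have "has_lap (\<lambda>w. ln ((cmod (k w))\<^sup>2))
     (of_real (inverse ((cmod (k z))\<^sup>2)) * (2 * cnj (k z) * deriv k z)) 0 z"
    using has_lap_compose[OF has_lap_norm2[OF assms(1-3)] ev d2] assms(4)
    by (simp add: norm_mult power_mult_distrib power2_eq_square field_simps)
  then have "has_lap (\<lambda>w. 1/2 * ln ((cmod (k w))\<^sup>2)) (of_real (1/2) * (of_real (inverse ((cmod (k z))\<^sup>2)) * (2 * cnj (k z) * deriv k z))) (1/2 * 0) z"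
    by (rule has_lap_cmult)
  moreover have "1/2 * ln ((cmod (k w))\<^sup>2) = ln (cmod (k w))" for w
    by (cases "k w = 0") (auto simp: ln_realpow)
  ultimately show ?thesis by auto
qed

lemma has_lap_ln_one_minus:
  assumes u: "has_lap u g L z" and "u z < 1"
  shows "has_lap (\<lambda>w. ln (1 - u w)) (- of_real (1 / (1 - u z)) * g)
           (- (L / (1 - u z) + (cmod g)\<^sup>2 / (1 - u z)\<^sup>2)) z"
proof -
  have ev: "\<forall>\<^sub>F s in nhds (u z). ((\<lambda>s. ln (1 - s)) has_real_derivative - (1 / (1 - s))) (at s)"
    using eventually_nhds_in_open[of "{..<1}" "u z"] assms(2)
    by (auto elim!: eventually_mono intro!: derivative_eq_intros simp: divide_inverse)
  have d2: "((\<lambda>s. - (1 / (1 - s))) has_real_derivative - (1 / (1 - u z)\<^sup>2)) (at (u z))"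
    using assms(2) by (auto intro!: derivative_eq_intros simp: power2_eq_square)
  show ?thesis
    using has_lap_compose[OF u ev d2] by (simp add: algebra_simps)
qed

text \<open>This is Liouville's equation for |f'| / (1 - |f|^2), that is, curvature exactly -4. The
  two terms of the general formula merge because (1 - |f|^2) + |f|^2 = 1.\<close>

lemma has_lap_ln_one_minus_norm2:
  assumes "f holomorphic_on S" "open S" "z \<in> S" "cmod (f z) < 1"
  shows "\<exists>g. has_lap (\<lambda>w. ln (1 - (cmod (f w))\<^sup>2)) g
            (- (4 * (cmod (deriv f z))\<^sup>2 / (1 - (cmod (f z))\<^sup>2)\<^sup>2)) z"
proof -
  define s where "s = 1 - (cmod (f z))\<^sup>2"
  have s: "s > 0" using assms(4) by (simp add: s_def abs_square_less_1)
  have "(cmod (f z))\<^sup>2 < 1" using s by (simp add: s_def)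
  from has_lap_ln_one_minus[OF has_lap_norm2[OF assms(1-3)] this]
  have "\<exists>g. has_lap (\<lambda>w. ln (1 - (cmod (f w))\<^sup>2)) g
     (- (4 * (cmod (deriv f z))\<^sup>2 / s + (cmod (2 * cnj (f z) * deriv f z))\<^sup>2 / s\<^sup>2)) z"
    unfolding s_def by blast
  also have "4 * (cmod (deriv f z))\<^sup>2 / s + (cmod (2 * cnj (f z) * deriv f z))\<^sup>2 / s\<^sup>2
      = (4 * (cmod (deriv f z))\<^sup>2 * s + 4 * (cmod (f z))\<^sup>2 * (cmod (deriv f z))\<^sup>2) / s\<^sup>2"
    using s by (simp add: norm_mult power_mult_distrib field_simps power2_eq_square)
  also have "\<dots> = 4 * (cmod (deriv f z))\<^sup>2 * (s + (cmod (f z))\<^sup>2) / s\<^sup>2"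
    by (simp add: algebra_simps)
  also have "s + (cmod (f z))\<^sup>2 = 1" by (simp add: s_def)
  finally show ?thesis by (simp add: s_def)
qed

section \<open>Pseudometrics of curvature at most -4 and Ahlfors' lemma\<close>

lemma one_minus_norm2_pos: "cmod w < 1 \<Longrightarrow> 0 < 1 - (cmod w)\<^sup>2"
  by (simp add: abs_square_less_1)

lemma eventually_holomorphic_nonzero:
  assumes "k holomorphic_on S" "open S" "z \<in> S" "k z \<noteq> 0"
  shows "\<forall>\<^sub>F w in nhds z. w \<in> S \<and> k w \<noteq> 0"
proof -
  have "isCont k z" using holomorphic_on_imp_continuous_on[OF assms(1)] assms(2,3)
    by (simp add: continuous_on_eq_continuous_at)
  then have "\<forall>\<^sub>F w in nhds z. k w \<noteq> 0" using assms(4)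
    by (intro tendsto_imp_eventually_ne[of k "k z"]) (auto simp: isCont_def tendsto_at_iff_tendsto_nhds)
  then show ?thesis using eventually_nhds_in_open[OF assms(2,3)] by eventually_elim auto
qed

section \<open>Disc automorphisms and invariance of the hyperbolic derivative\<close>

definition disc_moebius :: "complex \<Rightarrow> complex \<Rightarrow> complex" where
  "disc_moebius a z = (z - a) / (1 - cnj a * z)"

lemma moebius_denom_nonzero:
  assumes "cmod a < 1" "cmod z \<le> 1"
  shows "1 - cnj a * z \<noteq> 0"
proof
  assume "1 - cnj a * z = 0"
  then have "cmod (cnj a * z) = 1" by (metis eq_iff_diff_eq_0 norm_one)
  moreover have "cmod (cnj a * z) \<le> cmod a * 1"
    using assms by (simp add: norm_mult mult_left_le)
  ultimately show False using assms by simp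
qed

lemma moebius_norm:
  assumes "cmod a < 1" "cmod z \<le> 1"
  shows "1 - (cmod (disc_moebius a z))\<^sup>2 = (1 - (cmod a)\<^sup>2) * (1 - (cmod z)\<^sup>2) / (cmod (1 - cnj a * z))\<^sup>2"
proof -
  have nz: "(cmod (1 - cnj a * z))\<^sup>2 \<noteq> 0" using moebius_denom_nonzero[OF assms] by simp
  have "(cmod (1 - cnj a * z))\<^sup>2 - (cmod (z - a))\<^sup>2 = (1 - (cmod a)\<^sup>2) * (1 - (cmod z)\<^sup>2)"
    unfolding cmod_power2 by (simp add: power2_eq_square algebra_simps)
  then show ?thesis
    using nz by (simp add: disc_moebius_def norm_divide power_divide diff_divide_distrib[symmetric] field_simps)
qed

lemma moebius_in_disc:
  assumes "cmod a < 1" "cmod z < 1"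
  shows "cmod (disc_moebius a z) < 1"
proof -
  have "0 < 1 - (cmod (disc_moebius a z))\<^sup>2"
    unfolding moebius_norm[OF assms(1) less_imp_le[OF assms(2)]]
    using one_minus_norm2_pos[OF assms(1)] one_minus_norm2_pos[OF assms(2)]
      moebius_denom_nonzero[OF assms(1) less_imp_le[OF assms(2)]] by simp
  then show ?thesis by (simp add: abs_square_less_1)
qed

lemma moebius_inverse:
  assumes "cmod a < 1" "cmod z < 1"
  shows "disc_moebius (- a) (disc_moebius a z) = z"
proof -
  have nz: "1 - cnj a * z \<noteq> 0" using moebius_denom_nonzero assms by simp
  have "1 - cnj a * a \<noteq> 0" using moebius_denom_nonzero[OF assms(1), of a] assms by simp
  then have nz2: "1 - cnj a * z + cnj a * (z - a) \<noteq> 0" by (simp add: algebra_simps)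
  have "disc_moebius (- a) (disc_moebius a z) = ((z - a) + a * (1 - cnj a * z)) / (1 - cnj a * z + cnj a * (z - a))"
    using nz nz2 by (simp add: disc_moebius_def divide_simps)
  also have "(z - a) + a * (1 - cnj a * z) = z * (1 - cnj a * z + cnj a * (z - a))"
    by (simp add: algebra_simps)
  finally show ?thesis using nz2 by simp
qed

lemma moebius_has_derivative:
  assumes "cmod a < 1" "cmod z \<le> 1"
  shows "(disc_moebius a has_field_derivative (1 - of_real ((cmod a)\<^sup>2)) / (1 - cnj a * z)\<^sup>2) (at z)"
proof -
  have nz: "1 - cnj a * z \<noteq> 0" using moebius_denom_nonzero assms by simp
  have "((\<lambda>z. (z - a) / (1 - cnj a * z)) has_field_derivative
      ((1 - cnj a * z) - (z - a) * (- cnj a)) / (1 - cnj a * z)\<^sup>2) (at z)"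
    using nz by (auto intro!: derivative_eq_intros simp: power2_eq_square)
  also have "(1 - cnj a * z) - (z - a) * (- cnj a) = 1 - a * cnj a" by (simp add: algebra_simps)
  also have "a * cnj a = of_real ((cmod a)\<^sup>2)" by (metis complex_norm_square)
  finally show ?thesis by (simp add: disc_moebius_def[abs_def])
qed

lemma deriv_moebius:
  assumes "cmod a < 1" "cmod z \<le> 1"
  shows "deriv (disc_moebius a) z = (1 - of_real ((cmod a)\<^sup>2)) / (1 - cnj a * z)\<^sup>2"
  by (rule DERIV_imp_deriv[OF moebius_has_derivative[OF assms]])

text \<open>Equality in the Schwarz-Pick inequality: automorphisms are hyperbolic isometries. The
  invariance of \<open>hyp_deriv\<close> under postcomposition rests on this identity.\<close>

lemma norm_deriv_moebius:
  assumes "cmod a < 1" "cmod z < 1"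
  shows "cmod (deriv (disc_moebius a) z) * (1 - (cmod z)\<^sup>2) = 1 - (cmod (disc_moebius a z))\<^sup>2"
proof -
  have "cmod (1 - of_real ((cmod a)\<^sup>2)) = 1 - (cmod a)\<^sup>2"
    using one_minus_norm2_pos[OF assms(1)]
    by (metis abs_of_pos norm_of_real of_real_1 of_real_diff)
  then show ?thesis
    using assms by (simp add: deriv_moebius moebius_norm norm_divide norm_power)
qed

lemma deriv_moebius_nonzero:
  assumes "cmod a < 1" "cmod z < 1"
  shows "deriv (disc_moebius a) z \<noteq> 0"
  using norm_deriv_moebius[OF assms] one_minus_norm2_pos[OF moebius_in_disc[OF assms]] by auto

lemma moebius_holomorphic: "cmod a < 1 \<Longrightarrow> disc_moebius a holomorphic_on cball 0 1"
  unfolding disc_moebius_def[abs_def]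
  by (intro holomorphic_intros) (use moebius_denom_nonzero in auto)

lemma selfmap_in_disc: "holomorphic_selfmap f \<Longrightarrow> cmod z < 1 \<Longrightarrow> cmod (f z) < 1"
  by (force simp: holomorphic_selfmap_def)

lemma selfmap_moebius_compose:
  assumes f: "holomorphic_selfmap f" and a: "cmod a < 1"
  shows "holomorphic_selfmap (\<lambda>z. disc_moebius a (f z))"
proof -
  have "(disc_moebius a \<circ> f) holomorphic_on \<D>"
    using f a by (intro holomorphic_on_compose_gen[OF _ moebius_holomorphic[OF a]])
      (auto simp: holomorphic_selfmap_def)
  moreover have "disc_moebius a (f z) \<in> \<D>" if "z \<in> \<D>" for z
    using moebius_in_disc[OF a selfmap_in_disc[OF f]] that by simp
  ultimately show ?thesis by (auto simp: holomorphic_selfmap_def o_def)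
qed

lemma deriv_moebius_compose:
  assumes f: "holomorphic_selfmap f" and a: "cmod a < 1" and z: "z \<in> \<D>"
  shows "deriv (\<lambda>z. disc_moebius a (f z)) z = deriv (disc_moebius a) (f z) * deriv f z"
proof -
  have "(f has_field_derivative deriv f z) (at z)"
    using f z holomorphic_derivI[of f \<D> z] by (auto simp: holomorphic_selfmap_def)
  moreover have "(disc_moebius a has_field_derivative deriv (disc_moebius a) (f z)) (at (f z))"
    using moebius_has_derivative[OF a, of "f z"] selfmap_in_disc[OF f, of z] z
    by (simp add: deriv_moebius[OF a])
  ultimately show ?thesis by (intro DERIV_imp_deriv DERIV_chain2)
qed

lemma hyp_deriv_moebius_compose:
  assumes f: "holomorphic_selfmap f" and a: "cmod a < 1" and z: "z \<in> \<D>"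
  shows "hyp_deriv (\<lambda>z. disc_moebius a (f z)) z = hyp_deriv f z"
proof -
  have fz: "cmod (f z) < 1" using selfmap_in_disc[OF f] z by simp
  have p: "1 - (cmod (f z))\<^sup>2 > 0" using one_minus_norm2_pos[OF fz] .
  have p2: "1 - (cmod (disc_moebius a (f z)))\<^sup>2 > 0" using one_minus_norm2_pos[OF moebius_in_disc[OF a fz]] .
  show ?thesis
    unfolding hyp_deriv_def deriv_moebius_compose[OF assms] norm_mult
    using norm_deriv_moebius[OF a fz] p p2 by (simp add: divide_simps mult_ac)
qed

text \<open>The pseudometric is \<open>|\<phi>| U\<close>; since \<open>ln |\<phi>|\<close> is harmonic off the zeros of \<open>\<phi>\<close>, the inequality
  says that its curvature is at most \<open>-4\<close> there.\<close>

definition sk_metric :: "(complex \<Rightarrow> complex) \<Rightarrow> (complex \<Rightarrow> real) \<Rightarrow> bool" where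
  "sk_metric \<phi> U \<longleftrightarrow> \<phi> holomorphic_on \<D> \<and> continuous_on \<D> U \<and>
     (\<forall>z\<in>\<D>. U z > 0 \<and> (\<exists>g L. has_lap (\<lambda>w. ln (U w)) g L z \<and> 4 * (cmod (\<phi> z))\<^sup>2 * (U z)\<^sup>2 \<le> L))"

lemma sk_metric_selfmap:
  assumes f: "holomorphic_selfmap f"
  shows "sk_metric (deriv f) (\<lambda>z. 1 / (1 - (cmod (f z))\<^sup>2))"
proof -
  have hol: "f holomorphic_on \<D>" using f by (simp add: holomorphic_selfmap_def)
  have pos: "1 - (cmod (f z))\<^sup>2 > 0" if "z \<in> \<D>" for z
    using one_minus_norm2_pos[OF selfmap_in_disc[OF f]] that by simp
  have "\<exists>g L. has_lap (\<lambda>w. ln (1 / (1 - (cmod (f w))\<^sup>2))) g L z \<and>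
      4 * (cmod (deriv f z))\<^sup>2 * (1 / (1 - (cmod (f z))\<^sup>2))\<^sup>2 \<le> L" if z: "z \<in> \<D>" for z
  proof -
    obtain g where "has_lap (\<lambda>w. ln (1 - (cmod (f w))\<^sup>2)) g
            (- (4 * (cmod (deriv f z))\<^sup>2 / (1 - (cmod (f z))\<^sup>2)\<^sup>2)) z"
      using has_lap_ln_one_minus_norm2[OF hol open_ball z] selfmap_in_disc[OF f] z by auto
    from has_lap_uminus[OF this]
    have "has_lap (\<lambda>w. ln (1 / (1 - (cmod (f w))\<^sup>2))) (- g)
       (4 * (cmod (deriv f z))\<^sup>2 / (1 - (cmod (f z))\<^sup>2)\<^sup>2) z"
      unfolding minus_minus
    proof (rule has_lap_cong)
      show "\<forall>\<^sub>F w in nhds z. - ln (1 - (cmod (f w))\<^sup>2) = ln (1 / (1 - (cmod (f w))\<^sup>2))"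
        using eventually_nhds_in_open[OF open_ball z] by eventually_elim (use pos in \<open>simp add: ln_div\<close>)
    qed
    then show ?thesis by (force simp: power_divide)
  qed
  moreover have "continuous_on \<D> (\<lambda>z. 1 / (1 - (cmod (f z))\<^sup>2))"
    using holomorphic_on_imp_continuous_on[OF hol] pos
    by (intro continuous_intros) (auto simp: less_imp_neq[THEN not_sym])
  ultimately show ?thesis
    using hol pos unfolding sk_metric_def by (auto intro: holomorphic_deriv)
qed

lemma global_max_on_ball:
  fixes G :: "complex \<Rightarrow> real"
  assumes "continuous_on (ball 0 R) G" "z1 \<in> ball 0 R" "\<rho> < R"
    and "\<And>z. z \<in> ball 0 R \<Longrightarrow> \<rho> \<le> cmod z \<Longrightarrow> G z < G z1"
  shows "\<exists>z0\<in>ball 0 R. \<forall>z\<in>ball 0 R. G z \<le> G z0"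
proof -
  have z1: "cmod z1 < \<rho>" using assms(4)[of z1] assms(2) by force
  have "continuous_on (cball 0 \<rho>) G"
    using assms(3) by (intro continuous_on_subset[OF assms(1)]) auto
  moreover have "cball (0::complex) \<rho> \<noteq> {}" using order_le_less_trans[OF norm_ge_zero z1] by simp
  ultimately obtain z0 where z0: "z0 \<in> cball 0 \<rho>" "\<And>z. z \<in> cball 0 \<rho> \<Longrightarrow> G z \<le> G z0"
    using continuous_attains_sup[of "cball 0 \<rho>" G] by auto
  have "G z \<le> G z0" if "z \<in> ball 0 R" for z
    using z0(2)[of z] z0(2)[of z1] assms(4)[OF that] z1 by (cases "cmod z \<le> \<rho>") fastforce+
  then show ?thesis using z0(1) assms(3) by (intro bexI[of _ z0]) auto
qed

text \<open>The bounded quantity is the quotient of |\<phi>| U by |F'| / (1 - |F|^2) with the zeros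
  of F' cancelled. Where it exceeds 1, the first metric is the larger one, so the curvature
  inequality makes the logarithm of the quotient subharmonic. The boundary hypothesis forces a value
  above 1 to produce an interior maximum, which is then impossible.\<close>

lemma ahlfors_comparison:
  assumes R: "R \<le> 1" and F: "F holomorphic_on ball 0 R" "\<And>z. z \<in> ball 0 R \<Longrightarrow> cmod (F z) < 1"
    and k: "k holomorphic_on ball 0 R"
    and sk: "sk_metric \<phi> U" and \<phi>: "\<And>z. z \<in> ball 0 R \<Longrightarrow> \<phi> z = deriv F z * k z"
    and bd: "\<And>e. e > 0 \<Longrightarrow> \<exists>\<rho><R. \<forall>z\<in>ball 0 R. \<rho> \<le> cmod z \<longrightarrow>
               cmod (k z) * U z * (1 - (cmod (F z))\<^sup>2) \<le> 1 + e"
    and z: "z \<in> ball 0 R"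
  shows "cmod (k z) * U z * (1 - (cmod (F z))\<^sup>2) \<le> 1"
proof (rule ccontr)
  define G where "G = (\<lambda>z. cmod (k z) * U z * (1 - (cmod (F z))\<^sup>2))"
  assume "\<not> ?thesis"
  then have Gz: "G z > 1" by (simp add: G_def)
  have RD: "ball 0 R \<subseteq> \<D>" using R by auto
  have Up: "U w > 0" if "w \<in> ball 0 R" for w using sk RD that unfolding sk_metric_def by blast
  have Pp: "1 - (cmod (F w))\<^sup>2 > 0" if "w \<in> ball 0 R" for w
    using one_minus_norm2_pos[OF F(2)[OF that]] .
  have contG: "continuous_on (ball 0 R) G"
    unfolding G_def using sk RD F k
    by (intro continuous_intros holomorphic_on_imp_continuous_on)
       (auto simp: sk_metric_def intro: continuous_on_subset)
  define s where "s = ln (G z)"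
  have s: "s > 0" using Gz by (simp add: s_def)
  have Gs: "G z = exp s" using Gz by (simp add: s_def)
  \<comment> \<open>The factor makes the Laplacian strictly positive also at the zeros of \<open>deriv F\<close>.\<close>
  define H where "H = (\<lambda>w. G w * exp (s/3 * (cmod w)\<^sup>2))"
  have contH: "continuous_on (ball 0 R) H" unfolding H_def by (intro continuous_intros contG)
  have Hz: "G z \<le> H z" using Gz s by (simp add: H_def)
  \<comment> \<open>The excess s is divided in thirds: one for the weight, one for the boundary
    bound, and one that keeps the boundary values of \<open>H\<close> strictly below
    \<open>H z\<close>.\<close>
  have "exp (s/3) - 1 > 0" using s by simp
  from bd[OF this] obtain \<rho> where \<rho>: "\<rho> < R" "\<And>w. w \<in> ball 0 R \<Longrightarrow> \<rho> \<le> cmod w \<Longrightarrow> G w \<le> exp (s/3)"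
    unfolding G_def by auto
  have bdH: "H w < H z" if w: "w \<in> ball 0 R" "\<rho> \<le> cmod w" for w
  proof -
    have "(cmod w)\<^sup>2 \<le> 1" using w R by (simp add: power_le_one)
    then have "exp (s/3 * (cmod w)\<^sup>2) \<le> exp (s/3)" using s by (simp add: mult_left_le)
    then have "H w \<le> exp (s/3) * exp (s/3)"
      unfolding H_def using \<rho>(2)[OF w] by (intro mult_mono) auto
    also have "\<dots> = exp (2 * s / 3)" by (simp add: exp_add[symmetric])
    also have "\<dots> < exp s" using s by simp
    finally show ?thesis using Hz Gs by simp
  qed
  obtain z0 where z0: "z0 \<in> ball 0 R" "\<And>w. w \<in> ball 0 R \<Longrightarrow> H w \<le> H z0"
    using global_max_on_ball[OF contH z \<rho>(1) bdH] by blast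
  have G0: "G z0 > 1"
  proof (rule ccontr)
    assume "\<not> G z0 > 1"
    moreover have "(cmod z0)\<^sup>2 \<le> 1" using z0(1) R by (simp add: power_le_one)
    then have "exp (s/3 * (cmod z0)\<^sup>2) \<le> exp (s/3)" using s by (simp add: mult_left_le)
    ultimately have "H z0 \<le> 1 * exp (s/3)"
      unfolding H_def by (intro mult_mono) auto
    also have "\<dots> < exp s" using s by simp
    finally show False using z0(2)[OF z] Hz Gs by simp
  qed
  then have k0: "k z0 \<noteq> 0" by (auto simp: G_def)
  obtain g1 where g1: "has_lap (\<lambda>w. ln (cmod (k w))) g1 0 z0"
    using has_lap_ln_norm[OF k open_ball z0(1) k0] by blast
  obtain g2 L where g2: "has_lap (\<lambda>w. ln (U w)) g2 L z0" "4 * (cmod (\<phi> z0))\<^sup>2 * (U z0)\<^sup>2 \<le> L"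
    using sk RD z0(1) unfolding sk_metric_def by blast
  obtain g3 where g3: "has_lap (\<lambda>w. ln (1 - (cmod (F w))\<^sup>2)) g3
            (- (4 * (cmod (deriv F z0))\<^sup>2 / (1 - (cmod (F z0))\<^sup>2)\<^sup>2)) z0"
    using has_lap_ln_one_minus_norm2[OF F(1) open_ball z0(1) F(2)[OF z0(1)]] by blast
  have g4: "has_lap (\<lambda>w. s/3 * (cmod w)\<^sup>2) (of_real (s/3) * (2 * cnj z0 * 1)) (s/3 * (4 * (cmod 1)\<^sup>2)) z0"
    using has_lap_cmult[OF has_lap_norm2[of "\<lambda>w. w" UNIV z0], of "s/3"] by simp
  define M where "M = L - 4 * (cmod (deriv F z0))\<^sup>2 / (1 - (cmod (F z0))\<^sup>2)\<^sup>2 + 4 * s / 3"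
  obtain g where "has_lap (\<lambda>w. ln (cmod (k w)) + ln (U w) + ln (1 - (cmod (F w))\<^sup>2) + s/3 * (cmod w)\<^sup>2) g M z0"
    using has_lap_add[OF has_lap_add[OF has_lap_add[OF g1 g2(1)] g3] g4] by (auto simp: M_def mult.commute)
  moreover have ev: "\<forall>\<^sub>F w in nhds z0. w \<in> ball 0 R \<and> k w \<noteq> 0"
    by (rule eventually_holomorphic_nonzero[OF k open_ball z0(1) k0])
  have eq: "ln (cmod (k w)) + ln (U w) + ln (1 - (cmod (F w))\<^sup>2) + s/3 * (cmod w)\<^sup>2 = ln (H w)"
    "H w > 0" if "w \<in> ball 0 R" "k w \<noteq> 0" for w
    unfolding H_def G_def using Up[OF that(1)] Pp[OF that(1)] that(2) by (simp_all add: ln_mult)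
  have "\<forall>\<^sub>F w in nhds z0. ln (cmod (k w)) + ln (U w) + ln (1 - (cmod (F w))\<^sup>2) + s/3 * (cmod w)\<^sup>2 \<le>
     ln (cmod (k z0)) + ln (U z0) + ln (1 - (cmod (F z0))\<^sup>2) + s/3 * (cmod z0)\<^sup>2"
    using ev
  proof eventually_elim
    case (elim w)
    show ?case unfolding eq(1)[OF conjunct1[OF elim] conjunct2[OF elim]] eq(1)[OF z0(1) k0]
      using z0(2)[of w] eq(2)[of w] elim by simp
  qed
  ultimately have "M \<le> 0" by (rule has_lap_local_max)
  moreover have "4 * (cmod (deriv F z0))\<^sup>2 / (1 - (cmod (F z0))\<^sup>2)\<^sup>2 \<le> L"
  proof -
    have "4 * (cmod (deriv F z0))\<^sup>2 / (1 - (cmod (F z0))\<^sup>2)\<^sup>2 * 1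
        \<le> 4 * (cmod (deriv F z0))\<^sup>2 / (1 - (cmod (F z0))\<^sup>2)\<^sup>2 * (G z0)\<^sup>2"
      using G0 by (intro mult_left_mono) (auto simp: one_le_power)
    also have "\<dots> = 4 * (cmod (\<phi> z0))\<^sup>2 * (U z0)\<^sup>2"
    proof -
      have "p \<noteq> 0 \<Longrightarrow> 4 * d\<^sup>2 / p\<^sup>2 * (k' * u * p)\<^sup>2 = 4 * (d * k')\<^sup>2 * u\<^sup>2" for p d k' u :: real
        by (simp add: power_mult_distrib)
      then show ?thesis using Pp[OF z0(1)] unfolding G_def \<phi>[OF z0(1)] norm_mult by simp
    qed
    finally show ?thesis using g2(2) by simp
  qed
  ultimately show False using s by (simp add: M_def)
qed

text \<open>On a smaller disc of radius r the comparison map is z / r, whose derivative has no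
  zeros. The hyperbolic metric of that disc blows up on |z| = r while |\<phi>| U stays bounded
  there, so the boundary hypothesis of the comparison holds; then r tends to 1.\<close>

lemma ahlfors_lemma:
  assumes sk: "sk_metric \<phi> U" and z: "z \<in> \<D>"
  shows "cmod (\<phi> z) * U z * (1 - (cmod z)\<^sup>2) \<le> 1"
proof -
  have main: "cmod (\<phi> z) * r * U z * (1 - (cmod z / r)\<^sup>2) \<le> 1" if r: "cmod z < r" "r < 1" for r
  proof -
    have r0: "r > 0" using r(1) by (meson norm_ge_zero order_le_less_trans)
    have sub: "cball 0 r \<subseteq> \<D>" using r by auto
    have "continuous_on (cball 0 r) (\<lambda>w. cmod (\<phi> w * of_real r) * U w)"
      using sk sub by (intro continuous_intros)
        (auto simp: sk_metric_def intro: continuous_on_subset holomorphic_on_imp_continuous_on)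
    moreover have "cball (0::complex) r \<noteq> {}" using r0 by auto
    ultimately obtain w0 where w0: "\<forall>w\<in>cball 0 r. cmod (\<phi> w * of_real r) * U w \<le> cmod (\<phi> w0 * of_real r) * U w0"
      using continuous_attains_sup[OF compact_cball] by blast
    define M where "M = max 1 (cmod (\<phi> w0 * of_real r) * U w0)"
    have M: "M \<ge> 1" "\<And>w. w \<in> cball 0 r \<Longrightarrow> cmod (\<phi> w * of_real r) * U w \<le> M"
      using w0 unfolding M_def by fastforce+
    have "cmod (\<phi> z * of_real r) * U z * (1 - (cmod (z / of_real r))\<^sup>2) \<le> 1"
    proof (rule ahlfors_comparison[where R = r and \<phi> = \<phi> and U = U and z = z
          and k = "\<lambda>z. \<phi> z * of_real r" and F = "\<lambda>z. z / of_real r"])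
      show "(\<lambda>z. z / of_real r) holomorphic_on ball 0 r" using r0 by (intro holomorphic_intros) auto
      show "cmod (w / of_real r) < 1" if "w \<in> ball 0 r" for w
        using that r0 by (simp add: norm_divide)
      show "(\<lambda>z. \<phi> z * of_real r) holomorphic_on ball 0 r"
        using sk r(2) by (intro holomorphic_intros) (auto simp: sk_metric_def intro: holomorphic_on_subset subset_ball)
      show "\<phi> w = deriv (\<lambda>z. z / of_real r) w * (\<phi> w * of_real r)" if "w \<in> ball 0 r" for w
      proof -
        have "deriv (\<lambda>z. z / complex_of_real r) w = 1 / of_real r"
          using r0 by (intro DERIV_imp_deriv) (auto intro!: derivative_eq_intros)
        then show ?thesis using r0 by (auto simp: of_real_eq_0_iff)
      qed
      show "\<exists>\<rho><r. \<forall>w\<in>ball 0 r. \<rho> \<le> cmod w \<longrightarrow>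
          cmod (\<phi> w * of_real r) * U w * (1 - (cmod (w / of_real r))\<^sup>2) \<le> 1 + e" if "e > 0" for e
      proof (intro exI conjI ballI impI)
        \<comment> \<open>With t = |w| / r, the bound t >= 1 - 1 / (2 M) gives 1 - t^2 <= 2 (1 - t)
          <= 1 / M, which compensates the bound M for the metric.\<close>
        show "r * (1 - 1 / (2 * M)) < r" using r0 M(1) by simp
        fix w assume w: "w \<in> ball 0 r" "r * (1 - 1 / (2 * M)) \<le> cmod w"
        define t where "t = cmod w / r"
        have t: "t < 1" "1 - 1 / (2 * M) \<le> t" "0 \<le> t"
          using w r0 by (auto simp: t_def field_simps)
        have "1 - t\<^sup>2 = (1 - t) * (1 + t)" by (simp add: power2_eq_square algebra_simps)
        also have "\<dots> \<le> 1 / (2 * M) * 2" using t M(1) by (intro mult_mono) auto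
        finally have t2: "1 - t\<^sup>2 \<le> 1 / M" by simp
        have "0 \<le> 1 - t\<^sup>2" using t by (simp add: power_le_one)
        then have "cmod (\<phi> w * of_real r) * U w * (1 - t\<^sup>2) \<le> M * (1 - t\<^sup>2)"
          using w by (intro mult_right_mono M(2)) auto
        also have "\<dots> \<le> M * (1 / M)" using t2 M(1) by (intro mult_left_mono) auto
        finally show "cmod (\<phi> w * of_real r) * U w * (1 - (cmod (w / of_real r))\<^sup>2) \<le> 1 + e"
          using M(1) that r0 by (simp add: t_def norm_divide)
      qed
    qed (use r sk in auto)
    then show ?thesis using r0 by (simp add: norm_mult norm_divide)
  qed
  have "((\<lambda>r. cmod (\<phi> z) * r * U z * (1 - (cmod z / r)\<^sup>2)) \<longlongrightarrow> cmod (\<phi> z) * 1 * U z * (1 - (cmod z / 1)\<^sup>2)) (at_left 1)"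
    by (intro tendsto_intros) auto
  moreover have "\<forall>\<^sub>F r in at_left 1. cmod (\<phi> z) * r * U z * (1 - (cmod z / r)\<^sup>2) \<le> 1"
    using eventually_at_left_real[of "cmod z" 1] z by (auto elim!: eventually_mono intro!: main)
  ultimately show ?thesis
    using tendsto_upperbound[of _ _ "at_left (1::real)"] by fastforce
qed

text \<open>The hypothesis \<open>complete\<close> says that the hyperbolic derivative of F has
  lower limit at least 1 at the circle. Ahlfors' lemma bounds |\<phi>| U by the hyperbolic metric,
  hence near the circle by almost |F'| / (1 - |F|^2); this is the boundary condition that the
  comparison asks for.\<close>

lemma comparison_complete:
  assumes sk: "sk_metric \<phi> U" and F: "holomorphic_selfmap F" and k: "k holomorphic_on \<D>"
    and \<phi>: "\<And>z. z \<in> \<D> \<Longrightarrow> \<phi> z = deriv F z * k z"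
    and complete: "\<And>e. e > 0 \<Longrightarrow> \<exists>\<rho><1. \<forall>z. \<rho> \<le> cmod z \<and> cmod z < 1 \<longrightarrow>
       (1 - e) * (1 - (cmod (F z))\<^sup>2) \<le> (1 - (cmod z)\<^sup>2) * cmod (deriv F z)"
    and z: "z \<in> \<D>"
  shows "cmod (k z) * U z * (1 - (cmod (F z))\<^sup>2) \<le> 1"
proof (rule ahlfors_comparison[where R = 1 and \<phi> = \<phi> and U = U])
  fix e :: real assume e: "e > 0"
  define d where "d = e / (1 + e)"
  have d: "d > 0" "d < 1" "1 / (1 - d) = 1 + e" using e by (auto simp: d_def field_simps)
  obtain \<rho> where \<rho>: "\<rho> < 1" "\<And>z. \<rho> \<le> cmod z \<Longrightarrow> cmod z < 1 \<Longrightarrow>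
       (1 - d) * (1 - (cmod (F z))\<^sup>2) \<le> (1 - (cmod z)\<^sup>2) * cmod (deriv F z)"
    using complete[OF d(1)] by blast
  show "\<exists>\<rho><1. \<forall>z\<in>\<D>. \<rho> \<le> cmod z \<longrightarrow> cmod (k z) * U z * (1 - (cmod (F z))\<^sup>2) \<le> 1 + e"
  proof (intro exI[of _ \<rho>] conjI ballI impI \<rho>(1))
    fix w assume w: "w \<in> \<D>" "\<rho> \<le> cmod w"
    have U: "U w > 0" using sk w unfolding sk_metric_def by blast
    have "(1 - d) * (cmod (k w) * U w * (1 - (cmod (F w))\<^sup>2)) =
       cmod (k w) * U w * ((1 - d) * (1 - (cmod (F w))\<^sup>2))" by simp
    also have "\<dots> \<le> cmod (k w) * U w * ((1 - (cmod w)\<^sup>2) * cmod (deriv F w))"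
      using \<rho>(2)[of w] w U by (intro mult_left_mono) auto
    also have "\<dots> = cmod (\<phi> w) * U w * (1 - (cmod w)\<^sup>2)"
      using \<phi>[OF w(1)] by (simp add: norm_mult)
    also have "\<dots> \<le> 1" by (rule ahlfors_lemma[OF sk w(1)])
    finally have "cmod (k w) * U w * (1 - (cmod (F w))\<^sup>2) \<le> 1 / (1 - d)"
      using d by (simp add: field_simps)
    then show "cmod (k w) * U w * (1 - (cmod (F w))\<^sup>2) \<le> 1 + e" using d by simp
  qed
qed (use assms selfmap_in_disc[OF F] in \<open>auto simp: holomorphic_selfmap_def\<close>)

section \<open>Decay of the quotient at the boundary\<close>

text \<open>With \<open>m\<close> the disc automorphism taking \<open>a\<close> to \<open>0\<close>, the barrier is \<open>(|m| - 1 / |m|)\<^sup>2\<close>; it decays like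
  the small solutions of \<open>\<Delta> w = 8 w / (1 - |z|\<^sup>2)\<^sup>2\<close>, and for \<open>q \<le> 1\<close> the convexity of \<open>exp\<close> turns the
  curvature equations into \<open>\<Delta> ln q \<ge> 8 ln q / (1 - |z|\<^sup>2)\<^sup>2\<close>.\<close>

lemma comparison_barrier:
  assumes a: "cmod a < 1" and z: "cmod z < 1" "z \<noteq> a"
  defines "w \<equiv> (\<lambda>z. (cmod (disc_moebius a z))\<^sup>2 + (cmod (1 / disc_moebius a z))\<^sup>2 - 2)"
  shows "w z = (1 - (cmod (disc_moebius a z))\<^sup>2)\<^sup>2 / (cmod (disc_moebius a z))\<^sup>2"
    and "\<exists>g L. has_lap w g L z \<and> 8 * w z / (1 - (cmod z)\<^sup>2)\<^sup>2 \<le> L"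
proof -
  have m0: "disc_moebius a z \<noteq> 0"
    using moebius_denom_nonzero[OF a, of z] z by (simp add: disc_moebius_def)
  define s where "s = (cmod (disc_moebius a z))\<^sup>2"
  have s: "s > 0" using m0 by (simp add: s_def)
  show wz: "w z = (1 - (cmod (disc_moebius a z))\<^sup>2)\<^sup>2 / (cmod (disc_moebius a z))\<^sup>2"
    using s unfolding w_def norm_divide power_divide s_def[symmetric]
    by (simp add: field_simps power2_eq_square)
  define S where "S = \<D> - {a}"
  have S: "open S" "z \<in> S" using z by (auto simp: S_def)
  have hol: "disc_moebius a holomorphic_on S"
    by (rule holomorphic_on_subset[OF moebius_holomorphic[OF a]]) (auto simp: S_def)
  have nz: "disc_moebius a u \<noteq> 0" if "u \<in> S" for u
    using moebius_denom_nonzero[OF a, of u] that by (simp add: disc_moebius_def S_def)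
  have hol2: "(\<lambda>u. 1 / disc_moebius a u) holomorphic_on S"
    using nz by (intro holomorphic_intros hol) auto
  have dd: "(disc_moebius a has_field_derivative deriv (disc_moebius a) z) (at z)"
    using hol S holomorphic_derivI by blast
  have d2: "deriv (\<lambda>u. 1 / disc_moebius a u) z = - deriv (disc_moebius a) z / (disc_moebius a z)\<^sup>2"
    using m0 dd by (intro DERIV_imp_deriv) (auto intro!: derivative_eq_intros simp: power2_eq_square)
  define D where "D = (cmod (deriv (disc_moebius a) z))\<^sup>2"
  \<comment> \<open>Both m and 1 / m are holomorphic off a, so each squared modulus contributes four
    times the square of its derivative. The excess of \<open>L\<close> over the required bound will
    be the square \<open>4 * D * (1 - 1 / s)\<^sup>2\<close>.\<close>
  define L where "L = 4 * D * (1 + 1 / s\<^sup>2)"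
  have "\<exists>g. has_lap w g L z"
  proof -
    have "4 * (cmod (deriv (disc_moebius a) z))\<^sup>2 + 4 * (cmod (deriv (\<lambda>u. 1 / disc_moebius a u) z))\<^sup>2 + 0 = L"
      unfolding d2 L_def D_def s_def by (simp add: norm_divide norm_power power_divide algebra_simps)
    then show ?thesis
      using has_lap_add[OF has_lap_add[OF has_lap_norm2[OF hol S] has_lap_norm2[OF hol2 S]] has_lap_const[of "-2"]]
      unfolding w_def by auto
  qed
  moreover have "8 * w z / (1 - (cmod z)\<^sup>2)\<^sup>2 \<le> L"
  proof -
    have t: "1 - (cmod z)\<^sup>2 > 0" using one_minus_norm2_pos z by simp
    have "(1 - s)\<^sup>2 = D * (1 - (cmod z)\<^sup>2)\<^sup>2"
      unfolding s_def D_def norm_deriv_moebius[OF a z(1), symmetric] by (simp add: power_mult_distrib)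
    then have "8 * w z / (1 - (cmod z)\<^sup>2)\<^sup>2 = 8 * D / s"
      using t unfolding wz s_def[symmetric] by simp
    also have "\<dots> \<le> L"
    proof -
      have "L - 8 * D / s = 4 * D * (1 - 1 / s)\<^sup>2"
        unfolding L_def by (simp add: power2_eq_square algebra_simps)
      moreover have "4 * D * (1 - 1 / s)\<^sup>2 \<ge> 0" by (simp add: D_def)
      ultimately show ?thesis by linarith
    qed
    finally show ?thesis .
  qed
  ultimately show "\<exists>g L. has_lap w g L z \<and> 8 * w z / (1 - (cmod z)\<^sup>2)\<^sup>2 \<le> L" by blast
qed

lemma exp_minus_le:
  fixes t :: real
  assumes "0 \<le> t" "t \<le> 1"
  shows "exp (- t) \<le> 1 - t / 2"
proof -
  have "(1 + t) * (1 - t / 2) = 1 + t * (1 - t) / 2" by (simp add: field_simps)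
  moreover have "t * (1 - t) \<ge> 0" using assms by simp
  ultimately have "1 / (1 + t) \<le> 1 - t / 2" using assms by (simp add: field_simps)
  moreover have "exp (- t) \<le> 1 / (1 + t)"
    using exp_ge_add_one_self[of t] assms by (simp add: exp_minus field_simps)
  ultimately show ?thesis by simp
qed

text \<open>On a small circle around a, q stays below 1 by a fixed amount, which leaves room for a
  factor exp (c w); at the unit circle w tends to 0. If q exp (c w) exceeded 1 between the two
  circles, it would have a maximum there. At that point ln q + c w > 0, and the differential
  inequalities for ln q and w make its Laplacian positive.\<close>

lemma boundary_decay:
  assumes f: "holomorphic_selfmap f" and B: "holomorphic_selfmap B"
    and h: "h holomorphic_on \<D>" "\<And>z. z \<in> \<D> \<Longrightarrow> deriv f z = h z * deriv B z"
    and q_def: "q = (\<lambda>z. cmod (h z) * (1 - (cmod (B z))\<^sup>2) / (1 - (cmod (f z))\<^sup>2))"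
    and q1: "\<And>z. z \<in> \<D> \<Longrightarrow> q z \<le> 1" and a: "a \<in> \<D>" "q a < 1"
  shows "\<exists>c>0. \<exists>\<rho><1. \<forall>z. \<rho> \<le> cmod z \<and> cmod z < 1 \<longrightarrow> q z \<le> 1 - c * (1 - cmod z)\<^sup>2"
proof -
  define w where "w = (\<lambda>z. (cmod (disc_moebius a z))\<^sup>2 + (cmod (1 / disc_moebius a z))\<^sup>2 - 2)"
  have a1: "cmod a < 1" using a by simp
  have fp: "1 - (cmod (f z))\<^sup>2 > 0" if "z \<in> \<D>" for z
    using one_minus_norm2_pos[OF selfmap_in_disc[OF f]] that by simp
  have Bp: "1 - (cmod (B z))\<^sup>2 > 0" if "z \<in> \<D>" for z
    using one_minus_norm2_pos[OF selfmap_in_disc[OF B]] that by simp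
  have fh: "f holomorphic_on \<D>" "B holomorphic_on \<D>" using f B by (auto simp: holomorphic_selfmap_def)
  have contq: "continuous_on \<D> q"
    unfolding q_def using fp
    by (intro continuous_intros holomorphic_on_imp_continuous_on h fh) (auto simp: less_imp_neq[THEN not_sym])
  have q0: "q z \<ge> 0" if "z \<in> \<D>" for z
    unfolding q_def using fp[OF that] Bp[OF that] by simp
  have nz: "disc_moebius a u \<noteq> 0" if "u \<in> \<D>" "u \<noteq> a" for u
    using moebius_denom_nonzero[OF a1, of u] that by (simp add: disc_moebius_def)
  have contw: "continuous_on (\<D> - {a}) w"
  proof -
    have "continuous_on (\<D> - {a}) (disc_moebius a)"
      by (rule holomorphic_on_imp_continuous_on[OF holomorphic_on_subset[OF moebius_holomorphic[OF a1]]]) auto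
    then show ?thesis unfolding w_def using nz by (intro continuous_intros) auto
  qed
  have w_eq: "w z = (1 - (cmod (disc_moebius a z))\<^sup>2)\<^sup>2 / (cmod (disc_moebius a z))\<^sup>2" if "z \<in> \<D>" "z \<noteq> a" for z
    using comparison_barrier(1)[OF a1, of z] that unfolding w_def by simp
  have w0: "w z \<ge> 0" if "z \<in> \<D>" "z \<noteq> a" for z using w_eq[OF that] by simp
  define \<epsilon> where "\<epsilon> = (1 - q a) / 2"
  have \<epsilon>: "0 < \<epsilon>" "\<epsilon> < 1" using a q0[OF a(1)] by (auto simp: \<epsilon>_def)
  have "isCont q a" using contq a(1) by (simp add: continuous_on_eq_continuous_at)
  then have "\<forall>\<^sub>F z in nhds a. q z < 1 - \<epsilon>"
    using a(2) by (intro order_tendstoD(2)[of q "q a"]) (auto simp: \<epsilon>_def isCont_def tendsto_at_iff_tendsto_nhds field_simps)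
  then have "\<forall>\<^sub>F z in nhds a. q z < 1 - \<epsilon> \<and> z \<in> \<D>"
    using eventually_nhds_in_open[OF open_ball a(1)] by eventually_elim auto
  then obtain d0 where d0: "d0 > 0" "\<And>z. dist z a < d0 \<Longrightarrow> q z < 1 - \<epsilon> \<and> z \<in> \<D>"
    unfolding eventually_nhds_metric by blast
  define d where "d = d0 / 2"
  have d: "d > 0" "\<And>z. dist z a \<le> d \<Longrightarrow> q z \<le> 1 - \<epsilon> \<and> z \<in> \<D>"
    using d0 by (auto simp: d_def intro: less_imp_le)
  have "continuous_on (sphere a d) w"
    using d by (intro continuous_on_subset[OF contw]) (auto simp: dist_commute simp del: mem_ball)
  moreover have "sphere a d \<noteq> {}" using d(1) by simp
  ultimately obtain u where u: "\<forall>z\<in>sphere a d. w z \<le> w u"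
    using continuous_attains_sup[OF compact_sphere] by blast
  define W where "W = max 1 (w u)"
  have W: "W \<ge> 1" "\<And>z. dist z a = d \<Longrightarrow> w z \<le> W" using u by (auto simp: W_def dist_commute max.coboundedI2)
  \<comment> \<open>The value for which exp (c W) (1 - \<epsilon>) = 1, so that
    \<open>\<Psi>\<close> is at most 1 on the small circle.\<close>
  define c where "c = - ln (1 - \<epsilon>) / W"
  have lneg: "ln (1 - \<epsilon>) < 0" using \<epsilon> by simp
  have c: "c > 0" using lneg W by (simp add: c_def divide_neg_pos)
  have cW: "exp (c * W) * (1 - \<epsilon>) = 1" using \<epsilon> W by (simp add: c_def exp_minus)
  define \<Psi> where "\<Psi> = (\<lambda>z. q z * exp (c * w z))"
  have sph: "\<Psi> z \<le> 1" if "dist z a = d" for z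
  proof -
    have "\<Psi> z \<le> (1 - \<epsilon>) * exp (c * W)"
      unfolding \<Psi>_def using d(2)[of z] W(2)[OF that] c that \<epsilon> by (intro mult_mono) auto
    then show ?thesis using cW by (simp add: mult.commute)
  qed
  have claim: "\<Psi> z1 \<le> 1" if z1: "z1 \<in> \<D>" "dist z1 a \<ge> d" for z1
  proof (rule ccontr)
    assume "\<not> \<Psi> z1 \<le> 1"
    then have P1: "\<Psi> z1 > 1" by simp
    \<comment> \<open>With s = |m|^2 the barrier is (1 - s)^2 / s, and s tends to 1 at the unit
      circle uniformly.\<close>
    have small: "\<exists>\<rho><1. \<forall>z. \<rho> \<le> cmod z \<and> cmod z < 1 \<and> z \<noteq> a \<longrightarrow> w z < \<eta>" if \<eta>: "\<eta> > 0" for \<eta>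
    proof -
      have "((\<lambda>s::real. (1 - s)\<^sup>2 / s) \<longlongrightarrow> (1 - 1)\<^sup>2 / 1) (nhds 1)"
        by (intro tendsto_intros filterlim_ident) auto
      then have "\<forall>\<^sub>F s::real in nhds 1. (1 - s)\<^sup>2 / s < \<eta>"
        using \<eta> by (intro order_tendstoD(2)) auto
      then obtain e where e: "e > 0" "\<And>s::real. \<bar>s - 1\<bar> < e \<Longrightarrow> (1 - s)\<^sup>2 / s < \<eta>"
        unfolding eventually_nhds_metric dist_real_def by blast
      define b where "b = (1 - cmod a)\<^sup>2"
      have b: "b > 0" using a1 by (simp add: b_def)
      show ?thesis
      proof (intro exI[of _ "1 - e * b / 4"] conjI allI impI)
        show "1 - e * b / 4 < 1" using e b by simp
        fix z assume z: "1 - e * b / 4 \<le> cmod z \<and> cmod z < 1 \<and> z \<noteq> a"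
        have n: "cmod (1 - cnj a * z) \<ge> 1 - cmod a"
        proof -
          have "cmod (cnj a * z) \<le> cmod a" using z by (simp add: norm_mult mult_left_le)
          then show ?thesis using norm_triangle_ineq2[of 1 "cnj a * z"] by simp
        qed
        have "1 - (cmod (disc_moebius a z))\<^sup>2 = (1 - (cmod a)\<^sup>2) * (1 - (cmod z)\<^sup>2) / (cmod (1 - cnj a * z))\<^sup>2"
          using moebius_norm[OF a1] z by simp
        also have "\<dots> \<le> 1 * (1 - (cmod z)\<^sup>2) / b"
        proof (rule frac_le)
          show "b \<le> (cmod (1 - cnj a * z))\<^sup>2" unfolding b_def using n a1 by (intro power_mono) auto
          show "(1 - (cmod a)\<^sup>2) * (1 - (cmod z)\<^sup>2) \<le> 1 * (1 - (cmod z)\<^sup>2)"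
            using z one_minus_norm2_pos[of z] by (intro mult_right_mono) auto
        qed (use b z one_minus_norm2_pos[of z] in auto)
        also have "\<dots> = (1 - cmod z) * (1 + cmod z) / b" by (simp add: power2_eq_square algebra_simps)
        also have "\<dots> \<le> (e * b / 4) * 2 / b" using z b by (intro divide_right_mono mult_mono) auto
        also have "\<dots> < e" using b e by simp
        finally have 1: "1 - (cmod (disc_moebius a z))\<^sup>2 < e" .
        have "(cmod (disc_moebius a z))\<^sup>2 < 1" using one_minus_norm2_pos[OF moebius_in_disc[OF a1]] z by auto
        then show "w z < \<eta>" using 1 e(2)[of "(cmod (disc_moebius a z))\<^sup>2"] w_eq[of z] z by auto
      qed
    qed
    have "ln (\<Psi> z1) / c > 0" using P1 c by simp
    then obtain \<rho>0 where \<rho>0: "\<rho>0 < 1" "\<And>z. \<rho>0 \<le> cmod z \<Longrightarrow> cmod z < 1 \<Longrightarrow> z \<noteq> a \<Longrightarrow> w z < ln (\<Psi> z1) / c"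
      using small by blast
    have bd: "\<Psi> z < \<Psi> z1" if z: "\<rho>0 \<le> cmod z" "cmod z < 1" "dist z a \<ge> d" for z
    proof -
      have za: "z \<noteq> a" using z d(1) by auto
      have "\<Psi> z \<le> 1 * exp (c * w z)" unfolding \<Psi>_def using q1[of z] z by (intro mult_right_mono) auto
      also have "\<dots> < exp (ln (\<Psi> z1))"
        using \<rho>0(2)[OF z(1,2) za] c by (simp add: field_simps)
      finally show ?thesis using P1 by simp
    qed
    have z1\<rho>: "cmod z1 < \<rho>0" using bd[of z1] z1 by fastforce
    define K where "K = cball 0 \<rho>0 - ball a d"
    have K: "compact K" unfolding K_def by (intro compact_diff) auto
    have "continuous_on K \<Psi>"
    proof -
      have "continuous_on K q" using \<rho>0(1) by (intro continuous_on_subset[OF contq]) (auto simp: K_def)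
      moreover have "continuous_on K w" using \<rho>0(1) d(1)
        by (intro continuous_on_subset[OF contw]) (auto simp: K_def)
      ultimately show ?thesis unfolding \<Psi>_def by (intro continuous_intros)
    qed
    moreover have z1K: "z1 \<in> K" using z1\<rho> z1 by (auto simp: K_def dist_commute)
    ultimately obtain z0 where z0: "z0 \<in> K" "\<And>z. z \<in> K \<Longrightarrow> \<Psi> z \<le> \<Psi> z0"
      using continuous_attains_sup[OF K] by blast
    have P0: "\<Psi> z0 > 1" using z0(2)[OF z1K] P1 by simp
    have z0d: "dist z0 a > d" using sph[of z0] P0 z0(1) by (force simp: K_def dist_commute)
    have z0\<rho>: "cmod z0 < \<rho>0" using bd[of z0] z0d z0(2)[OF z1K] z0(1) \<rho>0(1) by (force simp: K_def)
    have z0D: "z0 \<in> \<D>" "z0 \<noteq> a" using z0\<rho> \<rho>0 z0d d(1) by auto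
    have q0pos: "q z0 > 0" using P0 q0[OF z0D(1)] by (cases "q z0 = 0") (auto simp: \<Psi>_def)
    then have h0: "h z0 \<noteq> 0" by (auto simp: q_def)
    obtain g1 where g1: "has_lap (\<lambda>w. ln (cmod (h w))) g1 0 z0"
      using has_lap_ln_norm[OF h(1) open_ball z0D(1) h0] by blast
    obtain g2 where g2: "has_lap (\<lambda>w. ln (1 - (cmod (B w))\<^sup>2)) g2
              (- (4 * (cmod (deriv B z0))\<^sup>2 / (1 - (cmod (B z0))\<^sup>2)\<^sup>2)) z0"
      using has_lap_ln_one_minus_norm2[OF fh(2) open_ball z0D(1)] selfmap_in_disc[OF B] z0D(1) by auto
    obtain g3 where "has_lap (\<lambda>w. ln (1 - (cmod (f w))\<^sup>2)) g3
              (- (4 * (cmod (deriv f z0))\<^sup>2 / (1 - (cmod (f z0))\<^sup>2)\<^sup>2)) z0"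
      using has_lap_ln_one_minus_norm2[OF fh(1) open_ball z0D(1)] selfmap_in_disc[OF f] z0D(1) by auto
    note g3 = has_lap_uminus[OF this]
    obtain g4 L where g4: "has_lap w g4 L z0" "8 * w z0 / (1 - (cmod z0)\<^sup>2)\<^sup>2 \<le> L"
      using comparison_barrier(2)[OF a1 _ z0D(2)] z0D(1) unfolding w_def by auto
    define \<beta> where "\<beta> = (cmod (deriv B z0))\<^sup>2 / (1 - (cmod (B z0))\<^sup>2)\<^sup>2"
    define X where "X = 1 / (1 - (cmod z0)\<^sup>2)\<^sup>2"
    have "(cmod (deriv f z0))\<^sup>2 / (1 - (cmod (f z0))\<^sup>2)\<^sup>2 = \<beta> * (q z0)\<^sup>2"
      unfolding \<beta>_def q_def h(2)[OF z0D(1)] using Bp[OF z0D(1)] fp[OF z0D(1)]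
      by (simp add: norm_mult power_mult_distrib power_divide)
    then have fq: "4 * (cmod (deriv f z0))\<^sup>2 / (1 - (cmod (f z0))\<^sup>2)\<^sup>2 = 4 * (\<beta> * (q z0)\<^sup>2)"
      by (simp only: times_divide_eq_right[symmetric])
    have Bq: "4 * (cmod (deriv B z0))\<^sup>2 / (1 - (cmod (B z0))\<^sup>2)\<^sup>2 = 4 * \<beta>"
      by (simp add: \<beta>_def)
    have Leq: "0 + - (4 * (cmod (deriv B z0))\<^sup>2 / (1 - (cmod (B z0))\<^sup>2)\<^sup>2) +
        - (- (4 * (cmod (deriv f z0))\<^sup>2 / (1 - (cmod (f z0))\<^sup>2)\<^sup>2)) + c * L = 4 * \<beta> * ((q z0)\<^sup>2 - 1) + c * L"
      unfolding fq Bq by (simp add: algebra_simps)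
    have lap: "has_lap (\<lambda>z. ln (cmod (h z)) + ln (1 - (cmod (B z))\<^sup>2) + - ln (1 - (cmod (f z))\<^sup>2) + c * w z)
        (g1 + g2 + - g3 + of_real c * g4) (4 * \<beta> * ((q z0)\<^sup>2 - 1) + c * L) z0"
      using has_lap_add[OF has_lap_add[OF has_lap_add[OF g1 g2] g3] has_lap_cmult[OF g4(1), of c]]
      unfolding Leq .
    have eqv: "ln (cmod (h z)) + ln (1 - (cmod (B z))\<^sup>2) + - ln (1 - (cmod (f z))\<^sup>2) + c * w z = ln (\<Psi> z)"
      "\<Psi> z > 0" if "z \<in> \<D>" "h z \<noteq> 0" for z
      unfolding \<Psi>_def q_def using Bp[OF that(1)] fp[OF that(1)] that(2)
      by (simp_all add: ln_mult ln_div)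
    have "open (ball 0 \<rho>0 - cball a d)" "z0 \<in> ball 0 \<rho>0 - cball a d"
      using z0\<rho> z0d by (auto simp: dist_commute)
    from eventually_nhds_in_open[OF this]
    have ev1: "\<forall>\<^sub>F z in nhds z0. z \<in> K \<and> z \<in> \<D>" 
      by eventually_elim (use \<rho>0(1) in \<open>auto simp: K_def\<close>)
    have "\<forall>\<^sub>F z in nhds z0. z \<in> \<D> \<and> h z \<noteq> 0"
      by (rule eventually_holomorphic_nonzero[OF h(1) open_ball z0D(1) h0])
    with ev1 have "\<forall>\<^sub>F z in nhds z0. ln (cmod (h z)) + ln (1 - (cmod (B z))\<^sup>2) + - ln (1 - (cmod (f z))\<^sup>2) + c * w z
      \<le> ln (cmod (h z0)) + ln (1 - (cmod (B z0))\<^sup>2) + - ln (1 - (cmod (f z0))\<^sup>2) + c * w z0"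
    proof eventually_elim
      case (elim z)
      show ?case using eqv[of z] eqv[of z0] elim z0D h0 z0(2)[of z] by simp
    qed
    from has_lap_local_max[OF lap this] have le: "4 * \<beta> * ((q z0)\<^sup>2 - 1) + c * L \<le> 0" .
    have \<beta>: "0 \<le> \<beta>" "\<beta> \<le> X"
    proof -
      show "0 \<le> \<beta>" by (simp add: \<beta>_def)
      have t: "1 - (cmod z0)\<^sup>2 > 0" using one_minus_norm2_pos z0D by simp
      have "cmod (deriv B z0) * (1 / (1 - (cmod (B z0))\<^sup>2)) * (1 - (cmod z0)\<^sup>2) \<le> 1"
        by (rule ahlfors_lemma[OF sk_metric_selfmap[OF B] z0D(1)])
      then have "cmod (deriv B z0) / (1 - (cmod (B z0))\<^sup>2) \<le> 1 / (1 - (cmod z0)\<^sup>2)"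
        using t by (simp add: field_simps)
      then have "(cmod (deriv B z0) / (1 - (cmod (B z0))\<^sup>2))\<^sup>2 \<le> (1 / (1 - (cmod z0)\<^sup>2))\<^sup>2"
        using Bp[OF z0D(1)] by (intro power_mono) auto
      then show "\<beta> \<le> X" by (simp add: \<beta>_def X_def power_divide)
    qed
    \<comment> \<open>The sign of ln q makes both replacements go the right way: q^2 - 1 is bounded
      below by 2 ln q, and the unknown metric term \<beta> is replaced by its Schwarz-Pick bound
      X.\<close>
    have lq: "ln (q z0) \<le> 0" using q1[OF z0D(1)] q0pos by simp
    have "ln ((q z0)\<^sup>2) \<le> (q z0)\<^sup>2 - 1" using q0pos by (intro ln_le_minus_one) simp
    then have "2 * ln (q z0) \<le> (q z0)\<^sup>2 - 1" using q0pos by (simp add: ln_realpow)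
    then have "\<beta> * (2 * ln (q z0)) \<le> \<beta> * ((q z0)\<^sup>2 - 1)" using \<beta>(1) by (intro mult_left_mono)
    moreover have "X * (2 * ln (q z0)) \<le> \<beta> * (2 * ln (q z0))"
      using \<beta>(2) lq by (intro mult_right_mono_neg) auto
    ultimately have 1: "8 * X * ln (q z0) \<le> 4 * \<beta> * ((q z0)\<^sup>2 - 1)" by simp
    have "ln (\<Psi> z0) > 0" using P0 by simp
    then have "ln (q z0) + c * w z0 > 0" using q0pos by (simp add: \<Psi>_def ln_mult)
    moreover have "X > 0" using one_minus_norm2_pos[of z0] z0D by (simp add: X_def)
    ultimately have "8 * X * (ln (q z0) + c * w z0) > 0" by simp
    moreover have "c * (8 * w z0 * X) \<le> c * L" using g4(2) c by (intro mult_left_mono) (auto simp: X_def)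
    ultimately show False using 1 le by (simp add: algebra_simps)
  qed
  \<comment> \<open>From |1 - cnj a z| <= 2 it follows that 1 - |m|^2 >= (1 - |a|^2) (1 - |z|) / 4.
    Squaring gives w >= b (1 - |z|)^2.\<close>
  define b where "b = ((1 - (cmod a)\<^sup>2) / 4)\<^sup>2"
  have b: "b > 0" using one_minus_norm2_pos[OF a1] by (simp add: b_def)
  \<comment> \<open>The cap at 1 keeps the exponent within the range [0, 1] of
    \<open>exp_minus_le\<close>.\<close>
  define \<kappa> where "\<kappa> = min 1 (c * b)"
  have \<kappa>: "\<kappa> > 0" "\<kappa> \<le> 1" "\<kappa> \<le> c * b" using c b by (auto simp: \<kappa>_def)
  have "\<exists>\<rho><1. \<forall>z. \<rho> \<le> cmod z \<and> cmod z < 1 \<longrightarrow> dist z a \<ge> d"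
  proof (intro exI[of _ "cmod a + d"] conjI allI impI)
    show "cmod a + d < 1"
    proof -
      \<comment> \<open>The point at distance d beyond a on the ray through a has modulus |a| + d.
        It lies in the closed disc of radius d about a, which is contained in \<D>.\<close>
      define e where "e = (if a = 0 then 1 else a / of_real (cmod a))"
      have e: "cmod e = 1" "a = of_real (cmod a) * e" by (auto simp: e_def norm_divide)
      have "dist (a + of_real d * e) a \<le> d" using d(1) e by (simp add: dist_norm norm_mult)
      then have "cmod (a + of_real d * e) < 1" using d(2) by force
      moreover have "a + of_real d * e = of_real (cmod a + d) * e" using e(2) by (simp add: algebra_simps)
      ultimately have "cmod (of_real (cmod a + d)) * 1 < 1" using e(1) by (metis norm_mult)
      then show ?thesis using abs_ge_self[of "cmod a + d"] unfolding norm_of_real mult_1_right by (rule order_le_less_trans[rotated])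
    qed
    fix z assume "cmod a + d \<le> cmod z \<and> cmod z < 1"
    then show "dist z a \<ge> d" using norm_triangle_ineq2[of z a] by (simp add: dist_norm)
  qed
  then obtain \<rho> where \<rho>: "\<rho> < 1" "\<And>z. \<rho> \<le> cmod z \<Longrightarrow> cmod z < 1 \<Longrightarrow> dist z a \<ge> d" by blast
  have "q z \<le> 1 - \<kappa> / 2 * (1 - cmod z)\<^sup>2" if z: "\<rho> \<le> cmod z" "cmod z < 1" for z
  proof -
    have zd: "dist z a \<ge> d" using \<rho>(2) z by simp
    have zD: "z \<in> \<D>" "z \<noteq> a" using z zd d(1) by auto
    have "q z * exp (c * w z) \<le> 1" using claim[OF zD(1) zd] by (simp add: \<Psi>_def)
    then have 1: "q z \<le> exp (- (c * w z))" by (simp add: exp_minus field_simps)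
    define s where "s = (cmod (disc_moebius a z))\<^sup>2"
    have s: "0 < s" "s < 1" using nz[OF zD] one_minus_norm2_pos[OF moebius_in_disc[OF a1]] z by (auto simp: s_def)
    have n: "cmod (1 - cnj a * z) \<le> 2"
    proof -
      have "cmod (cnj a * z) \<le> 1" using a1 z by (simp add: norm_mult mult_le_one)
      then show ?thesis using norm_triangle_ineq4[of 1 "cnj a * z"] by simp
    qed
    have nz2: "cmod (1 - cnj a * z) > 0" using moebius_denom_nonzero[OF a1, of z] z by simp
    have "(1 - (cmod a)\<^sup>2) / 4 * (1 - cmod z) = (1 - (cmod a)\<^sup>2) * (1 - cmod z) / 2\<^sup>2" by simp
    also have "\<dots> \<le> (1 - (cmod a)\<^sup>2) * (1 - (cmod z)\<^sup>2) / (cmod (1 - cnj a * z))\<^sup>2"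
    proof (rule frac_le)
      have "(cmod z)\<^sup>2 \<le> cmod z" using z by (simp add: power2_eq_square mult_left_le)
      then show "(1 - (cmod a)\<^sup>2) * (1 - cmod z) \<le> (1 - (cmod a)\<^sup>2) * (1 - (cmod z)\<^sup>2)"
        using one_minus_norm2_pos[OF a1] by (intro mult_left_mono) auto
      show "(cmod (1 - cnj a * z))\<^sup>2 \<le> 2\<^sup>2" using n by (intro power_mono) auto
      show "0 < (cmod (1 - cnj a * z))\<^sup>2" using nz2 by simp
      show "0 \<le> (1 - (cmod a)\<^sup>2) * (1 - (cmod z)\<^sup>2)"
        using one_minus_norm2_pos[OF a1] one_minus_norm2_pos[of z] z by simp
    qed
    also have "\<dots> = 1 - s" using moebius_norm[OF a1, of z] z by (simp add: s_def)
    finally have le: "(1 - (cmod a)\<^sup>2) / 4 * (1 - cmod z) \<le> 1 - s" .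
    have "b * (1 - cmod z)\<^sup>2 = ((1 - (cmod a)\<^sup>2) / 4 * (1 - cmod z))\<^sup>2"
      unfolding b_def by (rule power_mult_distrib[symmetric])
    also have "\<dots> \<le> (1 - s)\<^sup>2" using le z one_minus_norm2_pos[OF a1] by (intro power_mono) auto
    also have "\<dots> \<le> (1 - s)\<^sup>2 / s" using s by (simp add: field_simps mult_left_le)
    also have "\<dots> = w z" using w_eq[OF zD] by (simp add: s_def)
    finally have bw: "b * (1 - cmod z)\<^sup>2 \<le> w z" .
    have "\<kappa> * (1 - cmod z)\<^sup>2 \<le> c * b * (1 - cmod z)\<^sup>2" using \<kappa>(3) by (intro mult_right_mono) auto
    also have "\<dots> \<le> c * w z" using bw c by (simp add: mult.assoc)
    finally have "exp (- (c * w z)) \<le> exp (- (\<kappa> * (1 - cmod z)\<^sup>2))" by simp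
    also have "\<dots> \<le> 1 - \<kappa> * (1 - cmod z)\<^sup>2 / 2"
      using \<kappa> z by (intro exp_minus_le) (auto intro!: mult_le_one power_le_one)
    finally show ?thesis using 1 by simp
  qed
  then show ?thesis using \<rho>(1) \<kappa>(1) by (intro exI[of _ "\<kappa> / 2"] conjI exI[of _ \<rho>]) auto
qed

section \<open>Finite Blaschke products with prescribed critical points\<close>

text \<open>Uniqueness in Hermite interpolation: each node allows division by the square of a linear
  factor. It will be applied with n + 1 nodes and degree at most 2 n.\<close>

lemma double_roots_imp_zero:
  fixes p :: "complex poly"
  assumes "finite A" "\<And>x. x \<in> A \<Longrightarrow> poly p x = 0 \<and> poly (pderiv p) x = 0" "degree p < 2 * card A"
  shows "p = 0"
  using assms
proof (induction A arbitrary: p rule: finite_induct)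
  case empty
  then show ?case by simp
next
  case (insert x A)
  obtain q where q: "p = [:- x, 1:] * q" using insert.prems(1)[of x] poly_eq_0_iff_dvd by (metis dvdE insertI1)
  have "poly (pderiv p) x = poly q x" unfolding q pderiv_mult poly_add poly_mult by (simp add: pderiv_pCons)
  then have "poly q x = 0" using insert.prems(1)[of x] by simp
  then obtain r where r: "q = [:- x, 1:] * r" using poly_eq_0_iff_dvd by (metis dvdE)
  have p: "p = [:- x, 1:] * ([:- x, 1:] * r)" using q r by simp
  have "poly r y = 0 \<and> poly (pderiv r) y = 0" if y: "y \<in> A" for y
  proof -
    have xy: "y \<noteq> x" using y insert.hyps by auto
    have "poly p y = 0" "poly (pderiv p) y = 0" using insert.prems(1)[of y] y by auto
    moreover have "poly p y = (y - x)\<^sup>2 * poly r y"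
      unfolding p by (simp add: algebra_simps power2_eq_square)
    moreover have "poly (pderiv p) y = (y - x)\<^sup>2 * poly (pderiv r) y + 2 * (y - x) * poly r y"
      unfolding p pderiv_mult poly_add poly_mult by (simp add: pderiv_pCons algebra_simps power2_eq_square)
    ultimately show ?thesis using xy by simp
  qed
  moreover have "degree r < 2 * card A \<or> r = 0"
  proof (cases "r = 0")
    case False
    have "degree ([:- x, 1:] * s) = 1 + degree s" if "s \<noteq> 0" for s
      using that by (subst degree_mult_eq) auto
    note deg = this
    have "[:- x, 1:] * r \<noteq> 0" using False by (simp only: mult_eq_0_iff) simp
    then have "degree p = 2 + degree r" using deg[OF False] deg[of "[:- x, 1:] * r"] unfolding p by linarith
    then show ?thesis using insert.prems(2) insert.hyps by simp
  qed simp
  ultimately have "r = 0" using insert.IH by blast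
  then show ?case using p by simp
qed

text \<open>On the circle conjugation is inversion, so this square is a positive number times an
  explicit phase. With the same fact for the reflected factors of N, sums over the circle reduce to
  sums of real terms with one common phase.\<close>

lemma unit_circle_diff_square:
  assumes "cmod z = 1" "cmod w = 1"
  shows "(z - w)\<^sup>2 = - (z * w) * of_real ((cmod (z - w))\<^sup>2)"
proof -
  have "z * cnj z = 1" "w * cnj w = 1" using assms by (metis complex_norm_square of_real_1 power_one)+
  then have zw: "cnj z = 1 / z" "cnj w = 1 / w" "z \<noteq> 0" "w \<noteq> 0"
    by (metis nonzero_mult_div_cancel_left mult_zero_left zero_neq_one)
      (metis \<open>w * cnj w = 1\<close> nonzero_mult_div_cancel_left mult_zero_left zero_neq_one,
       use assms in auto)
  have "of_real ((cmod (z - w))\<^sup>2) = (z - w) * cnj (z - w)" by (metis complex_norm_square)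
  also have "\<dots> = (z - w) * (1 / z - 1 / w)" by (simp add: zw)
  finally show ?thesis using zw(3,4) by (simp add: field_simps power2_eq_square)
qed

lemma unit_circle_reflected_factor:
  assumes "cmod z = 1"
  shows "(z - c) * (1 - cnj c * z) = z * of_real ((cmod (z - c))\<^sup>2)"
proof -
  have "z * cnj z = 1" using assms by (metis complex_norm_square of_real_1 power_one)
  then have 1: "1 - cnj c * z = z * cnj (z - c)" by (simp add: algebra_simps)
  have "of_real ((cmod (z - c))\<^sup>2) = (z - c) * cnj (z - c)" by (metis complex_norm_square)
  then show ?thesis unfolding 1 by simp
qed

text \<open>A configuration that maximizes all n + 1 points jointly is also optimal in each point
  separately; only these one-point inequalities are kept. Distinctness holds because coinciding
  points give the value 0.\<close>

lemma weighted_fekete_points: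
  fixes q :: "complex \<Rightarrow> real"
  assumes q: "continuous_on (sphere 0 1) q" "\<And>z. cmod z = 1 \<Longrightarrow> q z > 0"
  shows "\<exists>\<zeta> :: nat \<Rightarrow> complex. (\<forall>i. cmod (\<zeta> i) = 1) \<and> inj_on \<zeta> {..n} \<and>
    (\<forall>k\<le>n. \<forall>z. cmod z = 1 \<longrightarrow>
       (\<Prod>j\<in>{..n}-{k}. (cmod (z - \<zeta> j))\<^sup>2) / q z \<le>
       (\<Prod>j\<in>{..n}-{k}. (cmod (\<zeta> k - \<zeta> j))\<^sup>2) / q (\<zeta> k))"
proof -
  \<comment> \<open>Full sequences instead of (n + 1)-tuples: compactness is then that of a product
    of circles, and \<open>V\<close> reads only the coordinates up to n.\<close>
  define S where "S = {\<zeta> :: nat \<Rightarrow> complex. \<forall>i. \<zeta> i \<in> sphere 0 1}"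
  have "compactin (product_topology (\<lambda>i::nat. euclidean) UNIV) (PiE UNIV (\<lambda>i. sphere (0::complex) 1))"
    unfolding compactin_PiE by auto
  moreover have "PiE UNIV (\<lambda>i. sphere (0::complex) 1) = S" by (auto simp: S_def PiE_def Pi_def)
  ultimately have S: "compact S" by (simp add: euclidean_product_topology)
  \<comment> \<open>Ordered pairs count each distance twice, so moving one point changes the
    numerator through squared distances.\<close>
  define P where "P = {(i, j). i \<le> n \<and> j \<le> n \<and> i \<noteq> j}"
  have "P \<subseteq> {..n} \<times> {..n}" by (auto simp: P_def)
  then have finP: "finite P" by (rule finite_subset) simp
  define V where "V = (\<lambda>\<zeta> :: nat \<Rightarrow> complex. (\<Prod>(i, j)\<in>P. cmod (\<zeta> i - \<zeta> j)) / (\<Prod>i\<le>n. q (\<zeta> i)))"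
  have coord: "continuous_on S (\<lambda>\<zeta>. \<zeta> i)" for i :: nat
    by (rule continuous_on_subset[OF continuous_on_product_coordinates]) simp
  have qS: "continuous_on S (\<lambda>\<zeta>. q (\<zeta> i))" for i :: nat
    by (rule continuous_on_compose2[OF q(1) coord]) (auto simp: S_def)
  have "continuous_on S V"
    unfolding V_def split_def using q(2)
    by (intro continuous_intros coord qS) (auto simp: S_def less_imp_neq[THEN not_sym])
  \<comment> \<open>Cayley images of the natural numbers: distinct points of the circle, which show
    that the maximum of \<open>V\<close> is positive.\<close>
  moreover define u where "u = (\<lambda>i::nat. (1 + \<i> * of_nat i) / (1 - \<i> * of_nat i))"
  have unz: "1 - \<i> * of_nat i \<noteq> 0" for i by (simp add: complex_eq_iff)
  have un: "cmod (u i) = 1" for i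
  proof -
    have "cmod (1 + \<i> * of_nat i) = cmod (1 - \<i> * of_nat i)" by (simp add: cmod_def)
    then show ?thesis using unz[of i] by (simp add: u_def norm_divide)
  qed
  have uinj: "u i \<noteq> u j" if "i \<noteq> j" for i j
  proof
    assume "u i = u j"
    then have "(1 + \<i> * of_nat i) * (1 - \<i> * of_nat j) = (1 + \<i> * of_nat j) * (1 - \<i> * of_nat i)"
      using unz by (simp add: u_def frac_eq_eq)
    then have "2 * \<i> * (of_nat i - of_nat j) = 0" by (simp add: algebra_simps)
    then show False using that by simp
  qed
  have uS: "u \<in> S" using un by (simp add: S_def)
  ultimately obtain \<zeta> where \<zeta>: "\<zeta> \<in> S" "\<And>\<xi>. \<xi> \<in> S \<Longrightarrow> V \<xi> \<le> V \<zeta>"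
    using continuous_attains_sup[OF S] by blast
  have n1: "cmod (\<zeta> i) = 1" for i using \<zeta>(1) by (simp add: S_def)
  have Qp: "(\<Prod>i\<le>n. q (\<xi> i)) > 0" if "\<xi> \<in> S" for \<xi>
    using that by (intro prod_pos) (auto simp: S_def intro!: q(2))
  have "V u > 0" unfolding V_def
    using uinj by (intro divide_pos_pos Qp uS prod_pos) (auto simp: P_def)
  then have V0: "V \<zeta> > 0" using \<zeta>(2)[OF uS] by simp
  have dist: "\<zeta> i \<noteq> \<zeta> j" if "i \<le> n" "j \<le> n" "i \<noteq> j" for i j
  proof
    assume "\<zeta> i = \<zeta> j"
    then have "(\<Prod>(i, j)\<in>P. cmod (\<zeta> i - \<zeta> j)) = 0"
      using finP that by (intro prod_zero bexI[of _ "(i, j)"]) (auto simp: P_def)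
    then show False using V0 by (simp add: V_def)
  qed
  have ext: "(\<Prod>j\<in>{..n}-{k}. (cmod (z - \<zeta> j))\<^sup>2) / q z \<le>
       (\<Prod>j\<in>{..n}-{k}. (cmod (\<zeta> k - \<zeta> j))\<^sup>2) / q (\<zeta> k)" if k: "k \<le> n" and z: "cmod z = 1" for k z
  proof -
    define J where "J = {..n} - {k}"
    define P' where "P' = {(i, j)\<in>P. i \<noteq> k \<and> j \<noteq> k}"
    \<comment> \<open>\<open>C\<close> collects all factors that do not involve the k-th point;
      being positive, it cancels from the comparison.\<close>
    define C where "C = (\<Prod>(i, j)\<in>P'. cmod (\<zeta> i - \<zeta> j)) / (\<Prod>i\<in>J. q (\<zeta> i))"
    have C: "C > 0" unfolding C_def
      using dist by (intro divide_pos_pos prod_pos) (auto simp: P'_def P_def n1 q(2))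
    have split: "V (\<zeta>(k := x)) = C * ((\<Prod>j\<in>J. (cmod (x - \<zeta> j))\<^sup>2) / q x)" for x
    proof -
      have P: "P = P' \<union> (Pair k ` J \<union> (\<lambda>j. (j, k)) ` J)"
        using k by (auto simp: P_def P'_def J_def)
      have fin: "finite P'" "finite J"
        by (rule finite_subset[OF _ finP]) (auto simp: P'_def J_def)
      have "(\<Prod>(i, j)\<in>P. cmod ((\<zeta>(k := x)) i - (\<zeta>(k := x)) j)) =
        (\<Prod>(i, j)\<in>P'. cmod ((\<zeta>(k := x)) i - (\<zeta>(k := x)) j)) *
        ((\<Prod>(i, j)\<in>Pair k ` J. cmod ((\<zeta>(k := x)) i - (\<zeta>(k := x)) j)) *
         (\<Prod>(i, j)\<in>(\<lambda>j. (j, k)) ` J. cmod ((\<zeta>(k := x)) i - (\<zeta>(k := x)) j)))"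
        unfolding P using fin
        by (subst prod.union_disjoint, force, force, force simp: P'_def J_def,
            subst prod.union_disjoint) (auto simp: J_def)
      also have "(\<Prod>(i, j)\<in>P'. cmod ((\<zeta>(k := x)) i - (\<zeta>(k := x)) j)) = (\<Prod>(i, j)\<in>P'. cmod (\<zeta> i - \<zeta> j))"
        by (intro prod.cong) (auto simp: P'_def)
      also have "(\<Prod>(i, j)\<in>Pair k ` J. cmod ((\<zeta>(k := x)) i - (\<zeta>(k := x)) j)) = (\<Prod>j\<in>J. cmod (x - \<zeta> j))"
        by (subst prod.reindex) (auto simp: J_def inj_on_def intro!: prod.cong)
      also have "(\<Prod>(i, j)\<in>(\<lambda>j. (j, k)) ` J. cmod ((\<zeta>(k := x)) i - (\<zeta>(k := x)) j)) = (\<Prod>j\<in>J. cmod (x - \<zeta> j))"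
        by (subst prod.reindex) (auto simp: J_def inj_on_def norm_minus_commute intro!: prod.cong)
      also have "(\<Prod>j\<in>J. cmod (x - \<zeta> j)) * (\<Prod>j\<in>J. cmod (x - \<zeta> j)) = (\<Prod>j\<in>J. (cmod (x - \<zeta> j))\<^sup>2)"
        by (simp add: prod.distrib[symmetric] power2_eq_square)
      finally have num: "(\<Prod>(i, j)\<in>P. cmod ((\<zeta>(k := x)) i - (\<zeta>(k := x)) j)) =
         (\<Prod>(i, j)\<in>P'. cmod (\<zeta> i - \<zeta> j)) * (\<Prod>j\<in>J. (cmod (x - \<zeta> j))\<^sup>2)" .
      have "(\<Prod>i\<le>n. q ((\<zeta>(k := x)) i)) = q x * (\<Prod>i\<in>J. q ((\<zeta>(k := x)) i))"
        using k by (subst prod.remove[of _ k]) (auto simp: J_def)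
      also have "(\<Prod>i\<in>J. q ((\<zeta>(k := x)) i)) = (\<Prod>i\<in>J. q (\<zeta> i))"
        by (intro prod.cong) (auto simp: J_def)
      finally show ?thesis unfolding V_def num C_def by (simp add: mult.commute)
    qed
    have "\<zeta>(k := z) \<in> S" using z n1 by (simp add: S_def)
    then have "V (\<zeta>(k := z)) \<le> V (\<zeta>(k := \<zeta> k))" using \<zeta>(2) by simp
    then show ?thesis unfolding split J_def[symmetric] using mult_le_cancel_left_pos[OF C] by blast
  qed
  show ?thesis using n1 dist ext by (intro exI[of _ \<zeta>]) (auto simp: inj_on_def)
qed

text \<open>A single directional derivative determines the complex derivative. Along the circle, W /
  \<kappa> has vanishing imaginary part and a real part with a maximum at w, so its tangential
  derivative has neither a real nor an imaginary part.\<close>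

lemma circle_extremum_critical:
  assumes W: "(W has_field_derivative W') (at w)" and w: "cmod w = 1" and \<kappa>: "\<kappa> \<noteq> 0"
    and R: "\<And>z. cmod z = 1 \<Longrightarrow> W z = \<kappa> * of_real (R z)"
    and max: "\<And>z. cmod z = 1 \<Longrightarrow> R z \<le> R w"
  shows "W' = 0"
proof -
  define v where "v = W' * (w * \<i>) / \<kappa>"
  have "((\<lambda>x. w * exp (\<i> * x)) has_field_derivative w * \<i>) (at 0)"
    by (auto intro!: derivative_eq_intros)
  moreover have "(W has_field_derivative W') (at (w * exp (\<i> * 0)))" using W by simp
  ultimately have "((\<lambda>x. W (w * exp (\<i> * x))) has_field_derivative W' * (w * \<i>)) (at 0)"
    by (rule DERIV_chain2[rotated])
  then have "((\<lambda>x. W (w * exp (\<i> * x)) / \<kappa>) has_field_derivative v) (at (of_real 0))"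
    unfolding v_def by (auto intro: DERIV_cdivide)
  then have "((\<lambda>t. W (w * exp (\<i> * of_real t)) / \<kappa>) has_vector_derivative v) (at 0)"
    by (rule has_vector_derivative_real_field)
  also have "(\<lambda>t. W (w * exp (\<i> * of_real t)) / \<kappa>) = (\<lambda>t. of_real (R (w * exp (\<i> * of_real t))))"
    using R w \<kappa> by (auto simp: norm_mult)
  finally have V: "((\<lambda>t. complex_of_real (R (w * exp (\<i> * of_real t)))) has_vector_derivative v) (at 0)" .
  have "((\<lambda>t. R (w * exp (\<i> * of_real t))) has_real_derivative Re v) (at 0)"
    using bounded_linear.has_vector_derivative[OF bounded_linear_Re V]
    by (simp add: has_real_derivative_iff_has_vector_derivative)
  then have re: "Re v = 0"
    by (rule DERIV_local_max[of _ _ _ 1]) (auto intro!: max simp: norm_mult w)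
  have "((\<lambda>t::real. 0::real) has_real_derivative Im v) (at 0)"
    using bounded_linear.has_vector_derivative[OF bounded_linear_Im V]
    by (simp add: has_real_derivative_iff_has_vector_derivative)
  then have "Im v = 0" using DERIV_unique[OF _ DERIV_const] by blast
  with re have "v = 0" by (simp add: complex_eq_iff)
  then show ?thesis using w \<kappa> by (auto simp: v_def)
qed


lemma pderiv_sum: "pderiv (\<Sum>i\<in>A. f i) = (\<Sum>i\<in>A. pderiv (f i))"
  by (induction A rule: infinite_finite_induct) (simp_all add: pderiv_add)

text \<open>Let \<open>N\<close> be the product of \<open>(z - c\<^sub>i) (1 - cnj c\<^sub>i z)\<close>. At weighted Fekete points \<open>\<zeta>\<^sub>k\<close>, maximizing
  the product of the distances \<open>|\<zeta>\<^sub>i - \<zeta>\<^sub>j|\<close> against the weight \<open>1 / |N|\<close>, the extremality conditions say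
  that \<open>N / \<Prod> (z - \<zeta>\<^sub>k)\<^sup>2\<close> has no residues, so it is a sum of multiples of \<open>1 / (z - \<zeta>\<^sub>k)\<^sup>2\<close>. These are,
  up to a common unimodular factor, positive multiples of the derivatives of the
  Herglotz kernels \<open>(\<zeta>\<^sub>k + z) / (\<zeta>\<^sub>k - z)\<close>.\<close>

lemma finite_critical_points_aux:
  fixes c :: "nat \<Rightarrow> complex"
  assumes "\<forall>i<n. cmod (c i) < 1"
  defines "N \<equiv> (\<lambda>z. \<Prod>i<n. (z - c i) * (1 - cnj (c i) * z))"
  shows "\<exists>(\<zeta> :: nat \<Rightarrow> complex) r \<kappa>. (\<forall>i. cmod (\<zeta> i) = 1) \<and> inj_on \<zeta> {..n} \<and> (\<forall>k\<le>n. r k > 0) \<and>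
     cmod \<kappa> = 1 \<and> (\<forall>z. N z = \<kappa> * (\<Sum>k\<le>n. of_real (r k) * \<zeta> k * (\<Prod>j\<in>{..n}-{k}. (z - \<zeta> j)\<^sup>2))) \<and>
     (\<forall>z. cmod z = 1 \<longrightarrow> cmod (N z) = (\<Sum>k\<le>n. r k * cmod (\<Prod>j\<in>{..n}-{k}. (z - \<zeta> j)\<^sup>2)))"
proof -
  note c = assms(1)[rule_format]
  define q where "q = (\<lambda>z. \<Prod>i<n. (cmod (z - c i))\<^sup>2)"
  have qpos: "q z > 0" if "cmod z = 1" for z
    unfolding q_def using c that by (intro prod_pos) fastforce
  have "continuous_on (sphere 0 1) q" unfolding q_def by (intro continuous_intros)
  from weighted_fekete_points[OF this qpos, of n]
  obtain \<zeta> where \<zeta>: "\<And>i::nat. cmod (\<zeta> i) = 1" "inj_on \<zeta> {..n}"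
    and max: "\<And>k z. k \<le> n \<Longrightarrow> cmod z = 1 \<Longrightarrow> (\<Prod>j\<in>{..n}-{k}. (cmod (z - \<zeta> j))\<^sup>2) / q z \<le>
       (\<Prod>j\<in>{..n}-{k}. (cmod (\<zeta> k - \<zeta> j))\<^sup>2) / q (\<zeta> k)" by blast
  have \<zeta>0: "\<zeta> i \<noteq> 0" for i using \<zeta>(1)[of i] by auto
  define M where "M = (\<lambda>k z. \<Prod>j\<in>{..n}-{k}. (z - \<zeta> j)\<^sup>2)"
  define A where "A = (\<lambda>k z. \<Prod>j\<in>{..n}-{k}. (cmod (z - \<zeta> j))\<^sup>2)"
  \<comment> \<open>On the circle every \<open>M k z * \<zeta> k\<close> has the phase
    \<open>\<mu> * z ^ n\<close>, whatever k is.\<close>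
  define \<mu> where "\<mu> = (-1) ^ n * (\<Prod>j\<le>n. \<zeta> j)"
  have \<mu>1: "cmod \<mu> = 1" by (simp add: \<mu>_def norm_mult norm_power prod_norm[symmetric] \<zeta>)
  have Mnz: "M k (\<zeta> k) \<noteq> 0" if "k \<le> n" for k
    unfolding M_def using inj_onD[OF \<zeta>(2), of k] that by auto
  have Ncirc: "N z = z ^ n * of_real (q z)" if "cmod z = 1" for z
    unfolding N_def q_def using unit_circle_reflected_factor[OF that] by (simp add: prod.distrib)
  have Mcirc: "M k z * \<zeta> k = \<mu> * z ^ n * of_real (A k z)" if z: "cmod z = 1" and k: "k \<le> n" for k z
  proof -
    have "M k z = (\<Prod>j\<in>{..n}-{k}. (- 1) * z * \<zeta> j * of_real ((cmod (z - \<zeta> j))\<^sup>2))"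
      unfolding M_def using unit_circle_diff_square[OF z \<zeta>(1)] by simp
    also have "\<dots> = ((-1) ^ n * z ^ n * (\<Prod>j\<in>{..n}-{k}. \<zeta> j)) * of_real (A k z)"
      using k by (simp only: prod.distrib prod_constant A_def of_real_prod) simp
    finally show ?thesis
      using prod.remove[of "{..n}" k \<zeta>] k by (simp add: \<mu>_def mult_ac)
  qed
  define r where "r = (\<lambda>k. q (\<zeta> k) / A k (\<zeta> k))"
  have Apos: "A k (\<zeta> k) > 0" if "k \<le> n" for k
    unfolding A_def using inj_onD[OF \<zeta>(2), of k] that by (intro prod_pos) auto
  have rpos: "r k > 0" if "k \<le> n" for k
    unfolding r_def using Apos[OF that] qpos[OF \<zeta>(1)] by simp
  \<comment> \<open>The coefficient of (z - \<open>\<zeta> k\<close>)^(-2) in the partial fraction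
    expansion of N divided by the product of all (z - \<open>\<zeta> j\<close>)^2. The phase
    computation shows that it is a positive number times \<open>\<zeta> k / \<mu>\<close>.\<close>
  define \<gamma> where "\<gamma> = (\<lambda>k. N (\<zeta> k) / M k (\<zeta> k))"
  have \<gamma>: "\<gamma> k = of_real (r k) * \<zeta> k / \<mu>" if k: "k \<le> n" for k
  proof -
    have "N (\<zeta> k) * \<mu> * of_real (A k (\<zeta> k)) = of_real (q (\<zeta> k)) * (M k (\<zeta> k) * \<zeta> k)"
      unfolding Ncirc[OF \<zeta>(1)] Mcirc[OF \<zeta>(1) k] by simp
    moreover have "\<mu> \<noteq> 0" using \<mu>1 by auto
    ultimately show ?thesis
      using Mnz[OF k] Apos[OF k] by (simp add: \<gamma>_def r_def field_simps)
  qed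
  define Np where "Np = (\<Prod>i<n. [:- c i, 1:] * [:1, - cnj (c i):])"
  define Mp where "Mp = (\<lambda>k. \<Prod>j\<in>{..n}-{k}. [:- \<zeta> j, 1:]\<^sup>2)"
  have polyN: "poly Np z = N z" for z
    unfolding Np_def N_def poly_prod poly_mult by (intro prod.cong refl) (simp add: algebra_simps)
  have polyM: "poly (Mp k) z = M k z" for k z
    unfolding Mp_def M_def poly_prod poly_power by simp
  \<comment> \<open>Up to nonzero factors this is the vanishing of the residue at
    \<open>\<zeta> k\<close>: the residue is the derivative of N / \<open>M k\<close> there, and the
    extremal property makes the derivative of the reciprocal zero.\<close>
  have M'eq: "poly (pderiv (Mp k)) (\<zeta> k) * N (\<zeta> k) = M k (\<zeta> k) * poly (pderiv Np) (\<zeta> k)" if k: "k \<le> n" for k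
  proof -
    have N0: "N (\<zeta> k) \<noteq> 0" using Ncirc[OF \<zeta>(1)] qpos[OF \<zeta>(1), of k] \<zeta>0 by simp
    have "((\<lambda>z. M k z / N z) has_field_derivative
       (poly (pderiv (Mp k)) (\<zeta> k) * N (\<zeta> k) - M k (\<zeta> k) * poly (pderiv Np) (\<zeta> k)) / (N (\<zeta> k) * N (\<zeta> k))) (at (\<zeta> k))"
      unfolding polyN[symmetric] polyM[symmetric]
      by (intro DERIV_divide poly_DERIV) (use N0 polyN in simp)
    then have "(poly (pderiv (Mp k)) (\<zeta> k) * N (\<zeta> k) - M k (\<zeta> k) * poly (pderiv Np) (\<zeta> k)) / (N (\<zeta> k) * N (\<zeta> k)) = 0"
    proof (rule circle_extremum_critical)
      show "\<mu> / \<zeta> k \<noteq> 0" using \<mu>1 \<zeta>0 by auto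
      show "M k z / N z = \<mu> / \<zeta> k * of_real (A k z / q z)" if z: "cmod z = 1" for z
        using Mcirc[OF z k] Ncirc[OF z] qpos[OF z] \<zeta>0[of k] z
        by (auto simp: field_simps)
      show "A k z / q z \<le> A k (\<zeta> k) / q (\<zeta> k)" if z: "cmod z = 1" for z
        unfolding A_def by (rule max[OF k z])
    qed (rule \<zeta>(1))
    then show ?thesis using N0 by simp
  qed
  define D where "D = Np - (\<Sum>k\<le>n. smult (\<gamma> k) (Mp k))"
  have other: "M j (\<zeta> k) = 0 \<and> poly (pderiv (Mp j)) (\<zeta> k) = 0" if "k \<le> n" "j \<noteq> k" for j k
  proof -
    have "Mp j = [:- \<zeta> k, 1:]\<^sup>2 * (\<Prod>i\<in>{..n}-{j}-{k}. [:- \<zeta> i, 1:]\<^sup>2)"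
      unfolding Mp_def using that by (subst prod.remove[of _ k]) auto
    then obtain E where E: "Mp j = [:- \<zeta> k, 1:] * ([:- \<zeta> k, 1:] * E)"
      unfolding power2_eq_square mult.assoc by blast
    have "poly (Mp j) (\<zeta> k) = 0" unfolding E by simp
    moreover have "poly (pderiv (Mp j)) (\<zeta> k) = 0"
      unfolding E pderiv_mult poly_add poly_mult by simp
    ultimately show ?thesis using polyM by simp
  qed
  have "D = 0"
  proof (rule double_roots_imp_zero)
    show "finite (\<zeta> ` {..n})" by simp
    show "poly D x = 0 \<and> poly (pderiv D) x = 0" if x: "x \<in> \<zeta> ` {..n}" for x
    proof -
      obtain k where k: "k \<le> n" "x = \<zeta> k" using x by blast
      have "(\<Sum>j\<le>n. \<gamma> j * M j (\<zeta> k)) = \<gamma> k * M k (\<zeta> k)"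
        using k other[OF k(1)] by (subst sum.remove[of _ k]) (auto intro!: sum.neutral)
      moreover have "(\<Sum>j\<le>n. \<gamma> j * poly (pderiv (Mp j)) (\<zeta> k)) = \<gamma> k * poly (pderiv (Mp k)) (\<zeta> k)"
        using k other[OF k(1)] by (subst sum.remove[of _ k]) (auto intro!: sum.neutral)
      moreover have "\<gamma> k * M k (\<zeta> k) = N (\<zeta> k)" using Mnz[OF k(1)] by (simp add: \<gamma>_def)
      moreover have "\<gamma> k * poly (pderiv (Mp k)) (\<zeta> k) = poly (pderiv Np) (\<zeta> k)"
        using M'eq[OF k(1)] Mnz[OF k(1)] by (simp add: \<gamma>_def field_simps)
      ultimately show ?thesis
        by (simp add: k(2) D_def poly_sum polyM polyN pderiv_diff pderiv_sum pderiv_smult)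
    qed
    have dN: "degree Np \<le> 2 * n"
    proof -
      have "degree Np \<le> (\<Sum>i<n. degree ([:- c i, 1:] * [:1, - cnj (c i):]))"
        unfolding Np_def by (rule order_trans[OF degree_prod_sum_le]) (simp_all only: o_def finite_lessThan order_refl)
      also have "\<dots> \<le> (\<Sum>i<n. 2)"
        by (intro sum_mono order_trans[OF degree_mult_le]) auto
      finally show ?thesis by simp
    qed
    have dM: "degree (Mp k) \<le> 2 * n" if "k \<le> n" for k
    proof -
      have "degree (Mp k) \<le> (\<Sum>j\<in>{..n}-{k}. degree ([:- \<zeta> j, 1:]\<^sup>2))"
        unfolding Mp_def by (rule order_trans[OF degree_prod_sum_le]) (simp_all only: o_def finite_Diff finite_atMost order_refl)
      also have "\<dots> \<le> (\<Sum>j\<in>{..n}-{k}. 2)"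
        by (intro sum_mono order_trans[OF degree_power_le]) auto
      finally show ?thesis using that by simp
    qed
    have "degree D \<le> 2 * n"
      unfolding D_def by (intro degree_diff_le dN degree_sum_le order_trans[OF degree_smult_le] dM) auto
    then show "degree D < 2 * card (\<zeta> ` {..n})" using \<zeta>(2) by (simp add: card_image)
  qed
  then have "poly Np z = (\<Sum>k\<le>n. \<gamma> k * M k z)" for z
    unfolding D_def by (simp add: poly_sum polyM)
  then have sumN: "N z = (\<Sum>k\<le>n. \<gamma> k * M k z)" for z by (simp add: polyN)
  have eq: "N z = (1 / \<mu>) * (\<Sum>k\<le>n. of_real (r k) * \<zeta> k * M k z)" for z
    unfolding sumN sum_distrib_left by (intro sum.cong refl) (simp add: \<gamma>)
  \<comment> \<open>All summands have the phase \<open>\<mu> * z ^ n\<close> on the circle, so the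
    triangle inequality is an equality.\<close>
  have circ: "cmod (N z) = (\<Sum>k\<le>n. r k * cmod (M k z))" if z: "cmod z = 1" for z
  proof -
    have "(\<Sum>k\<le>n. of_real (r k) * \<zeta> k * M k z) = (\<Sum>k\<le>n. \<mu> * z ^ n * of_real (r k * A k z))"
      using Mcirc[OF z] by (intro sum.cong refl) (simp add: mult_ac)
    also have "\<dots> = \<mu> * z ^ n * of_real (\<Sum>k\<le>n. r k * A k z)"
      by (simp add: sum_distrib_left)
    finally have "cmod (N z) = \<bar>\<Sum>k\<le>n. r k * A k z\<bar>"
      unfolding eq using z by (simp only: norm_mult norm_divide norm_power \<mu>1 norm_of_real) simp
    also have "\<dots> = (\<Sum>k\<le>n. r k * A k z)"
    proof (intro abs_of_nonneg sum_nonneg mult_nonneg_nonneg)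
      fix k assume "k \<in> {..n}"
      then show "0 \<le> r k" using rpos[of k] by simp
      show "0 \<le> A k z" unfolding A_def by (intro prod_nonneg) auto
    qed
    also have "\<dots> = (\<Sum>k\<le>n. r k * cmod (M k z))"
      by (simp add: A_def M_def prod_norm[symmetric] norm_power)
    finally show ?thesis .
  qed
  have \<mu>': "cmod (1 / \<mu>) = 1" using \<mu>1 by (simp add: norm_divide)
  show ?thesis
  proof (rule exI[of _ \<zeta>], rule exI[of _ r], rule exI[of _ "1 / \<mu>"], intro conjI)
    show "\<forall>i. cmod (\<zeta> i) = 1" using \<zeta>(1) by blast
    show "inj_on \<zeta> {..n}" by (rule \<zeta>(2))
    show "\<forall>k\<le>n. 0 < r k" using rpos by blast
    show "cmod (1 / \<mu>) = 1" by (rule \<mu>')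
    show "\<forall>z. N z = 1 / \<mu> * (\<Sum>k\<le>n. of_real (r k) * \<zeta> k * (\<Prod>j\<in>{..n}-{k}. (z - \<zeta> j)\<^sup>2))"
      using eq unfolding M_def by (rule allI)
    show "\<forall>z. cmod z = 1 \<longrightarrow> cmod (N z) = (\<Sum>k\<le>n. r k * cmod (\<Prod>j\<in>{..n}-{k}. (z - \<zeta> j)\<^sup>2))"
      using circ unfolding M_def by blast
  qed
qed

lemma near_unit_circle:
  fixes \<tau> :: "complex \<Rightarrow> real"
  assumes cont: "continuous_on (cball 0 1) \<tau>" and \<tau>1: "\<And>z. cmod z = 1 \<Longrightarrow> \<tau> z = 1" and e: "e > 0"
  shows "\<exists>\<rho><1. \<forall>z. \<rho> \<le> cmod z \<and> cmod z \<le> 1 \<longrightarrow> \<tau> z > 1 - e"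
proof -
  define A where "A = cball (0::complex) 1 \<inter> \<tau> -` {..1 - e}"
  have "closed A" unfolding A_def using cont by (intro continuous_closed_preimage) auto
  moreover have "bounded A" unfolding A_def by (intro bounded_Int) auto
  ultimately have A: "compact A" using compact_eq_bounded_closed by blast
  have "\<exists>\<rho><1. \<forall>z\<in>A. cmod z < \<rho>"
  proof (cases "A = {}")
    case False
    then obtain a where a: "a \<in> A" "\<forall>z\<in>A. cmod z \<le> cmod a"
      using continuous_attains_sup[OF A False, of cmod] by (auto intro: continuous_intros)
    have "cmod a < 1" using a(1) \<tau>1[of a] e by (cases "cmod a = 1") (auto simp: A_def)
    then show ?thesis using a(2) by (intro exI[of _ "(1 + cmod a) / 2"]) force
  qed (auto intro: exI[of _ 0])
  then obtain \<rho> where \<rho>: "\<rho> < 1" "\<And>z. z \<in> A \<Longrightarrow> cmod z < \<rho>" by blast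
  have "\<tau> z > 1 - e" if "\<rho> \<le> cmod z" "cmod z \<le> 1" for z
    using \<rho>(2)[of z] that by (force simp: A_def)
  then show ?thesis using \<rho>(1) by blast
qed

text \<open>H is the Herglotz sum with the positive masses \<open>r k\<close> at
  \<open>\<zeta> k\<close>, and F is its Cayley transform; H' vanishes in the disc exactly at the
  zeros of N there. The asymptotics at the circle come from a cancellation: the hyperbolic
  derivative of F equals |N| divided by the sum of \<open>r k\<close> |\<open>M k\<close>|. Unlike
  H, this ratio extends continuously to the closed disc.\<close>

lemma finite_critical_points:
  fixes c :: "nat \<Rightarrow> complex"
  assumes c: "\<And>i. i < n \<Longrightarrow> cmod (c i) < 1"
  shows "\<exists>F K. holomorphic_selfmap F \<and> K holomorphic_on \<D> \<and>
     (\<forall>z\<in>\<D>. K z \<noteq> 0 \<and> deriv F z = (\<Prod>i<n. z - c i) * K z) \<and>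
     (\<forall>e>0. \<exists>\<rho><1. \<forall>z. \<rho> \<le> cmod z \<and> cmod z < 1 \<longrightarrow>
       (1 - e) * (1 - (cmod (F z))\<^sup>2) \<le> (1 - (cmod z)\<^sup>2) * cmod (deriv F z))"
proof -
  define N where "N = (\<lambda>z. \<Prod>i<n. (z - c i) * (1 - cnj (c i) * z))"
  have N_eq: "(\<Prod>i<n. (z - c i) * (1 - cnj (c i) * z)) = N z" for z by (simp only: N_def)
  obtain \<zeta> :: "nat \<Rightarrow> complex" and r \<kappa> where all: "\<forall>i. cmod (\<zeta> i) = 1" "inj_on \<zeta> {..n}"
    "\<forall>k\<le>n. r k > 0" "cmod \<kappa> = 1"
    "\<forall>z. N z = \<kappa> * (\<Sum>k\<le>n. of_real (r k) * \<zeta> k * (\<Prod>j\<in>{..n}-{k}. (z - \<zeta> j)\<^sup>2))"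
    "\<forall>z. cmod z = 1 \<longrightarrow> cmod (N z) = (\<Sum>k\<le>n. r k * cmod (\<Prod>j\<in>{..n}-{k}. (z - \<zeta> j)\<^sup>2))"
  proof -
    have "\<forall>i<n. cmod (c i) < 1" using c by blast
    from finite_critical_points_aux[OF this, unfolded N_eq] show thesis
      using that by (elim exE conjE)
  qed
  note \<zeta> = all(1)[rule_format] all(2) and r = all(3)[rule_format] and \<kappa> = all(4)
    and N = all(5)[rule_format] and Ncirc = all(6)[rule_format]
  have nz: "\<zeta> k - z \<noteq> 0" if "z \<in> \<D>" for k z using \<zeta>(1)[of k] that by auto
  define M where "M = (\<lambda>k z. \<Prod>j\<in>{..n}-{k}. (z - \<zeta> j)\<^sup>2)"
  define \<Theta> where "\<Theta> = (\<lambda>z. \<Prod>j\<le>n. (z - \<zeta> j)\<^sup>2)"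
  have \<Theta>0: "\<Theta> z \<noteq> 0" if "z \<in> \<D>" for z
    using nz[OF that] by (force simp: \<Theta>_def)
  have M: "M k z = \<Theta> z / (\<zeta> k - z)\<^sup>2" if "k \<le> n" "z \<in> \<D>" for k z
  proof -
    have "\<Theta> z = (z - \<zeta> k)\<^sup>2 * M k z"
      unfolding \<Theta>_def M_def using that by (subst prod.remove[of _ k]) auto
    then show ?thesis using nz[OF that(2), of k] by (simp add: power2_commute)
  qed
  define H where "H = (\<lambda>z. \<Sum>k\<le>n. of_real (r k) * ((\<zeta> k + z) / (\<zeta> k - z)))"
  have \<kappa>0: "\<kappa> \<noteq> 0" using \<kappa> by auto
  have dH: "(H has_field_derivative (2 / \<kappa> * (N z / \<Theta> z))) (at z)" if z: "z \<in> \<D>" for z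
  proof -
    have "(H has_field_derivative (\<Sum>k\<le>n. of_real (r k) * (2 * \<zeta> k / (\<zeta> k - z)\<^sup>2))) (at z)"
      unfolding H_def
    proof (intro DERIV_sum DERIV_cmult)
      fix k
      have "((\<lambda>x. (\<zeta> k + x) / (\<zeta> k - x)) has_field_derivative
          (1 * (\<zeta> k - z) - (\<zeta> k + z) * (- 1)) / ((\<zeta> k - z) * (\<zeta> k - z))) (at z)"
        by (intro DERIV_divide) (use nz[OF z, of k] in \<open>auto intro!: derivative_eq_intros\<close>)
      then show "((\<lambda>x. (\<zeta> k + x) / (\<zeta> k - x)) has_field_derivative 2 * \<zeta> k / (\<zeta> k - z)\<^sup>2) (at z)"
        by (simp add: power2_eq_square)
    qed
    also have "(\<Sum>k\<le>n. of_real (r k) * (2 * \<zeta> k / (\<zeta> k - z)\<^sup>2)) = 2 / \<Theta> z * (\<Sum>k\<le>n. of_real (r k) * \<zeta> k * M k z)"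
      unfolding sum_distrib_left using \<Theta>0[OF z] by (intro sum.cong refl) (simp add: M[OF _ z])
    also have "\<dots> = 2 / \<kappa> * (N z / \<Theta> z)" using \<kappa>0 unfolding N M_def by simp
    finally show ?thesis .
  qed
  have Hhol: "H holomorphic_on \<D>"
    unfolding holomorphic_on_open[OF open_ball] using dH by blast
  define S where "S = (\<lambda>z. \<Sum>k\<le>n. r k / (cmod (\<zeta> k - z))\<^sup>2)"
  have ReH: "Re (H z) = (1 - (cmod z)\<^sup>2) * S z" if z: "z \<in> \<D>" for z
  proof -
    have "Re ((\<zeta> k + z) / (\<zeta> k - z)) = (1 - (cmod z)\<^sup>2) / (cmod (\<zeta> k - z))\<^sup>2" for k
    proof -
      have "Re ((\<zeta> k + z) / (\<zeta> k - z)) = Re ((\<zeta> k + z) * cnj (\<zeta> k - z)) / (cmod (\<zeta> k - z))\<^sup>2"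
        by (subst complex_div_cnj) (simp only: of_real_power[symmetric] Re_divide_of_real)
      also have "Re ((\<zeta> k + z) * cnj (\<zeta> k - z)) = (cmod (\<zeta> k))\<^sup>2 - (cmod z)\<^sup>2"
        unfolding cmod_power2 by (simp add: algebra_simps power2_eq_square)
      finally show ?thesis using \<zeta>(1) by simp
    qed
    note frac = this
    have re: "Re (of_real a * w) = a * Re w" for a w by simp
    show ?thesis unfolding H_def S_def sum_distrib_left Re_sum re frac by (simp add: mult.commute)
  qed
  have Spos: "S z > 0" if z: "z \<in> \<D>" for z
    unfolding S_def using r nz[OF z] by (intro sum_pos divide_pos_pos) auto
  have ReHpos: "Re (H z) > 0" if z: "z \<in> \<D>" for z
    using ReH[OF z] Spos[OF z] one_minus_norm2_pos[of z] z by simp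
  have H1: "H z + 1 \<noteq> 0" if z: "z \<in> \<D>" for z
    using ReHpos[OF z] by (auto simp: complex_eq_iff)
  define F where "F = (\<lambda>z. (H z - 1) / (H z + 1))"
  have Fhol: "F holomorphic_on \<D>" unfolding F_def using H1 by (intro holomorphic_intros Hhol) auto
  have dF: "deriv F z = 4 / \<kappa> * (N z / \<Theta> z) / (H z + 1)\<^sup>2" if z: "z \<in> \<D>" for z
  proof -
    define D where "D = 2 / \<kappa> * (N z / \<Theta> z)"
    have "(F has_field_derivative (D * (H z + 1) - (H z - 1) * D) / ((H z + 1) * (H z + 1))) (at z)"
      unfolding F_def by (intro DERIV_divide) (use dH[OF z] H1[OF z] D_def in \<open>auto intro!: derivative_eq_intros\<close>)
    also have "(D * (H z + 1) - (H z - 1) * D) / ((H z + 1) * (H z + 1)) = 2 * D / (H z + 1)\<^sup>2"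
      by (simp add: algebra_simps power2_eq_square)
    finally show ?thesis by (auto dest: DERIV_imp_deriv simp: D_def)
  qed
  have Fn: "1 - (cmod (F z))\<^sup>2 = 4 * Re (H z) / (cmod (H z + 1))\<^sup>2" if z: "z \<in> \<D>" for z
  proof -
    have "(cmod (H z + 1))\<^sup>2 - (cmod (H z - 1))\<^sup>2 = 4 * Re (H z)"
      unfolding cmod_power2 by (simp add: algebra_simps power2_eq_square)
    moreover have "(cmod (H z + 1))\<^sup>2 \<noteq> 0" using H1[OF z] by simp
    ultimately show ?thesis
      by (simp add: F_def norm_divide power_divide field_simps)
  qed
  have Fself: "holomorphic_selfmap F"
  proof -
    have "F z \<in> \<D>" if z: "z \<in> \<D>" for z
    proof -
      have "1 - (cmod (F z))\<^sup>2 > 0" unfolding Fn[OF z] using ReHpos[OF z] H1[OF z] by simp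
      then show ?thesis by (simp add: abs_square_less_1)
    qed
    then show ?thesis using Fhol by (auto simp: holomorphic_selfmap_def)
  qed
  define K where "K = (\<lambda>z. (\<Prod>i<n. 1 - cnj (c i) * z) * (4 / \<kappa>) / (\<Theta> z * (H z + 1)\<^sup>2))"
  have "\<Theta> holomorphic_on \<D>" unfolding \<Theta>_def by (intro holomorphic_intros)
  then have Khol: "K holomorphic_on \<D>" unfolding K_def using \<Theta>0 H1
    by (intro holomorphic_intros Hhol) auto
  have K0: "K z \<noteq> 0" if z: "z \<in> \<D>" for z
    unfolding K_def using \<Theta>0[OF z] H1[OF z] \<kappa>0 moebius_denom_nonzero[OF c, of _ z] z by auto
  have K: "deriv F z = (\<Prod>i<n. z - c i) * K z" if z: "z \<in> \<D>" for z
    unfolding dF[OF z] K_def N_def by (simp add: prod.distrib mult_ac)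
  \<comment> \<open>On the closed disc the \<open>M k\<close> have no common zero: a zero of
    \<open>M 0\<close> is some \<open>\<zeta> j\<close>, and \<open>M j\<close> is nonzero there
    because the points are distinct.\<close>
  define T where "T = (\<lambda>z. \<Sum>k\<le>n. r k * cmod (M k z))"
  have Tpos: "T z > 0" if "cmod z \<le> 1" for z
  proof (rule ccontr)
    have ge: "r k * cmod (M k z) \<ge> 0" if "k \<le> n" for k using r[OF that] by simp
    assume "\<not> T z > 0"
    moreover have "T z \<ge> 0" unfolding T_def by (intro sum_nonneg) (use ge in auto)
    ultimately have "T z = 0" by simp
    then have all0: "\<forall>k\<in>{..n}. r k * cmod (M k z) = 0"
      unfolding T_def using ge by (subst sum_nonneg_eq_0_iff[symmetric]) auto
    have M0: "M k z = 0" if k: "k \<le> n" for k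
    proof -
      have "r k * cmod (M k z) = 0" using all0 k by blast
      then show ?thesis using r[OF k] by simp
    qed
    from M0[of 0, OF le0] obtain j where j: "j \<le> n" "z = \<zeta> j" unfolding M_def by auto
    have "M j (\<zeta> j) \<noteq> 0" unfolding M_def using inj_onD[OF \<zeta>(2), of j] j(1) by auto
    then show False using M0[OF j(1)] j(2) by simp
  qed
  define \<tau> where "\<tau> = (\<lambda>z. cmod (N z) / T z)"
  have "continuous_on (cball 0 1) T" unfolding T_def M_def by (intro continuous_intros)
  moreover have "continuous_on (cball 0 1) N" unfolding N_def by (intro continuous_intros)
  ultimately have cont\<tau>: "continuous_on (cball 0 1) \<tau>"
    unfolding \<tau>_def by (intro continuous_intros) (use Tpos in force)+
  have \<tau>1: "\<tau> z = 1" if "cmod z = 1" for z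
    using Tpos[of z] Ncirc[OF that] that unfolding \<tau>_def T_def M_def by simp
  have \<tau>eq: "(1 - (cmod z)\<^sup>2) * cmod (deriv F z) = \<tau> z * (1 - (cmod (F z))\<^sup>2)" if z: "z \<in> \<D>" for z
  proof -
    have T: "T z = cmod (\<Theta> z) * S z"
      unfolding T_def S_def sum_distrib_left using M[OF _ z]
      by (intro sum.cong refl) (simp add: norm_divide norm_power)
    have "cmod (\<Theta> z) > 0" "cmod (H z + 1) > 0" using \<Theta>0[OF z] H1[OF z] by auto
    then show ?thesis
      unfolding dF[OF z] Fn[OF z] ReH[OF z] \<tau>_def T using Spos[OF z]
      by (simp add: norm_mult norm_divide norm_power \<kappa>)
  qed
  have "\<exists>\<rho><1. \<forall>z. \<rho> \<le> cmod z \<and> cmod z < 1 \<longrightarrow>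
       (1 - e) * (1 - (cmod (F z))\<^sup>2) \<le> (1 - (cmod z)\<^sup>2) * cmod (deriv F z)" if e: "e > 0" for e
  proof -
    obtain \<rho> where \<rho>: "\<rho> < 1" "\<And>z. \<rho> \<le> cmod z \<Longrightarrow> cmod z \<le> 1 \<Longrightarrow> \<tau> z > 1 - e"
      using near_unit_circle[OF cont\<tau> \<tau>1 e] by blast
    show ?thesis
    proof (intro exI[of _ \<rho>] conjI \<rho>(1) allI impI)
      fix z assume z: "\<rho> \<le> cmod z \<and> cmod z < 1"
      then have "\<tau> z > 1 - e" using \<rho>(2)[of z] by simp
      moreover have "1 - (cmod (F z))\<^sup>2 > 0"
        using one_minus_norm2_pos[OF selfmap_in_disc[OF Fself]] z by simp
      ultimately show "(1 - e) * (1 - (cmod (F z))\<^sup>2) \<le> (1 - (cmod z)\<^sup>2) * cmod (deriv F z)"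
        using z by (simp add: \<tau>eq)
    qed
  qed
  then show ?thesis using Fself Khol K0 K by blast
qed

section \<open>Zeros of bounded holomorphic functions\<close>

lemma blaschke_factor_moebius:
  assumes "cmod a < 1"
  obtains u where "cmod u = 1" "\<And>z. blaschke_factor a z = u * disc_moebius a z"
proof (cases "a = 0")
  case True
  then show ?thesis using that[of 1] by (simp add: blaschke_factor_def disc_moebius_def)
next
  case False
  have "cmod (- (of_real (cmod a) / a)) = 1" using False by (simp add: norm_divide)
  moreover have "blaschke_factor a z = - (of_real (cmod a) / a) * disc_moebius a z" for z
    using False by (simp add: blaschke_factor_def disc_moebius_def divide_inverse algebra_simps)
  ultimately show ?thesis using that by blast
qed

lemma norm_blaschke_factor: "cmod a < 1 \<Longrightarrow> cmod (blaschke_factor a z) = cmod (disc_moebius a z)"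
  by (metis blaschke_factor_moebius norm_mult mult_1)

lemma blaschke_factor_lt_1: "cmod a < 1 \<Longrightarrow> cmod z < 1 \<Longrightarrow> cmod (blaschke_factor a z) < 1"
  by (simp add: norm_blaschke_factor moebius_in_disc)

lemma blaschke_factor_unit_circle:
  assumes "cmod a < 1" "cmod z = 1"
  shows "cmod (blaschke_factor a z) = 1"
proof -
  have "1 - (cmod (disc_moebius a z))\<^sup>2 = 0" using assms by (simp add: moebius_norm)
  then have "(cmod (disc_moebius a z))\<^sup>2 = 1\<^sup>2" by simp
  then show ?thesis using assms by (simp only: norm_blaschke_factor power2_eq_iff_nonneg norm_ge_zero zero_le_one)
qed

lemma blaschke_factor_eq_0_iff: "cmod a < 1 \<Longrightarrow> cmod z \<le> 1 \<Longrightarrow> blaschke_factor a z = 0 \<longleftrightarrow> z = a"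
  using norm_blaschke_factor[of a z] moebius_denom_nonzero[of a z]
  by (auto simp: disc_moebius_def)

lemma blaschke_factor_holomorphic:
  assumes a: "cmod a < 1"
  shows "blaschke_factor a holomorphic_on cball 0 1"
proof -
  obtain u where u: "\<And>z. blaschke_factor a z = u * disc_moebius a z"
    using blaschke_factor_moebius[OF a] by blast
  have "(\<lambda>z. u * disc_moebius a z) holomorphic_on cball 0 1"
    by (intro holomorphic_intros moebius_holomorphic a)
  moreover have "blaschke_factor a = (\<lambda>z. u * disc_moebius a z)" by (rule ext) (rule u)
  ultimately show ?thesis by simp
qed

text \<open>The normalization |a| / a in \<open>blaschke_factor\<close> makes the factor tend to 1
  as |a| tends to 1, at the rate that the Blaschke condition can sum. It enters through the identity
  |a| (a - z) - a (1 - cnj a z) = (|a| - 1) (a + |a| z).\<close>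

lemma blaschke_factor_close_to_1:
  assumes a: "cmod a < 1" and z: "cmod z < 1"
  shows "cmod (blaschke_factor a z - 1) \<le> 2 / (1 - cmod z) * (1 - cmod a)"
proof (cases "a = 0")
  case True
  have "cmod (z - 1) \<le> 2" using norm_triangle_ineq4[of z 1] z by simp
  also have "\<dots> \<le> 2 / (1 - cmod z)" using z by (simp add: field_simps)
  finally show ?thesis using True by (simp add: blaschke_factor_def)
next
  case False
  have nz: "1 - cnj a * z \<noteq> 0" using moebius_denom_nonzero a z by simp
  have aa: "a * cnj a = of_real (cmod a) * of_real (cmod a)"
    using complex_norm_square[of a] by (simp add: power2_eq_square)
  have "r / a * (b / c) - 1 = (r * b - a * c) / (a * c)" if "c \<noteq> 0" for r b c
    using False that by (simp add: diff_divide_distrib)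
  from this[OF nz] have "blaschke_factor a z - 1 = (of_real (cmod a) * (a - z) - a * (1 - cnj a * z)) / (a * (1 - cnj a * z))"
    using False by (simp only: blaschke_factor_def if_False)
  also have "of_real (cmod a) * (a - z) - a * (1 - cnj a * z) = (of_real (cmod a) - 1) * (a + of_real (cmod a) * z)"
  proof -
    have eq: "a * (1 - cnj a * z) = a - of_real (cmod a) * of_real (cmod a) * z"
      unfolding aa[symmetric] by (simp add: algebra_simps)
    show ?thesis unfolding eq by (simp add: algebra_simps)
  qed
  finally have *: "blaschke_factor a z - 1 = (of_real (cmod a) - 1) * (a + of_real (cmod a) * z) / (a * (1 - cnj a * z))" .
  have eq: "cmod (blaschke_factor a z - 1) = (1 - cmod a) * cmod (a + of_real (cmod a) * z) / (cmod a * cmod (1 - cnj a * z))"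
  proof -
    have "cmod (of_real (cmod a) - 1) = 1 - cmod a"
      using a by (metis abs_minus_commute abs_of_pos diff_gt_0_iff_gt norm_of_real of_real_1 of_real_diff)
    then show ?thesis unfolding * by (simp only: norm_mult norm_divide)
  qed
  have "cmod (a + of_real (cmod a) * z) \<le> cmod a * 2"
  proof -
    have "cmod (a + of_real (cmod a) * z) \<le> cmod a + cmod a * cmod z"
      using norm_triangle_ineq[of a "of_real (cmod a) * z"] by (simp add: norm_mult)
    also have "\<dots> \<le> cmod a + cmod a * 1" using z by (intro add_left_mono mult_left_mono) auto
    finally show ?thesis by simp
  qed
  moreover have "cmod (1 - cnj a * z) \<ge> 1 - cmod z"
  proof -
    have "cmod (cnj a * z) \<le> cmod z" using a by (simp add: norm_mult mult_left_le_one_le)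
    then show ?thesis using norm_triangle_ineq2[of 1 "cnj a * z"] by simp
  qed
  ultimately have "(1 - cmod a) * cmod (a + of_real (cmod a) * z) / (cmod a * cmod (1 - cnj a * z))
     \<le> (1 - cmod a) * (cmod a * 2) / (cmod a * (1 - cmod z))"
    using a z False by (intro frac_le mult_left_mono mult_nonneg_nonneg mult_pos_pos) auto
  also have "\<dots> = 2 / (1 - cmod z) * (1 - cmod a)" using False by simp
  finally show ?thesis using eq by simp
qed

lemma max_modulus_disc:
  assumes G: "G holomorphic_on \<D>"
    and bd: "\<And>e. e > 0 \<Longrightarrow> \<exists>\<rho><1. \<forall>z. \<rho> \<le> cmod z \<and> cmod z < 1 \<longrightarrow> cmod (G z) \<le> 1 + e"
    and z: "cmod z < 1"
  shows "cmod (G z) \<le> 1"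
proof (rule field_le_epsilon)
  fix e :: real assume "e > 0"
  then obtain \<rho> where \<rho>: "\<rho> < 1" "\<And>z. \<rho> \<le> cmod z \<Longrightarrow> cmod z < 1 \<Longrightarrow> cmod (G z) \<le> 1 + e"
    using bd by blast
  define r where "r = (1 + max \<rho> (cmod z)) / 2"
  have r: "\<rho> \<le> r" "cmod z < r" "r < 1" using \<rho>(1) z by (auto simp: r_def)
  have r0: "0 < r" using r(2) by (meson norm_ge_zero order_le_less_trans)
  show "cmod (G z) \<le> 1 + e"
  proof (rule maximum_modulus_frontier[of G "cball 0 r"])
    show "G holomorphic_on interior (cball 0 r)"
      using r by (intro holomorphic_on_subset[OF G]) auto
    show "continuous_on (closure (cball 0 r)) G"
      using r by (intro continuous_on_subset[OF holomorphic_on_imp_continuous_on[OF G]]) auto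
    show "cmod (G w) \<le> 1 + e" if "w \<in> frontier (cball 0 r)" for w
      using that r r0 \<rho>(2)[of w] by simp
  qed (use r in auto)
qed

lemma inverse_bound_near_1:
  fixes e :: real
  assumes "e > 0"
  obtains d where "d > 0" "\<And>x :: real. x > 1 - d \<Longrightarrow> x > 0 \<and> 1 / x \<le> 1 + e"
proof
  define d where "d = e / (1 + e)"
  show "d > 0" using assms by (simp add: d_def)
  show "x > 0 \<and> 1 / x \<le> 1 + e" if "x > 1 - d" for x
  proof -
    have "1 - d = 1 / (1 + e)" using assms by (simp add: d_def field_simps)
    then have x: "1 / (1 + e) < x" using that by simp
    moreover have "1 / (1 + e) > 0" using assms by simp
    ultimately have "x > 0" by linarith
    then show ?thesis using x assms by (simp add: field_simps)
  qed
qed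

section \<open>Finite Blaschke products near the circle and successive removal of zeros\<close>

definition finite_bprod :: "(nat \<Rightarrow> complex) \<Rightarrow> nat \<Rightarrow> complex \<Rightarrow> complex" where
  "finite_bprod a N z = (\<Prod>n<N. blaschke_factor (a n) z)"

lemma finite_bprod_holomorphic:
  assumes "\<And>n. n < N \<Longrightarrow> cmod (a n) < 1"
  shows "finite_bprod a N holomorphic_on cball 0 1"
  unfolding finite_bprod_def[abs_def] using assms blaschke_factor_holomorphic
  by (intro holomorphic_intros) auto

lemma finite_bprod_near_circle:
  assumes a: "\<And>n. n < N \<Longrightarrow> cmod (a n) < 1" and e: "e > 0"
  shows "\<exists>\<rho><1. \<forall>z. \<rho> \<le> cmod z \<and> cmod z \<le> 1 \<longrightarrow> cmod (finite_bprod a N z) > 1 - e"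
proof (rule near_unit_circle[OF _ _ e])
  show "continuous_on (cball 0 1) (\<lambda>z. cmod (finite_bprod a N z))"
    by (intro continuous_on_norm holomorphic_on_imp_continuous_on finite_bprod_holomorphic a)
  show "cmod (finite_bprod a N z) = 1" if "cmod z = 1" for z
    unfolding finite_bprod_def using blaschke_factor_unit_circle[OF a that]
    by (simp flip: prod_norm)
qed

lemma finite_bprod_le_1:
  assumes "\<And>n. n < N \<Longrightarrow> cmod (a n) < 1" "cmod z < 1"
  shows "cmod (finite_bprod a N z) \<le> 1"
  unfolding finite_bprod_def prod_norm[symmetric]
  using assms by (intro prod_le_1) (auto intro: less_imp_le blaschke_factor_lt_1)

text \<open>A finite product has modulus tending uniformly to 1 at the circle, so removing it leaves
  the boundary bound intact although it may be small inside.\<close>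

lemma max_modulus_quotient:
  assumes G: "G holomorphic_on \<D>" and a: "\<And>n. n < N \<Longrightarrow> cmod (a n) < 1"
    and bd: "\<And>z. cmod z < 1 \<Longrightarrow> cmod (finite_bprod a N z * G z) \<le> 1" and z: "cmod z < 1"
  shows "cmod (G z) \<le> 1"
proof (rule max_modulus_disc[OF G _ z])
  fix e :: real assume "e > 0"
  then obtain d where d: "d > 0" "\<And>x :: real. x > 1 - d \<Longrightarrow> x > 0 \<and> 1 / x \<le> 1 + e"
    using inverse_bound_near_1 by blast
  obtain \<rho> where \<rho>: "\<rho> < 1" "\<And>z. \<rho> \<le> cmod z \<Longrightarrow> cmod z \<le> 1 \<Longrightarrow> cmod (finite_bprod a N z) > 1 - d"
    using finite_bprod_near_circle[of N a, OF a d(1)] by blast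
  have "cmod (G z) \<le> 1 + e" if z: "\<rho> \<le> cmod z" "cmod z < 1" for z
  proof -
    have x: "cmod (finite_bprod a N z) > 0" "1 / cmod (finite_bprod a N z) \<le> 1 + e"
      using d(2)[OF \<rho>(2)[OF z(1)]] z by auto
    have "cmod (G z) \<le> 1 / cmod (finite_bprod a N z)"
      using bd[OF z(2)] x(1) by (simp add: norm_mult field_simps)
    then show ?thesis using x(2) by simp
  qed
  then show "\<exists>\<rho><1. \<forall>z. \<rho> \<le> cmod z \<and> cmod z < 1 \<longrightarrow> cmod (G z) \<le> 1 + e"
    using \<rho>(1) by blast
qed

lemma divide_zero_by_blaschke_factor:
  assumes G: "G holomorphic_on \<D>" "\<And>z. cmod z < 1 \<Longrightarrow> cmod (G z) \<le> 1" and a: "cmod a < 1" "G a = 0"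
  shows "\<exists>G1. G1 holomorphic_on \<D> \<and> (\<forall>z. cmod z < 1 \<longrightarrow> cmod (G1 z) \<le> 1 \<and> G z = blaschke_factor a z * G1 z)"
proof -
  obtain u where u: "cmod u = 1" "\<And>z. blaschke_factor a z = u * disc_moebius a z"
    using blaschke_factor_moebius[OF a(1)] by blast
  define k where "k = (\<lambda>z. if z = a then deriv G a else (G z - G a) / (z - a))"
  have k: "k holomorphic_on \<D>" unfolding k_def using pole_lemma_open[OF G(1) open_ball] .
  define G1 where "G1 = (\<lambda>z. k z * (1 - cnj a * z) / u)"
  have u0: "u \<noteq> 0" using u by auto
  have G1: "G1 holomorphic_on \<D>" unfolding G1_def using u0 by (intro holomorphic_intros k) auto
  have eq: "G z = blaschke_factor a z * G1 z" if "cmod z < 1" for z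
    using u0 moebius_denom_nonzero[OF a(1), of z] that a(2)
    by (simp add: u(2) G1_def k_def disc_moebius_def)
  have "cmod (G1 z) \<le> 1" if "cmod z < 1" for z
  proof (rule max_modulus_quotient[OF G1 _ _ that, of 1 "\<lambda>_. a"])
    show "cmod (finite_bprod (\<lambda>_. a) 1 z * G1 z) \<le> 1" if "cmod z < 1" for z
      using eq[OF that] G(2)[OF that] by (simp add: finite_bprod_def)
  qed (use a in auto)
  then show ?thesis using G1 eq by blast
qed

lemma zero_of_minimal_modulus:
  assumes G: "G holomorphic_on \<D>" and z: "cmod z < 1" "G z = 0"
  shows "\<exists>a. cmod a < 1 \<and> G a = 0 \<and> (\<forall>w. cmod w < 1 \<and> G w = 0 \<longrightarrow> cmod a \<le> cmod w)"
proof -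
  define A where "A = cball 0 (cmod z) \<inter> G -` {0}"
  have "continuous_on (cball 0 (cmod z)) G"
    using z by (intro continuous_on_subset[OF holomorphic_on_imp_continuous_on[OF G]]) auto
  then have "closed A" unfolding A_def by (intro continuous_closed_preimage) auto
  moreover have "bounded A" unfolding A_def by (intro bounded_Int) auto
  ultimately have A: "compact A" using compact_eq_bounded_closed by blast
  have zA: "z \<in> A" using z by (auto simp: A_def)
  then obtain a where a: "a \<in> A" "\<forall>w\<in>A. cmod a \<le> cmod w"
    using continuous_attains_inf[OF A, of cmod] by (auto intro: continuous_intros)
  have "cmod a \<le> cmod w" if "cmod w < 1" "G w = 0" for w
  proof (cases "w \<in> A")
    case False
    then have "cmod z < cmod w" using that by (auto simp: A_def)
    moreover have "cmod a \<le> cmod z" using a(2) zA by blast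
    ultimately show ?thesis by simp
  qed (use a(2) in blast)
  moreover have "cmod a < 1" using a(1) z(1) by (auto simp: A_def)
  ultimately show ?thesis using a(1) by (intro exI[of _ a]) (auto simp: A_def)
qed

text \<open>Zeros are split off in order of increasing modulus, multiple ones repeatedly, so what
  remains at stage N has no zero of modulus below |\<open>a N\<close>|. Either the process stops
  with a zero-free factor or it runs forever. The order later guarantees that each smaller disc is
  cleared after finitely many steps.\<close>

lemma successive_zeros:
  assumes G: "G holomorphic_on \<D>" "\<forall>z. cmod z < 1 \<longrightarrow> cmod (G z) \<le> 1"
    and nz: "cmod z0 < 1" "G z0 \<noteq> 0"
  shows "(\<exists>N a S. (\<forall>i. cmod (a i) < 1) \<and> S holomorphic_on \<D> \<and>
      (\<forall>z. cmod z < 1 \<longrightarrow> cmod (S z) \<le> 1 \<and> S z \<noteq> 0 \<and> G z = finite_bprod a N z * S z)) \<or>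
    (\<exists>a S. \<forall>N. cmod (a N) < 1 \<and> S N holomorphic_on \<D> \<and> S N (a N) = 0 \<and>
      (\<forall>z. cmod z < 1 \<longrightarrow> cmod (S N z) \<le> 1 \<and> (S N z = 0 \<longrightarrow> cmod (a N) \<le> cmod z) \<and>
         G z = finite_bprod a N z * S N z \<and> S N z = blaschke_factor (a N) z * S (Suc N) z))" (is "?A \<or> ?B")
proof (cases ?A)
  case False
  define P where "P = (\<lambda>N S. S holomorphic_on \<D> \<and> (\<forall>z. cmod z < 1 \<longrightarrow> cmod (S z) \<le> 1) \<and>
     (\<exists>a. (\<forall>i. cmod (a i) < 1) \<and> (\<forall>z. cmod z < 1 \<longrightarrow> G z = finite_bprod a N z * S z)))"
  define Q where "Q = (\<lambda>S S'. \<exists>a. cmod a < 1 \<and> S a = 0 \<and> (\<forall>z. cmod z < 1 \<and> S z = 0 \<longrightarrow> cmod a \<le> cmod z) \<and>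
     (\<forall>z. cmod z < 1 \<longrightarrow> S z = blaschke_factor a z * S' z))"
  have "\<exists>S. \<forall>n. P n (S n) \<and> Q (S n) (S (Suc n))"
  proof (rule dependent_nat_choice)
    show "\<exists>S. P 0 S" unfolding P_def using G
      by (intro exI[of _ G] conjI exI[of _ "\<lambda>_. 0"]) (auto simp: finite_bprod_def)
    fix S n assume PS: "P n S"
    then obtain a where a: "\<And>i. cmod (a i) < 1" "\<And>z. cmod z < 1 \<Longrightarrow> G z = finite_bprod a n z * S z"
      and S: "S holomorphic_on \<D>" "\<And>z. cmod z < 1 \<Longrightarrow> cmod (S z) \<le> 1"
      unfolding P_def by blast
    \<comment> \<open>A zero-free S at this stage would realize the first alternative, so its
      failure supplies a zero to remove.\<close>
    obtain z where z: "cmod z < 1" "S z = 0"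
      using False a S by blast
    obtain b where b: "cmod b < 1" "S b = 0" "\<forall>w. cmod w < 1 \<and> S w = 0 \<longrightarrow> cmod b \<le> cmod w"
      using zero_of_minimal_modulus[OF S(1) z] by blast
    obtain S' where S': "S' holomorphic_on \<D>"
      "\<And>z. cmod z < 1 \<Longrightarrow> cmod (S' z) \<le> 1 \<and> S z = blaschke_factor b z * S' z"
      using divide_zero_by_blaschke_factor[OF S b(1,2)] by blast
    have "P (Suc n) S'" unfolding P_def
    proof (intro conjI exI[of _ "a(n := b)"] allI impI)
      show "cmod ((a(n := b)) i) < 1" for i using a b by simp
      fix z :: complex assume z: "cmod z < 1"
      have "finite_bprod (a(n := b)) n z = finite_bprod a n z"
        unfolding finite_bprod_def by (intro prod.cong) auto
      then have "finite_bprod (a(n := b)) (Suc n) z = finite_bprod a n z * blaschke_factor b z"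
        by (simp add: finite_bprod_def)
      then show "G z = finite_bprod (a(n := b)) (Suc n) z * S' z"
        using a(2)[OF z] S'(2)[OF z] by simp
    qed (use S' in auto)
    moreover have "Q S S'" unfolding Q_def using b S' by blast
    ultimately show "\<exists>S'. P (Suc n) S' \<and> Q S S'" by blast
  qed
  then obtain S where S: "\<And>n. P n (S n)" "\<And>n. Q (S n) (S (Suc n))" by blast
  obtain a0 where S0: "\<And>z. cmod z < 1 \<Longrightarrow> G z = finite_bprod a0 0 z * S 0 z"
    using S(1)[of 0] unfolding P_def by blast
  obtain a where a: "\<And>n. cmod (a n) < 1 \<and> S n (a n) = 0 \<and> (\<forall>z. cmod z < 1 \<and> S n z = 0 \<longrightarrow> cmod (a n) \<le> cmod z) \<and>
     (\<forall>z. cmod z < 1 \<longrightarrow> S n z = blaschke_factor (a n) z * S (Suc n) z)"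
    using S(2) unfolding Q_def by metis
  have "G z = finite_bprod a N z * S N z" if "cmod z < 1" for z N
  proof (induction N)
    case 0
    then show ?case using S0[OF that] by (simp add: finite_bprod_def)
  next
    case (Suc N)
    then show ?case using a[of N] that by (simp add: finite_bprod_def)
  qed
  then have ?B using a S(1) unfolding P_def by blast
  then show ?thesis ..
qed blast

text \<open>Since - ln x >= 1 - x for x = |factor|^2, each 1 - |\<open>a n\<close>| is bounded by a
  multiple of - ln |factor|, and these logarithms add up to at most - ln c. The constant \<kappa>
  comes from |1 - cnj a z| <= 2.\<close>

lemma blaschke_condition:
  assumes a: "\<And>n. cmod (a n) < 1" and z: "cmod z < 1"
    and bd: "\<And>N. c \<le> cmod (finite_bprod a N z)" and c: "c > 0"
  shows "summable (\<lambda>n. 1 - cmod (a n))"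
proof -
  define \<kappa> where "\<kappa> = (1 - (cmod z)\<^sup>2) / 4"
  have \<kappa>: "\<kappa> > 0" using one_minus_norm2_pos[OF z] by (simp add: \<kappa>_def)
  have le: "\<kappa> * (1 - cmod (a n)) \<le> - 2 * ln (cmod (blaschke_factor (a n) z))"
    "cmod (blaschke_factor (a n) z) > 0" for n
  proof -
    have nb: "finite_bprod a (Suc n) z \<noteq> 0" using bd[of "Suc n"] c by force
    then show pos: "cmod (blaschke_factor (a n) z) > 0" by (auto simp: finite_bprod_def)
    have n2: "cmod (1 - cnj (a n) * z) \<le> 2"
    proof -
      have "cmod (cnj (a n) * z) \<le> 1" using a[of n] z by (simp add: norm_mult mult_le_one)
      then show ?thesis using norm_triangle_ineq4[of 1 "cnj (a n) * z"] by simp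
    qed
    have "\<kappa> * (1 - cmod (a n)) = (1 - cmod (a n)) * (1 - (cmod z)\<^sup>2) / 2\<^sup>2" by (simp add: \<kappa>_def)
    also have "\<dots> \<le> (1 - (cmod (a n))\<^sup>2) * (1 - (cmod z)\<^sup>2) / (cmod (1 - cnj (a n) * z))\<^sup>2"
    proof (rule frac_le)
      have "(cmod (a n))\<^sup>2 \<le> cmod (a n)" using a[of n] by (simp add: power2_eq_square mult_left_le)
      then show "(1 - cmod (a n)) * (1 - (cmod z)\<^sup>2) \<le> (1 - (cmod (a n))\<^sup>2) * (1 - (cmod z)\<^sup>2)"
        using one_minus_norm2_pos[OF z] by (intro mult_right_mono) auto
      show "(cmod (1 - cnj (a n) * z))\<^sup>2 \<le> 2\<^sup>2" using n2 by (intro power_mono) auto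
      show "0 < (cmod (1 - cnj (a n) * z))\<^sup>2" using moebius_denom_nonzero[OF a, of z] z by simp
      show "0 \<le> (1 - (cmod (a n))\<^sup>2) * (1 - (cmod z)\<^sup>2)"
        using one_minus_norm2_pos[OF a[of n]] one_minus_norm2_pos[OF z] by simp
    qed
    also have "\<dots> = 1 - (cmod (blaschke_factor (a n) z))\<^sup>2"
      using moebius_norm[OF a, of z] z by (simp add: norm_blaschke_factor[OF a])
    also have "\<dots> \<le> - ln ((cmod (blaschke_factor (a n) z))\<^sup>2)"
      using ln_le_minus_one[of "(cmod (blaschke_factor (a n) z))\<^sup>2"] pos by simp
    finally show "\<kappa> * (1 - cmod (a n)) \<le> - 2 * ln (cmod (blaschke_factor (a n) z))"
      using pos by (simp add: ln_realpow)
  qed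
  have "(\<Sum>n<N. 1 - cmod (a n)) \<le> - 2 * ln c / \<kappa>" for N
  proof -
    have "\<kappa> * (\<Sum>n<N. 1 - cmod (a n)) \<le> (\<Sum>n<N. - 2 * ln (cmod (blaschke_factor (a n) z)))"
      unfolding sum_distrib_left by (intro sum_mono le)
    also have "\<dots> = - 2 * ln (cmod (finite_bprod a N z))"
      unfolding finite_bprod_def prod_norm[symmetric] sum_distrib_left[symmetric]
      by (subst ln_prod) (use le(2) in auto)
    also have "\<dots> \<le> - 2 * ln c"
      using ln_le_cancel_iff[OF c order_less_le_trans[OF c bd[of N]]] bd[of N] by simp
    finally show ?thesis using \<kappa> by (simp add: field_simps)
  qed
  from this[of "Suc _"] show ?thesis
    unfolding lessThan_Suc_atMost
    by (intro bounded_imp_summable[of _ "- 2 * ln c / \<kappa>"]) (use a in \<open>auto intro: less_imp_le\<close>)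
qed

section \<open>Maximal Blaschke products dominate\<close>

lemma holomorphic_disc_isCont: "f holomorphic_on \<D> \<Longrightarrow> z \<in> \<D> \<Longrightarrow> isCont f z"
  using holomorphic_on_imp_continuous_on continuous_on_eq_continuous_at open_ball by blast

text \<open>As b may be unbounded, it is rescaled from a disc of radius r < 1 containing z0. If the
  removal of zeros does not stop, the Blaschke condition forces the moduli of the zeros to 1. So
  after finitely many steps nothing remains in |z| <= \<rho>; any zeros further out stay in
  k.\<close>

lemma finite_zeros_factorization:
  assumes b: "b holomorphic_on \<D>" and z0: "cmod z0 < 1" "b z0 \<noteq> 0" and \<rho>: "0 < \<rho>" "\<rho> < 1"
  shows "\<exists>n (c :: nat \<Rightarrow> complex) k. (\<forall>i. cmod (c i) < 1) \<and> k holomorphic_on \<D> \<and>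
     (\<forall>z\<in>\<D>. b z = (\<Prod>i<n. z - c i) * k z) \<and> (\<forall>z. cmod z \<le> \<rho> \<longrightarrow> k z \<noteq> 0)"
proof -
  define r where "r = (1 + max \<rho> (cmod z0)) / 2"
  have r: "\<rho> < r" "cmod z0 < r" "r < 1" "0 < r" using \<rho> z0 by (auto simp: r_def)
  have "continuous_on (cball 0 r) b"
    using r by (intro continuous_on_subset[OF holomorphic_on_imp_continuous_on[OF b]]) auto
  then have "bounded (b ` cball 0 r)" by (intro compact_imp_bounded compact_continuous_image) auto
  then obtain M where M: "M > 0" "\<And>z. z \<in> cball 0 r \<Longrightarrow> cmod (b z) \<le> M"
    unfolding bounded_pos by blast
  define G where "G = (\<lambda>w. b (of_real r * w) / of_real M)"
  have rD: "of_real r * w \<in> cball 0 r" "of_real r * w \<in> \<D>" if "cmod w < 1" for w :: complex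
  proof -
    have "r * cmod w \<le> r * 1" using r that by (intro mult_left_mono) auto
    then show "of_real r * w \<in> cball 0 r" using r by (simp add: norm_mult)
    then show "of_real r * w \<in> \<D>" using r by simp
  qed
  have "(b \<circ> (\<lambda>w. of_real r * w)) holomorphic_on \<D>"
    using rD(2) by (intro holomorphic_on_compose_gen[OF _ b] holomorphic_intros) auto
  then have G: "G holomorphic_on \<D>" unfolding G_def using M(1)
    by (intro holomorphic_intros) (auto simp: o_def)
  have G1: "\<forall>w. cmod w < 1 \<longrightarrow> cmod (G w) \<le> 1"
    using M(2)[OF rD(1)] M(1) by (auto simp: G_def norm_divide)
  define w0 where "w0 = z0 / of_real r"
  have w0: "cmod w0 < 1" "G w0 \<noteq> 0" using r z0 M by (auto simp: w0_def G_def norm_divide)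
  have "\<exists>N a S. (\<forall>i. cmod (a i) < 1) \<and> S holomorphic_on \<D> \<and>
      (\<forall>z. cmod z < 1 \<longrightarrow> G z = finite_bprod a N z * S z) \<and> (\<forall>z. cmod z \<le> \<rho> / r \<longrightarrow> S z \<noteq> 0)"
    using successive_zeros[OF G G1 w0]
  proof (elim disjE exE)
    fix N a S
    assume "(\<forall>i. cmod (a i) < 1) \<and> S holomorphic_on \<D> \<and>
      (\<forall>z. cmod z < 1 \<longrightarrow> cmod (S z) \<le> 1 \<and> S z \<noteq> 0 \<and> G z = finite_bprod a N z * S z)"
    moreover have "cmod z < 1" if "cmod z \<le> \<rho> / r" for z :: complex
    proof -
      have "\<rho> / r < 1" using r by simp
      then show ?thesis using that by linarith
    qed
    ultimately show ?thesis by blast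
  next
    fix a S
    assume *: "\<forall>N. cmod (a N) < 1 \<and> S N holomorphic_on \<D> \<and> S N (a N) = 0 \<and>
      (\<forall>z. cmod z < 1 \<longrightarrow> cmod (S N z) \<le> 1 \<and> (S N z = 0 \<longrightarrow> cmod (a N) \<le> cmod z) \<and>
         G z = finite_bprod a N z * S N z \<and> S N z = blaschke_factor (a N) z * S (Suc N) z)"
    have "cmod (G w0) \<le> cmod (finite_bprod a N w0)" for N
    proof -
      have "G w0 = finite_bprod a N w0 * S N w0" "cmod (S N w0) \<le> 1" using * w0(1) by blast+
      then have "cmod (G w0) \<le> cmod (finite_bprod a N w0)" by (simp add: norm_mult mult_left_le)
      then show ?thesis .
    qed
    moreover have "cmod (a n) < 1" for n using * by blast
    ultimately have "summable (\<lambda>n. 1 - cmod (a n))"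
      using blaschke_condition[of a w0 "cmod (G w0)"] w0 by simp
    then have "(\<lambda>n. 1 - cmod (a n)) \<longlonglongrightarrow> 0" by (rule summable_LIMSEQ_zero)
    moreover have "0 < 1 - \<rho> / r" using r by simp
    ultimately have "\<forall>\<^sub>F n in sequentially. 1 - cmod (a n) < 1 - \<rho> / r" by (rule order_tendstoD)
    then obtain N where N: "1 - cmod (a N) < 1 - \<rho> / r"
      by (auto simp: eventually_sequentially)
    have "S N z \<noteq> 0" if "cmod z \<le> \<rho> / r" for z
    proof -
      have "cmod z < cmod (a N)" using N that by simp
      moreover from this have "cmod z < 1" using * by (meson order_less_trans)
      ultimately show ?thesis using * by (meson not_less)
    qed
    then show ?thesis using * by blast
  qed
  then obtain N a S where a: "\<And>i. cmod (a i) < 1" and S: "S holomorphic_on \<D>"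
    and GS: "\<And>z. cmod z < 1 \<Longrightarrow> G z = finite_bprod a N z * S z"
    and S0: "\<And>z. cmod z \<le> \<rho> / r \<Longrightarrow> S z \<noteq> 0" by blast
  have "\<exists>u. cmod u = 1 \<and> (\<forall>z. blaschke_factor (a i) z = u * disc_moebius (a i) z)" for i
    using blaschke_factor_moebius[OF a[of i]] by blast
  then obtain u where u: "\<And>i. cmod (u i) = 1" "\<And>i z. blaschke_factor (a i) z = u i * disc_moebius (a i) z"
    by metis
  define c where "c = (\<lambda>i. of_real r * a i)"
  define k0 where "k0 = (\<lambda>z. of_real M * S (z / of_real r) *
     (\<Prod>i<N. (u i / of_real r) / (1 - cnj (a i) * (z / of_real r))))"
  \<comment> \<open>Inside radius r the rescaled cofactor continues the quotient across the removed
    zeros, all of which lie there; outside, the plain quotient is holomorphic. The two agree on the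
    overlap.\<close>
  define k where "k = (\<lambda>z. if z \<in> ball 0 r then k0 z else b z / (\<Prod>i<N. z - c i))"
  have zr: "cmod (z / of_real r) < 1" if "z \<in> ball 0 r" for z
    using that r by (simp add: norm_divide)
  have c: "c i \<in> ball 0 r" "cmod (c i) < 1" for i
  proof -
    have "r * cmod (a i) < r * 1" using a[of i] r by (intro mult_strict_left_mono) auto
    then show "c i \<in> ball 0 r" using r by (simp add: c_def norm_mult)
    then show "cmod (c i) < 1" using r by simp
  qed
  have den: "1 - cnj (a i) * (z / of_real r) \<noteq> 0" if "z \<in> ball 0 r" for z i
    using moebius_denom_nonzero[OF a[of i], of "z / of_real r"] zr[OF that] by simp
  have bk0: "b z = (\<Prod>i<N. z - c i) * k0 z" if z: "z \<in> ball 0 r" for z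
  proof -
    have "blaschke_factor (a i) (z / of_real r) =
        (z - c i) * ((u i / of_real r) / (1 - cnj (a i) * (z / of_real r)))" for i
    proof -
      have "z / of_real r - a i = (z - c i) / of_real r" using r by (simp add: c_def diff_divide_distrib)
      then show ?thesis unfolding u(2) disc_moebius_def by simp
    qed
    then have "finite_bprod a N (z / of_real r) =
       (\<Prod>i<N. z - c i) * (\<Prod>i<N. (u i / of_real r) / (1 - cnj (a i) * (z / of_real r)))"
      unfolding finite_bprod_def by (simp only: prod.distrib)
    moreover have "b z = of_real M * G (z / of_real r)" using M(1) r by (simp add: G_def)
    ultimately show ?thesis using GS[OF zr[OF z]] by (simp add: k0_def mult_ac)
  qed
  have "(S \<circ> (\<lambda>z. z / of_real r)) holomorphic_on ball 0 r"
    using zr r by (intro holomorphic_on_compose_gen[OF _ S] holomorphic_intros) auto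
  then have k0: "k0 holomorphic_on ball 0 r" unfolding k0_def
    using den r by (intro holomorphic_intros) (auto simp: o_def)
  have "k holomorphic_on ball 0 r \<union> (\<D> - c ` {..<N})"
  proof (rule holomorphic_on_Un)
    show "k holomorphic_on ball 0 r" by (rule holomorphic_transform[OF k0]) (simp add: k_def)
    have "(\<lambda>z. b z / (\<Prod>i<N. z - c i)) holomorphic_on \<D> - c ` {..<N}"
      using b by (intro holomorphic_intros) (auto intro: holomorphic_on_subset)
    then show "k holomorphic_on \<D> - c ` {..<N}"
    proof (rule holomorphic_transform)
      fix z assume z: "z \<in> \<D> - c ` {..<N}"
      then have "(\<Prod>i<N. z - c i) \<noteq> 0" by auto
      then show "b z / (\<Prod>i<N. z - c i) = k z" using bk0[of z] by (simp add: k_def)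
    qed
  qed (auto intro: open_Diff finite_imp_closed)
  moreover have "\<D> \<subseteq> ball 0 r \<union> (\<D> - c ` {..<N})" using c(1) by auto
  ultimately have k: "k holomorphic_on \<D>" by (rule holomorphic_on_subset)
  have bk: "b z = (\<Prod>i<N. z - c i) * k z" for z
  proof (cases "z \<in> ball 0 r")
    case False
    then have "(\<Prod>i<N. z - c i) \<noteq> 0" using c(1) by auto
    then show ?thesis using False by (simp add: k_def)
  qed (simp add: k_def bk0)
  have k1: "k z \<noteq> 0" if "cmod z \<le> \<rho>" for z
  proof -
    have z: "z \<in> ball 0 r" using that r by simp
    have "S (z / of_real r) \<noteq> 0" using that r by (intro S0) (simp add: norm_divide divide_right_mono)
    moreover have "u i \<noteq> 0" for i using u(1)[of i] by auto
    ultimately show ?thesis using z den[OF z] M(1) r by (simp add: k_def k0_def)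
  qed
  show ?thesis
  proof (rule exI[of _ N], rule exI[of _ c], rule exI[of _ k], intro conjI)
    show "\<forall>i. cmod (c i) < 1" using c(2) by (rule allI)
    show "k holomorphic_on \<D>" by (rule k)
    show "\<forall>z\<in>\<D>. b z = (\<Prod>i<N. z - c i) * k z" by (rule ballI) (rule bk)
    show "\<forall>z. cmod z \<le> \<rho> \<longrightarrow> k z \<noteq> 0" by (intro allI impI) (rule k1)
  qed
qed

text \<open>The normalization \<open>F 0 = 0\<close> keeps the limit of the maps \<open>F\<close> inside the disc.\<close>

lemma prescribed_zeros_dominating_selfmap:
  assumes B: "holomorphic_selfmap B" and z0: "z0 \<in> \<D>" "deriv B z0 \<noteq> 0" and \<rho>: "0 < \<rho>" "\<rho> < 1"
  shows "\<exists>F \<psi>. holomorphic_selfmap F \<and> F 0 = 0 \<and> \<psi> holomorphic_on \<D> \<and>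
     (\<forall>z\<in>\<D>. deriv B z = \<psi> z * deriv F z) \<and> (\<forall>z. cmod z \<le> \<rho> \<longrightarrow> \<psi> z \<noteq> 0) \<and>
     (\<forall>\<phi> U h. sk_metric \<phi> U \<and> h holomorphic_on \<D> \<and> (\<forall>z\<in>\<D>. \<phi> z = h z * deriv B z) \<longrightarrow>
        (\<forall>z\<in>\<D>. cmod (h z * \<psi> z) * U z * (1 - (cmod (F z))\<^sup>2) \<le> 1))"
proof -
  have Bh: "B holomorphic_on \<D>" "deriv B holomorphic_on \<D>"
    using B by (auto simp: holomorphic_selfmap_def intro: holomorphic_deriv)
  obtain n c k where c: "\<And>i. cmod (c i) < 1" and k: "k holomorphic_on \<D>"
    and Bk: "\<And>z. z \<in> \<D> \<Longrightarrow> deriv B z = (\<Prod>i<(n::nat). z - c i) * k z" and k0: "\<And>z. cmod z \<le> \<rho> \<Longrightarrow> k z \<noteq> 0"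
  proof -
    have "cmod z0 < 1" using z0(1) by simp
    from finite_zeros_factorization[OF Bh(2) this z0(2) \<rho>] show thesis using that by blast
  qed
  obtain F0 K where F0: "holomorphic_selfmap F0" and K: "K holomorphic_on \<D>"
    and F0K: "\<And>z. z \<in> \<D> \<Longrightarrow> K z \<noteq> 0 \<and> deriv F0 z = (\<Prod>i<n. z - c i) * K z"
    and compl: "\<And>e. e > 0 \<Longrightarrow> \<exists>\<rho><1. \<forall>z. \<rho> \<le> cmod z \<and> cmod z < 1 \<longrightarrow>
       (1 - e) * (1 - (cmod (F0 z))\<^sup>2) \<le> (1 - (cmod z)\<^sup>2) * cmod (deriv F0 z)"
    using finite_critical_points[of n c] c by blast
  define a where "a = F0 0"
  have a: "cmod a < 1" unfolding a_def using selfmap_in_disc[OF F0] by simp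
  define F where "F = (\<lambda>z. disc_moebius a (F0 z))"
  have F: "holomorphic_selfmap F" unfolding F_def by (rule selfmap_moebius_compose[OF F0 a])
  have F00: "F 0 = 0" by (simp add: F_def a_def disc_moebius_def)
  define m where "m = (\<lambda>z. deriv (disc_moebius a) (F0 z))"
  have m0: "m z \<noteq> 0" if "z \<in> \<D>" for z
    unfolding m_def using deriv_moebius_nonzero[OF a selfmap_in_disc[OF F0]] that by simp
  have dF: "deriv F z = m z * deriv F0 z" if "z \<in> \<D>" for z
    unfolding F_def m_def by (rule deriv_moebius_compose[OF F0 a that])
  have "(deriv (disc_moebius a) \<circ> F0) holomorphic_on \<D>"
  proof (rule holomorphic_on_compose_gen)
    show "deriv (disc_moebius a) holomorphic_on \<D>"
      by (intro holomorphic_deriv holomorphic_on_subset[OF moebius_holomorphic[OF a]]) auto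
  qed (use F0 in \<open>auto simp: holomorphic_selfmap_def\<close>)
  then have m: "m holomorphic_on \<D>" by (simp add: m_def o_def)
  \<comment> \<open>The factors \<open>K\<close> and \<open>m\<close> have no zeros, so \<psi>
    vanishes only where \<open>k\<close> does, hence not on |z| <= \<rho>.\<close>
  define \<psi> where "\<psi> = (\<lambda>z. k z / (K z * m z))"
  have \<psi>: "\<psi> holomorphic_on \<D>" unfolding \<psi>_def using F0K m0 by (intro holomorphic_intros k K m) auto
  have B\<psi>: "deriv B z = \<psi> z * deriv F z" if "z \<in> \<D>" for z
    using F0K[OF that] m0[OF that] by (simp add: \<psi>_def dF[OF that] Bk[OF that])
  have \<psi>0: "\<psi> z \<noteq> 0" if "cmod z \<le> \<rho>" for z
    using k0[OF that] F0K[of z] m0[of z] that \<rho> by (simp add: \<psi>_def)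
  have "cmod (h z * \<psi> z) * U z * (1 - (cmod (F z))\<^sup>2) \<le> 1"
    if sk: "sk_metric \<phi> U" and h: "h holomorphic_on \<D>" "\<forall>z\<in>\<D>. \<phi> z = h z * deriv B z" and z: "z \<in> \<D>" for \<phi> U h z
  proof (rule comparison_complete[OF sk F])
    show "(\<lambda>z. h z * \<psi> z) holomorphic_on \<D>" by (intro holomorphic_intros h \<psi>)
    show "\<phi> w = deriv F w * (h w * \<psi> w)" if "w \<in> \<D>" for w
      using h(2) B\<psi>[OF that] that by simp
    show "\<exists>\<rho><1. \<forall>z. \<rho> \<le> cmod z \<and> cmod z < 1 \<longrightarrow>
       (1 - e) * (1 - (cmod (F z))\<^sup>2) \<le> (1 - (cmod z)\<^sup>2) * cmod (deriv F z)" if e: "e > 0" for e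
    proof -
      have "(1 - e) * (1 - (cmod (F z))\<^sup>2) \<le> (1 - (cmod z)\<^sup>2) * cmod (deriv F z)"
        if "(1 - e) * (1 - (cmod (F0 z))\<^sup>2) \<le> (1 - (cmod z)\<^sup>2) * cmod (deriv F0 z)" "cmod z < 1" for z
      proof -
        have p: "1 - (cmod (F z))\<^sup>2 > 0" "1 - (cmod (F0 z))\<^sup>2 > 0"
          using one_minus_norm2_pos selfmap_in_disc[OF F that(2)] selfmap_in_disc[OF F0 that(2)] by auto
        have "1 - e \<le> hyp_deriv F0 z"
          using that(1) p(2) by (simp add: hyp_deriv_def field_simps)
        also have "hyp_deriv F0 z = hyp_deriv F z"
          unfolding F_def using hyp_deriv_moebius_compose[OF F0 a] that(2) by simp
        finally show ?thesis using p(1) by (simp add: hyp_deriv_def field_simps)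
      qed
      then show ?thesis using compl[OF e] by blast
    qed
  qed (rule z)
  then show ?thesis using F F00 \<psi> B\<psi> \<psi>0 by blast
qed

text \<open>A normal family argument along discs exhausting \<D>. The F n are bounded by 1; the
  \<psi> n are locally bounded because domination also applies to the metric of B. Carrying \<psi> n
  along turns equality of critical points in the limit into zero-freeness of the limit of \<psi> n,
  which Hurwitz' theorem provides.\<close>

lemma dominating_selfmap:
  assumes B: "holomorphic_selfmap B" and z0: "z0 \<in> \<D>" "deriv B z0 \<noteq> 0"
  shows "\<exists>F \<psi>. holomorphic_selfmap F \<and> \<psi> holomorphic_on \<D> \<and>
     (\<forall>z\<in>\<D>. deriv B z = \<psi> z * deriv F z \<and> \<psi> z \<noteq> 0) \<and>
     (\<forall>\<phi> U h. sk_metric \<phi> U \<and> h holomorphic_on \<D> \<and> (\<forall>z\<in>\<D>. \<phi> z = h z * deriv B z) \<longrightarrow>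
        (\<forall>z\<in>\<D>. cmod (h z * \<psi> z) * U z * (1 - (cmod (F z))\<^sup>2) \<le> 1))"
proof -
  define \<rho> where "\<rho> = (\<lambda>n::nat. 1 - 1 / (real n + 2))"
  have \<rho>: "0 < \<rho> n" "\<rho> n < 1" for n by (auto simp: \<rho>_def field_simps)
  define dom where "dom = (\<lambda>F \<psi>. \<forall>\<phi> U h. sk_metric \<phi> U \<and> h holomorphic_on \<D> \<and> (\<forall>z\<in>\<D>. \<phi> z = h z * deriv B z) \<longrightarrow>
        (\<forall>z\<in>\<D>. cmod (h z * \<psi> z) * U z * (1 - (cmod (F z))\<^sup>2) \<le> (1::real)))"
  have "\<forall>n. \<exists>F \<psi>. holomorphic_selfmap F \<and> F 0 = 0 \<and> \<psi> holomorphic_on \<D> \<and>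
     (\<forall>z\<in>\<D>. deriv B z = \<psi> z * deriv F z) \<and> (\<forall>z. cmod z \<le> \<rho> n \<longrightarrow> \<psi> z \<noteq> 0) \<and> dom F \<psi>"
    unfolding dom_def using prescribed_zeros_dominating_selfmap[OF B z0 \<rho>] by blast
  then obtain F \<psi> where F: "\<And>n. holomorphic_selfmap (F n)" "\<And>n. F n 0 = 0"
    and \<psi>: "\<And>n. \<psi> n holomorphic_on \<D>" "\<And>n z. cmod z \<le> \<rho> n \<Longrightarrow> \<psi> n z \<noteq> 0"
    and BF: "\<And>n z. z \<in> \<D> \<Longrightarrow> deriv B z = \<psi> n z * deriv (F n) z" and dom: "\<And>n. dom (F n) (\<psi> n)"
    by metis
  have Fz: "cmod (F n z) \<le> cmod z" if "cmod z < 1" for n z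
    using Schwarz_Lemma(1)[of "F n" z] F selfmap_in_disc[OF F(1)] that
    by (auto simp: holomorphic_selfmap_def)
  have \<psi>bd: "cmod (\<psi> n z) \<le> 1 / (1 - (cmod z)\<^sup>2)" if z: "z \<in> \<D>" for n z
  proof -
    have Bz: "1 - (cmod (B z))\<^sup>2 > 0" using one_minus_norm2_pos[OF selfmap_in_disc[OF B]] z by simp
    \<comment> \<open>Domination is applied to B itself with h = 1. Together with
      |\<open>F n z\<close>| <= |z| from the Schwarz lemma this bounds \<psi> n locally.\<close>
    have "cmod (1 * \<psi> n z) * (1 / (1 - (cmod (B z))\<^sup>2)) * (1 - (cmod (F n z))\<^sup>2) \<le> 1"
      by (rule dom[of n, unfolded dom_def, rule_format, of "deriv B" "\<lambda>z. 1 / (1 - (cmod (B z))\<^sup>2)" "\<lambda>_. 1" z])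
        (use sk_metric_selfmap[OF B] z in auto)
    then have "cmod (\<psi> n z) * (1 - (cmod (F n z))\<^sup>2) \<le> 1 - (cmod (B z))\<^sup>2"
      using Bz by (simp add: field_simps)
    also have "\<dots> \<le> 1" by simp
    finally have 1: "cmod (\<psi> n z) * (1 - (cmod (F n z))\<^sup>2) \<le> 1" .
    have "(cmod (F n z))\<^sup>2 \<le> (cmod z)\<^sup>2" using Fz z by (intro power_mono) auto
    then have "cmod (\<psi> n z) * (1 - (cmod z)\<^sup>2) \<le> cmod (\<psi> n z) * (1 - (cmod (F n z))\<^sup>2)"
      by (intro mult_left_mono) auto
    with 1 have "cmod (\<psi> n z) * (1 - (cmod z)\<^sup>2) \<le> 1" by linarith
    then show ?thesis using one_minus_norm2_pos[of z] z by (simp add: field_simps)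
  qed
  have bd1: "\<exists>M. \<forall>h\<in>range \<psi>. \<forall>z\<in>K. cmod (h z) \<le> M" if K: "compact K" "K \<subseteq> \<D>" for K
  proof -
    have "continuous_on K (\<lambda>z. 1 / (1 - (cmod z)\<^sup>2))"
      using K(2) one_minus_norm2_pos by (intro continuous_intros) (force simp: less_imp_neq[THEN not_sym])
    then have "bounded ((\<lambda>z. 1 / (1 - (cmod z)\<^sup>2)) ` K)"
      using K(1) by (intro compact_imp_bounded compact_continuous_image) auto
    then obtain M where M: "\<And>z. z \<in> K \<Longrightarrow> \<bar>1 / (1 - (cmod z)\<^sup>2)\<bar> \<le> M"
      unfolding bounded_iff by auto
    have "cmod (\<psi> n z) \<le> M" if "z \<in> K" for n z
      using \<psi>bd[of z n] M[OF that] K(2) that by (meson abs_ge_self order_trans subsetD)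
    then show ?thesis by blast
  qed
  obtain \<psi>' r1 where \<psi>': "\<psi>' holomorphic_on \<D>" and r1: "strict_mono (r1 :: nat \<Rightarrow> nat)"
    and \<psi>lim: "\<And>z. z \<in> \<D> \<Longrightarrow> (\<lambda>n. \<psi> (r1 n) z) \<longlonglongrightarrow> \<psi>' z"
    and \<psi>unif: "\<And>K. compact K \<Longrightarrow> K \<subseteq> \<D> \<Longrightarrow> uniform_limit K (\<psi> \<circ> r1) \<psi>' sequentially"
  proof -
    show thesis
    proof (rule Montel[of \<D> "range \<psi>" \<psi>])
      show "h holomorphic_on \<D>" if "h \<in> range \<psi>" for h using \<psi>(1) that by auto
      show "\<exists>M. \<forall>h\<in>range \<psi>. \<forall>z\<in>K. cmod (h z) \<le> M" if "compact K" "K \<subseteq> \<D>" for K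
        by (rule bd1[OF that])
      fix g r
      assume "g holomorphic_on \<D>" "strict_mono (r :: nat \<Rightarrow> nat)"
        "\<And>x. x \<in> \<D> \<Longrightarrow> (\<lambda>n. \<psi> (r n) x) \<longlonglongrightarrow> g x"
        "\<And>K. compact K \<Longrightarrow> K \<subseteq> \<D> \<Longrightarrow> uniform_limit K (\<psi> \<circ> r) g sequentially"
      then show thesis by (rule that)
    qed auto
  qed
  obtain F' r2 where F': "F' holomorphic_on \<D>" and r2: "strict_mono (r2 :: nat \<Rightarrow> nat)"
    and Flim: "\<And>z. z \<in> \<D> \<Longrightarrow> (\<lambda>n. (F \<circ> r1) (r2 n) z) \<longlonglongrightarrow> F' z"
    and Funif: "\<And>K. compact K \<Longrightarrow> K \<subseteq> \<D> \<Longrightarrow> uniform_limit K ((F \<circ> r1) \<circ> r2) F' sequentially"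
  proof -
    show thesis
    proof (rule Montel[of \<D> "range (F \<circ> r1)" "F \<circ> r1"])
      show "h holomorphic_on \<D>" if "h \<in> range (F \<circ> r1)" for h
        using F(1) that by (auto simp: holomorphic_selfmap_def)
      show "\<exists>M. \<forall>h\<in>range (F \<circ> r1). \<forall>z\<in>K. cmod (h z) \<le> M" if K: "compact K" "K \<subseteq> \<D>" for K
      proof (intro exI[of _ 1] ballI)
        fix h z assume h: "h \<in> range (F \<circ> r1)" and z: "z \<in> K"
        then have "cmod z < 1" using K(2) by auto
        then show "cmod (h z) \<le> 1" using h selfmap_in_disc[OF F(1)] by (auto intro: less_imp_le)
      qed
      fix g r
      assume "g holomorphic_on \<D>" "strict_mono (r :: nat \<Rightarrow> nat)"
        "\<And>x. x \<in> \<D> \<Longrightarrow> (\<lambda>n. (F \<circ> r1) (r n) x) \<longlonglongrightarrow> g x"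
        "\<And>K. compact K \<Longrightarrow> K \<subseteq> \<D> \<Longrightarrow> uniform_limit K ((F \<circ> r1) \<circ> r) g sequentially"
      then show thesis by (rule that)
    qed auto
  qed
  define s where "s = r1 \<circ> r2"
  have s: "strict_mono s" unfolding s_def using r1 r2 by (rule strict_mono_o)
  have \<psi>s: "(\<lambda>n. \<psi> (s n) z) \<longlonglongrightarrow> \<psi>' z" if "z \<in> \<D>" for z
    using LIMSEQ_subseq_LIMSEQ[OF \<psi>lim[OF that] r2] by (simp add: s_def o_def)
  have Fs: "(\<lambda>n. F (s n) z) \<longlonglongrightarrow> F' z" if "z \<in> \<D>" for z
    using Flim[OF that] by (simp add: s_def o_def)
  have F'z: "cmod (F' z) \<le> cmod z" if "z \<in> \<D>" for z
    using Lim_norm_ubound[OF _ Fs[OF that]] Fz that by auto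
  have F'self: "holomorphic_selfmap F'"
    using F' F'z by (force simp: holomorphic_selfmap_def)
  have dFs: "(\<lambda>n. deriv (F (s n)) z) \<longlonglongrightarrow> deriv F' z" if z: "z \<in> \<D>" for z
  proof (rule deriv_complex_uniform_limit)
    define d where "d = (1 - cmod z) / 2"
    have d: "d > 0" using z by (simp add: d_def)
    have sub: "cball z d \<subseteq> \<D>"
    proof
      fix w assume "w \<in> cball z d"
      then have "cmod (w - z) \<le> d" by (simp add: dist_norm norm_minus_commute)
      then have "cmod w \<le> cmod z + d" using norm_triangle_sub[of w z] by simp
      moreover have "2 * d = 1 - cmod z" by (simp add: d_def)
      ultimately have "cmod w < 1" using d by linarith
      then show "w \<in> \<D>" by simp
    qed
    show "uniform_limit (ball z d) (\<lambda>n. F (s n)) F' sequentially"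
      using uniform_limit_on_subset[OF Funif[OF compact_cball sub] ball_subset_cball]
      by (simp add: s_def o_def)
    show "\<forall>\<^sub>F n in sequentially. F (s n) holomorphic_on ball z d"
    proof (intro always_eventually allI)
      fix n
      have "F (s n) holomorphic_on \<D>" using F(1) unfolding holomorphic_selfmap_def by blast
      then show "F (s n) holomorphic_on ball z d"
        using sub ball_subset_cball by (rule holomorphic_on_subset[OF _ order_trans[rotated]])
    qed
    show "z \<in> ball z d" using d by simp
  qed auto
  have BF': "deriv B z = \<psi>' z * deriv F' z" if z: "z \<in> \<D>" for z
  proof -
    have "(\<lambda>n. \<psi> (s n) z * deriv (F (s n)) z) \<longlonglongrightarrow> \<psi>' z * deriv F' z"
      by (intro tendsto_mult \<psi>s dFs z)
    then have "(\<lambda>n. deriv B z) \<longlonglongrightarrow> \<psi>' z * deriv F' z"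
      using BF[OF z] by simp
    then show ?thesis by (simp add: LIMSEQ_const_iff)
  qed
  have \<psi>'0: "\<psi>' z \<noteq> 0" if z: "z \<in> \<D>" for z
  proof -
    define t where "t = (1 + max (cmod z) (cmod z0)) / 2"
    have t: "cmod z < t" "cmod z0 < t" "t < 1" using z z0 by (auto simp: t_def)
    \<comment> \<open>This excludes a vanishing limit, which Hurwitz' theorem would allow. The shift
      by N below starts the subsequence where the zero-free discs already contain
      \<open>ball 0 t\<close>.\<close>
    have nz0: "\<psi>' z0 \<noteq> 0" using BF'[OF z0(1)] z0(2) by auto
    show ?thesis
    proof (cases "\<psi>' constant_on ball 0 t")
      case True
      then have "\<psi>' z = \<psi>' z0" using t unfolding constant_on_def by fastforce
      then show ?thesis using nz0 by simp
    next
      case False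
      have sub: "ball 0 t \<subseteq> \<D>" using t by auto
      obtain N :: nat where N: "1 / (1 - t) < real N" using reals_Archimedean2 by blast
      have Nt: "t \<le> \<rho> (r1 (n + N))" for n
      proof -
        have "real N \<le> real (r1 (n + N)) + 2"
          using seq_suble[OF r1, of "n + N"] by linarith
        then have "1 / (1 - t) \<le> real (r1 (n + N)) + 2" using N by linarith
        then show ?thesis using t by (simp add: \<rho>_def field_simps)
      qed
      show ?thesis
      proof (rule Hurwitz_no_zeros[of "ball 0 t" "\<lambda>n. \<psi> (r1 (n + N))" \<psi>'])
        show "uniform_limit K (\<lambda>n. \<psi> (r1 (n + N))) \<psi>' sequentially" if "compact K" "K \<subseteq> ball 0 t" for K
        proof -
          have "uniform_limit K (\<psi> \<circ> r1) \<psi>' sequentially" using that sub by (intro \<psi>unif) auto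
          then show ?thesis
            unfolding uniform_limit_iff o_def by (auto intro: sequentially_offset)
        qed
        show "\<psi> (r1 (n + N)) w \<noteq> 0" if "w \<in> ball 0 t" for n w
          using \<psi>(2)[of w "r1 (n + N)"] Nt[of n] that by simp
      qed (use False t \<psi>(1) \<psi>' sub in \<open>auto intro: holomorphic_on_subset\<close>)
    qed
  qed
  have dom': "cmod (h z * \<psi>' z) * U z * (1 - (cmod (F' z))\<^sup>2) \<le> 1"
    if h: "sk_metric \<phi> U" "h holomorphic_on \<D>" "\<forall>z\<in>\<D>. \<phi> z = h z * deriv B z" and z: "z \<in> \<D>" for \<phi> U h z
  proof (rule LIMSEQ_le_const2)
    show "(\<lambda>n. cmod (h z * \<psi> (s n) z) * U z * (1 - (cmod (F (s n) z))\<^sup>2)) \<longlonglongrightarrow>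
       cmod (h z * \<psi>' z) * U z * (1 - (cmod (F' z))\<^sup>2)"
      by (intro tendsto_intros \<psi>s Fs z)
    show "\<exists>N. \<forall>n\<ge>N. cmod (h z * \<psi> (s n) z) * U z * (1 - (cmod (F (s n) z))\<^sup>2) \<le> 1"
    proof (intro exI allI impI)
      fix n
      show "cmod (h z * \<psi> (s n) z) * U z * (1 - (cmod (F (s n) z))\<^sup>2) \<le> 1"
        by (rule dom[of "s n", unfolded dom_def, rule_format, of \<phi> U h z]) (use h z in auto)
    qed
  qed
  show ?thesis
  proof (rule exI[of _ F'], rule exI[of _ \<psi>'], intro conjI allI impI ballI)
    fix \<phi> U h z
    assume "sk_metric \<phi> U \<and> h holomorphic_on \<D> \<and> (\<forall>z\<in>\<D>. \<phi> z = h z * deriv B z)" "z \<in> \<D>"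
    then show "cmod (h z * \<psi>' z) * U z * (1 - (cmod (F' z))\<^sup>2) \<le> 1"
      by (elim conjE) (rule dom')
  qed (rule F'self \<psi>' | erule BF' | erule \<psi>'0)+
qed

section \<open>Multiplicities of critical points, and domination by a maximal Blaschke
  product\<close>

lemma zorder_mult_nonvanishing:
  assumes S: "open S" "z \<in> S" and f: "f holomorphic_on S" and g: "g holomorphic_on S" "g z \<noteq> 0"
    and nc: "connected S" "w \<in> S" "f w \<noteq> 0" and eq: "\<And>w. w \<in> S \<Longrightarrow> k w = g w * f w"
  shows "zorder k z = zorder f z"
proof -
  have nz: "\<exists>w\<in>S. f w \<noteq> 0" using nc by blast
  obtain r where r: "if f z = 0 then zorder f z > 0 else zorder f z = 0" "0 < r" "cball z r \<subseteq> S"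
     "zor_poly f z holomorphic_on cball z r"
     "\<forall>w\<in>cball z r. f w = zor_poly f z w * (w - z) ^ nat (zorder f z) \<and> zor_poly f z w \<noteq> 0"
    using zorder_exist_zero[OF f S(1) nc(1) S(2) nz] by blast
  define h where "h = zor_poly f z"
  have h: "0 < r" "cball z r \<subseteq> S" "h holomorphic_on cball z r"
     "\<And>w. w \<in> cball z r \<Longrightarrow> f w = h w * (w - z) ^ nat (zorder f z) \<and> h w \<noteq> 0" "0 \<le> zorder f z"
    using r by (auto simp: h_def split: if_splits)
  have pw: "(w - z) powi zorder f z = (w - z) ^ nat (zorder f z)" for w
    using h(5) by (simp add: power_int_def)
  have sub: "ball z r \<subseteq> S" "ball z r \<subseteq> cball z r" using h(2) by auto
  have hh: "h holomorphic_on ball z r" "g holomorphic_on ball z r"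
    using h(3) g(1) sub by (auto intro: holomorphic_on_subset)
  show ?thesis
  proof (rule zorder_eqI[of "ball z r" _ "\<lambda>w. g w * h w"])
    show "(\<lambda>w. g w * h w) holomorphic_on ball z r" by (intro holomorphic_intros hh)
    show "g z * h z \<noteq> 0" using g(2) h(4)[of z] h(1) by simp
    show "k w = g w * h w * (w - z) powi zorder f z" if "w \<in> ball z r" "w \<noteq> z" for w
      using eq[of w] h(4)[of w] that sub unfolding pw by auto
  qed (use h(1) in auto)
qed

lemma nonconstant_deriv_nonzero:
  assumes "f holomorphic_on \<D>" "\<not> f constant_on \<D>"
  obtains z where "z \<in> \<D>" "deriv f z \<noteq> 0"
proof (rule ccontr)
  assume "\<not> thesis"
  then have "deriv f z = 0" if "z \<in> \<D>" for z using that \<open>\<And>z. z \<in> \<D> \<Longrightarrow> deriv f z \<noteq> 0 \<Longrightarrow> thesis\<close> by blast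
  then have "(f has_field_derivative 0) (at z)" if "z \<in> \<D>" for z
    using holomorphic_derivI[OF assms(1) open_ball that] that by simp
  then have "\<exists>c. \<forall>z\<in>\<D>. f z = c"
    using has_field_derivative_zero_constant[of \<D> f]
    by (metis convex_ball has_field_derivative_at_within)
  then show False using assms(2) by (auto simp: constant_on_def)
qed

lemma constant_on_disc_deriv:
  assumes "f constant_on \<D>" "z \<in> \<D>"
  shows "deriv f z = 0"
proof -
  obtain c where c: "\<And>w. w \<in> \<D> \<Longrightarrow> f w = c" using assms(1) by (auto simp: constant_on_def)
  have "deriv f z = deriv (\<lambda>_. c) z"
    using eventually_nhds_in_open[OF open_ball assms(2)] c
    by (intro deriv_cong_ev) (auto elim: eventually_mono)
  then show ?thesis by simp
qed

text \<open>The dominating map F has exactly the critical points of B, so maximality makes the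
  metric of F at most that of B, while F dominates the given pseudometric by construction.\<close>

lemma maximal_dominates:
  assumes max: "maximal_blaschke_product B" and B: "holomorphic_selfmap B"
    and sk: "sk_metric \<phi> U" and h: "h holomorphic_on \<D>" "\<And>z. z \<in> \<D> \<Longrightarrow> \<phi> z = h z * deriv B z"
    and z: "z \<in> \<D>"
  shows "cmod (h z) * U z * (1 - (cmod (B z))\<^sup>2) \<le> 1"
proof -
  have Bh: "B holomorphic_on \<D>" using B by (simp add: holomorphic_selfmap_def)
  have nc: "\<not> B constant_on \<D>" using max by (simp add: maximal_blaschke_product_def)
  obtain z0 where z0: "z0 \<in> \<D>" "deriv B z0 \<noteq> 0" using nonconstant_deriv_nonzero[OF Bh nc] by blast
  obtain F \<psi> where F: "holomorphic_selfmap F" and \<psi>: "\<psi> holomorphic_on \<D>"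
    and BF: "\<And>z. z \<in> \<D> \<Longrightarrow> deriv B z = \<psi> z * deriv F z \<and> \<psi> z \<noteq> 0"
    and dom: "\<And>z. z \<in> \<D> \<Longrightarrow> cmod (h z * \<psi> z) * U z * (1 - (cmod (F z))\<^sup>2) \<le> 1"
    using dominating_selfmap[OF B z0] sk h by blast
  have Fh: "F holomorphic_on \<D>" using F by (simp add: holomorphic_selfmap_def)
  have dF0: "deriv F z0 \<noteq> 0" using BF[OF z0(1)] z0(2) by auto
  have "\<not> F constant_on \<D>" using constant_on_disc_deriv[OF _ z0(1)] dF0 by blast
  moreover have "same_critical_points F B"
    unfolding same_critical_points_def
  proof
    fix w assume w: "w \<in> \<D>"
    have "zorder (deriv B) w = zorder (deriv F) w"
      by (rule zorder_mult_nonvanishing[where S = \<D> and g = \<psi> and w = z0])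
        (use w BF \<psi> dF0 z0 Fh in \<open>auto intro: holomorphic_deriv\<close>)
    then show "zorder (deriv F) w = zorder (deriv B) w" by simp
  qed
  ultimately have le: "hyp_deriv F w \<le> hyp_deriv B w" if "w \<in> \<D>" for w
    using max F that unfolding maximal_blaschke_product_def by blast
  have Bp: "1 - (cmod (B w))\<^sup>2 > 0" if "w \<in> \<D>" for w
    using one_minus_norm2_pos[OF selfmap_in_disc[OF B]] that by simp
  have Fp: "1 - (cmod (F w))\<^sup>2 > 0" if "w \<in> \<D>" for w
    using one_minus_norm2_pos[OF selfmap_in_disc[OF F]] that by simp
  have key: "1 - (cmod (B w))\<^sup>2 \<le> cmod (\<psi> w) * (1 - (cmod (F w))\<^sup>2)" if w: "w \<in> \<D>" "deriv F w \<noteq> 0" for w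
  proof -
    have w1: "1 - (cmod w)\<^sup>2 > 0" using one_minus_norm2_pos w by simp
    have "cmod (deriv F w) / (1 - (cmod (F w))\<^sup>2) \<le> cmod (deriv B w) / (1 - (cmod (B w))\<^sup>2)"
      using le[OF w(1)] w1 unfolding hyp_deriv_def by (simp only: mult_le_cancel_left_pos)
    also have "cmod (deriv B w) = cmod (\<psi> w) * cmod (deriv F w)" using BF[OF w(1)] by (simp add: norm_mult)
    finally have "cmod (deriv F w) * (1 - (cmod (B w))\<^sup>2) \<le> cmod (deriv F w) * (cmod (\<psi> w) * (1 - (cmod (F w))\<^sup>2))"
      using Bp[OF w(1)] Fp[OF w(1)] by (simp add: divide_simps mult_ac)
    then show ?thesis using w(2) by simp
  qed
  \<comment> \<open>Maximality compares metrics and is vacuous at critical points, where both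
    vanish. The inequality with F' cancelled extends there by continuity, since these points are
    isolated.\<close>
  have key': "1 - (cmod (B w))\<^sup>2 \<le> cmod (\<psi> w) * (1 - (cmod (F w))\<^sup>2)" if w: "w \<in> \<D>" for w
  proof -
    have "deriv F holomorphic_on \<D>" using Fh by (intro holomorphic_deriv) auto
    then have ev: "\<forall>\<^sub>F v in at w. deriv F v \<noteq> 0 \<and> v \<in> \<D>"
      using non_zero_neighbour_alt[of "deriv F" \<D> w z0] w z0 dF0 by auto
    have cont: "isCont B w" "isCont F w" "isCont \<psi> w"
      using Bh Fh \<psi> w by (auto intro: holomorphic_disc_isCont)
    show ?thesis
    proof (rule tendsto_le[of "at w"])
      show "((\<lambda>v. cmod (\<psi> v) * (1 - (cmod (F v))\<^sup>2)) \<longlongrightarrow> cmod (\<psi> w) * (1 - (cmod (F w))\<^sup>2)) (at w)"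
        using cont by (intro tendsto_intros) (auto simp: isCont_def)
      show "((\<lambda>v. 1 - (cmod (B v))\<^sup>2) \<longlongrightarrow> 1 - (cmod (B w))\<^sup>2) (at w)"
        using cont by (intro tendsto_intros) (auto simp: isCont_def)
      show "\<forall>\<^sub>F v in at w. 1 - (cmod (B v))\<^sup>2 \<le> cmod (\<psi> v) * (1 - (cmod (F v))\<^sup>2)"
        using ev by eventually_elim (use key in blast)
    qed auto
  qed
  have U: "U z > 0" using sk z unfolding sk_metric_def by blast
  have "cmod (h z) * U z * (1 - (cmod (B z))\<^sup>2) \<le> cmod (h z) * U z * (cmod (\<psi> z) * (1 - (cmod (F z))\<^sup>2))"
    using key'[OF z] U by (intro mult_left_mono) auto
  also have "\<dots> \<le> 1" using dom[OF z] by (simp add: norm_mult mult_ac)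
  finally show ?thesis .
qed

section \<open>Rigidity of local isometries\<close>

text \<open>The map preserves the hyperbolic length of the segment from 0 to w, and its image joins
  0 to \<tau> w. Projecting the image onto the direction of \<tau> w gives a real curve \<gamma>,
  and artanh is the distance from 0, so artanh \<gamma> grows no faster than artanh x. The Schwarz
  lemma does not apply yet: \<tau> is only known to map a smaller disc into the unit disc.\<close>

lemma local_isometry_contracts:
  assumes t: "\<tau> holomorphic_on ball 0 s" and s: "s \<le> 1" and t0: "\<tau> 0 = 0"
    and t1: "\<And>w. w \<in> ball 0 s \<Longrightarrow> cmod (\<tau> w) < 1"
    and iso: "\<And>w. w \<in> ball 0 s \<Longrightarrow> cmod (deriv \<tau> w) * (1 - (cmod w)\<^sup>2) = 1 - (cmod (\<tau> w))\<^sup>2"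
    and w: "w \<in> ball 0 s"
  shows "cmod (\<tau> w) \<le> cmod w"
proof (cases "w = 0 \<or> \<tau> w = 0")
  case True
  then show ?thesis using t0 by auto
next
  case False
  define e where "e = w / of_real (cmod w)"
  define u where "u = \<tau> w / of_real (cmod (\<tau> w))"
  have e: "cmod e = 1" "of_real (cmod w) * e = w" using False by (auto simp: e_def norm_divide)
  have u: "cmod u = 1" "cnj u * \<tau> w = of_real (cmod (\<tau> w))"
  proof -
    show "cmod u = 1" using False by (simp add: u_def norm_divide)
    have "\<tau> w * cnj (\<tau> w) = of_real (cmod (\<tau> w)) * of_real (cmod (\<tau> w))"
      using complex_norm_square[of "\<tau> w"] by (simp add: power2_eq_square)
    then show "cnj u * \<tau> w = of_real (cmod (\<tau> w))" using False by (simp add: u_def mult.commute)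
  qed
  define \<gamma> where "\<gamma> = (\<lambda>x::real. Re (cnj u * \<tau> (of_real x * e)))"
  define \<gamma>' where "\<gamma>' = (\<lambda>x::real. Re (cnj u * (deriv \<tau> (of_real x * e) * e)))"
  have mem: "of_real x * e \<in> ball 0 s" if "0 \<le> x" "x \<le> cmod w" for x :: real
    using that w e(1) by (simp add: norm_mult)
  have g1: "\<bar>\<gamma> x\<bar> \<le> cmod (\<tau> (of_real x * e))" for x
    unfolding \<gamma>_def using abs_Re_le_cmod[of "cnj u * \<tau> (of_real x * e)"] u(1) by (simp add: norm_mult)
  have g2: "\<bar>\<gamma> x\<bar> < 1" if "0 \<le> x" "x \<le> cmod w" for x
    using g1[of x] t1[OF mem[OF that]] by simp
  have dg: "(\<gamma> has_real_derivative \<gamma>' x) (at x)" if x: "0 \<le> x" "x \<le> cmod w" for x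
  proof -
    have "(\<tau> has_field_derivative deriv \<tau> (of_real x * e)) (at (of_real x * e))"
      using holomorphic_derivI[OF t open_ball mem[OF x]] .
    moreover have "((\<lambda>y. y * e) has_field_derivative e) (at (of_real x))"
      by (auto intro!: derivative_eq_intros)
    ultimately have "((\<lambda>y. cnj u * \<tau> (y * e)) has_field_derivative cnj u * (deriv \<tau> (of_real x * e) * e)) (at (of_real x))"
      by (intro DERIV_cmult DERIV_chain2[where f = \<tau>])
    then have "((\<lambda>y. cnj u * \<tau> (of_real y * e)) has_vector_derivative cnj u * (deriv \<tau> (of_real x * e) * e)) (at x)"
      by (rule has_vector_derivative_real_field)
    from bounded_linear.has_vector_derivative[OF bounded_linear_Re this]
    show ?thesis unfolding \<gamma>_def \<gamma>'_def has_real_derivative_iff_has_vector_derivative .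
  qed
  have le: "\<gamma>' x / (1 - (\<gamma> x)\<^sup>2) \<le> 1 / (1 - x\<^sup>2)" if x: "0 \<le> x" "x \<le> cmod w" for x
  proof -
    have nx: "cmod (of_real x * e) = x" using x e(1) by (simp add: norm_mult)
    have x1: "x < 1" using x w s by simp
    have p: "1 - x\<^sup>2 > 0" using x x1 by (simp add: power_less_one_iff)
    have q: "1 - (\<gamma> x)\<^sup>2 > 0" using g2[OF x] by (simp add: abs_square_less_1)
    have "\<gamma>' x \<le> cmod (deriv \<tau> (of_real x * e))"
      unfolding \<gamma>'_def using complex_Re_le_cmod[of "cnj u * (deriv \<tau> (of_real x * e) * e)"] u(1) e(1)
      by (simp add: norm_mult)
    also have "\<dots> = (1 - (cmod (\<tau> (of_real x * e)))\<^sup>2) / (1 - x\<^sup>2)"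
      using iso[OF mem[OF x]] p unfolding nx by (simp add: field_simps)
    also have "\<dots> \<le> (1 - (\<gamma> x)\<^sup>2) / (1 - x\<^sup>2)"
    proof -
      have "\<bar>\<gamma> x\<bar>\<^sup>2 \<le> (cmod (\<tau> (of_real x * e)))\<^sup>2" using g1 by (intro power_mono) auto
      then show ?thesis using p by (intro divide_right_mono) auto
    qed
    finally show ?thesis using p q by (simp add: field_simps)
  qed
  have "artanh (\<gamma> (cmod w)) - artanh (cmod w) \<le> artanh (\<gamma> 0) - artanh 0"
  proof (rule DERIV_nonpos_imp_nonincreasing[of 0 "cmod w" "\<lambda>x. artanh (\<gamma> x) - artanh x"])
    fix x assume x: "0 \<le> x" "x \<le> cmod w"
    have "((\<lambda>x. artanh (\<gamma> x) - artanh x) has_real_derivative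
        (1 / (1 - (\<gamma> x)\<^sup>2)) * \<gamma>' x - 1 / (1 - x\<^sup>2)) (at x)"
      using x w s by (intro DERIV_diff DERIV_chain2[OF artanh_real_has_field_derivative dg] artanh_real_has_field_derivative g2) auto
    moreover have "(1 / (1 - (\<gamma> x)\<^sup>2)) * \<gamma>' x - 1 / (1 - x\<^sup>2) \<le> 0" using le[OF x] by simp
    ultimately show "\<exists>y. ((\<lambda>x. artanh (\<gamma> x) - artanh x) has_real_derivative y) (at x) \<and> y \<le> 0" by blast
  qed simp
  moreover have "\<gamma> 0 = 0" by (simp add: \<gamma>_def t0)
  moreover have gw: "\<gamma> (cmod w) = cmod (\<tau> w)" unfolding \<gamma>_def e(2) u(2) by simp
  ultimately have at: "artanh (cmod (\<tau> w)) \<le> artanh (cmod w)" by simp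
  define A B where "A = cmod (\<tau> w)" and "B = cmod w"
  have AB: "0 \<le> A" "A < 1" "0 \<le> B" "B < 1" using t1[OF w] w s by (auto simp: A_def B_def)
  have "ln ((1 + A) / (1 - A)) \<le> ln ((1 + B) / (1 - B))" using at by (simp add: artanh_def A_def B_def)
  then have "(1 + A) / (1 - A) \<le> (1 + B) / (1 - B)" using AB by (subst (asm) ln_le_cancel_iff) auto
  then have "(1 + A) * (1 - B) \<le> (1 + B) * (1 - A)" using AB by (simp add: divide_simps mult.commute)
  then have "A \<le> B" by (simp add: algebra_simps)
  then show ?thesis by (simp add: A_def B_def)
qed

text \<open>The contraction estimate makes the rescaled map \<sigma> a selfmap of the unit disc. The
  isometry condition at 0 says |\<sigma>' 0| = 1, the equality case of the Schwarz lemma.\<close>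

lemma local_isometry_rotation:
  assumes t: "\<tau> holomorphic_on ball 0 s" and s: "0 < s" "s \<le> 1" and t0: "\<tau> 0 = 0"
    and t1: "\<And>w. w \<in> ball 0 s \<Longrightarrow> cmod (\<tau> w) < 1"
    and iso: "\<And>w. w \<in> ball 0 s \<Longrightarrow> cmod (deriv \<tau> w) * (1 - (cmod w)\<^sup>2) = 1 - (cmod (\<tau> w))\<^sup>2"
  shows "\<exists>\<alpha>. cmod \<alpha> = 1 \<and> (\<forall>w\<in>ball 0 s. \<tau> w = \<alpha> * w)"
proof -
  define \<sigma> where "\<sigma> = (\<lambda>w. \<tau> (of_real s * w) / of_real s)"
  have mem: "of_real s * w \<in> ball 0 s" if "cmod w < 1" for w :: complex
    using that s by (simp add: norm_mult)
  have "(\<tau> \<circ> (\<lambda>w. of_real s * w)) holomorphic_on \<D>"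
    using mem by (intro holomorphic_on_compose_gen[OF _ t] holomorphic_intros) auto
  then have hol: "\<sigma> holomorphic_on \<D>"
    unfolding \<sigma>_def o_def using s by (intro holomorphic_intros) auto
  have bd: "cmod (\<sigma> w) < 1" if w: "cmod w < 1" for w
  proof -
    have "cmod (\<tau> (of_real s * w)) \<le> cmod (of_real s * w)"
      by (rule local_isometry_contracts[OF t s(2) t0 t1 iso mem[OF w]])
    also have "\<dots> < s" using mem[OF w] by simp
    finally show ?thesis using s by (simp add: \<sigma>_def norm_divide)
  qed
  have 0: "(0::complex) \<in> ball 0 s" using s by simp
  have "(\<tau> has_field_derivative deriv \<tau> (of_real s * 0)) (at (of_real s * 0))"
    using holomorphic_derivI[OF t open_ball 0] by simp
  moreover have "((\<lambda>w. of_real s * w) has_field_derivative of_real s) (at 0)"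
    by (auto intro!: derivative_eq_intros)
  ultimately have "(\<sigma> has_field_derivative deriv \<tau> (of_real s * 0) * of_real s / of_real s) (at 0)"
    unfolding \<sigma>_def by (intro DERIV_cdivide DERIV_chain2[where f = \<tau>])
  then have "deriv \<sigma> 0 = deriv \<tau> 0" using s DERIV_imp_deriv by fastforce
  then have d1: "cmod (deriv \<sigma> 0) = 1" using iso[OF 0] t0 by simp
  have s0: "\<sigma> 0 = 0" using t0 by (simp add: \<sigma>_def)
  obtain \<alpha> where \<alpha>: "\<forall>z. cmod z < 1 \<longrightarrow> \<sigma> z = \<alpha> * z" "cmod \<alpha> = 1"
    using Schwarz_Lemma(3)[OF hol s0 bd, of 0] d1 by auto
  have "\<tau> w = \<alpha> * w" if "w \<in> ball 0 s" for w
  proof -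
    have "cmod (w / of_real s) < 1" using that s by (simp add: norm_divide)
    then have "\<sigma> (w / of_real s) = \<alpha> * (w / of_real s)" using \<alpha> by blast
    then show ?thesis using s by (simp add: \<sigma>_def)
  qed
  then show ?thesis using \<alpha>(2) by blast
qed

lemma moebius_rotation_automorphism:
  assumes a: "cmod a < 1" and b: "cmod b < 1" and \<alpha>: "cmod \<alpha> = 1"
  defines "T \<equiv> (\<lambda>w. disc_moebius (- a) (\<alpha> * disc_moebius b w))"
  shows "disc_automorphism T"
proof -
  have self: "(\<lambda>w. disc_moebius (- c) (\<beta> * disc_moebius d w)) holomorphic_on \<D>"
    "\<And>w. w \<in> \<D> \<Longrightarrow> disc_moebius (- c) (\<beta> * disc_moebius d w) \<in> \<D>"
    if c: "cmod c < 1" and d: "cmod d < 1" and \<beta>: "cmod \<beta> = 1" for c d \<beta>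
  proof -
    have "holomorphic_selfmap (\<lambda>w. \<beta> * disc_moebius d w)"
      unfolding holomorphic_selfmap_def
      using moebius_holomorphic[OF d] moebius_in_disc[OF d] \<beta>
      by (auto intro!: holomorphic_intros intro: holomorphic_on_subset simp: norm_mult)
    then have "holomorphic_selfmap (\<lambda>w. disc_moebius (- c) (\<beta> * disc_moebius d w))"
      using selfmap_moebius_compose[of _ "- c"] c by simp
    then show "(\<lambda>w. disc_moebius (- c) (\<beta> * disc_moebius d w)) holomorphic_on \<D>"
      "\<And>w. w \<in> \<D> \<Longrightarrow> disc_moebius (- c) (\<beta> * disc_moebius d w) \<in> \<D>"
      unfolding holomorphic_selfmap_def by blast+
  qed
  have inv: "disc_moebius (- d) (cnj \<beta> * disc_moebius c (disc_moebius (- c) (\<beta> * disc_moebius d w))) = w"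
    if c: "cmod c < 1" and d: "cmod d < 1" and \<beta>: "cmod \<beta> = 1" and w: "w \<in> \<D>" for c d \<beta> w
  proof -
    have bb: "cnj \<beta> * \<beta> = 1" using complex_norm_square[of \<beta>] \<beta> by (simp add: mult.commute)
    have m: "cmod (\<beta> * disc_moebius d w) < 1" using moebius_in_disc[OF d] w \<beta> by (simp add: norm_mult)
    have "disc_moebius c (disc_moebius (- c) (\<beta> * disc_moebius d w)) = \<beta> * disc_moebius d w"
      using moebius_inverse[of "- c" "\<beta> * disc_moebius d w"] c m by simp
    then have "cnj \<beta> * disc_moebius c (disc_moebius (- c) (\<beta> * disc_moebius d w)) = disc_moebius d w"
      using bb by (metis mult.assoc mult_1)
    then show ?thesis using moebius_inverse[OF d] w by simp
  qed
  \<comment> \<open>The inverse has the same form, with a and b exchanged and the rotation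
    conjugated.\<close>
  define T' where "T' = (\<lambda>w. disc_moebius (- b) (cnj \<alpha> * disc_moebius a w))"
  have \<alpha>': "cmod (cnj \<alpha>) = 1" using \<alpha> by simp
  have TT': "T' (T w) = w" if "w \<in> \<D>" for w
    unfolding T_def T'_def by (rule inv[OF a b \<alpha> that])
  have T'T: "T (T' w) = w" if "w \<in> \<D>" for w
    unfolding T_def T'_def using inv[OF b a \<alpha>' that] by simp
  have Tself: "T ` \<D> \<subseteq> \<D>" unfolding T_def using self(2)[OF a b \<alpha>] by blast
  have T'self: "T' ` \<D> \<subseteq> \<D>" unfolding T'_def using self(2)[OF b a \<alpha>'] by blast
  have bij: "bij_betw T \<D> \<D>"
    by (rule bij_betw_byWitness[where f' = T']) (use TT' T'T Tself T'self in auto)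
  have "inv_into \<D> T holomorphic_on \<D>"
  proof (rule holomorphic_transform)
    show "T' holomorphic_on \<D>" unfolding T'_def by (rule self(1)[OF b a \<alpha>'])
    show "T' w = inv_into \<D> T w" if "w \<in> \<D>" for w
      using bij T'T[OF that] T'self that by (metis bij_betw_def image_subset_iff inv_into_f_eq)
  qed
  then show ?thesis unfolding disc_automorphism_def using bij self(1)[OF a b \<alpha>] by (simp add: T_def)
qed

lemma moebius_norm_bound:
  assumes a: "cmod a < 1" and w: "cmod w < 1"
  shows "1 - (cmod (disc_moebius a w))\<^sup>2 \<le> 1 / (1 - cmod a)\<^sup>2 * (1 - (cmod w)\<^sup>2)"
proof -
  have n: "cmod (1 - cnj a * w) \<ge> 1 - cmod a"
  proof -
    have "cmod (cnj a * w) \<le> cmod a" using w by (simp add: norm_mult mult_left_le)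
    then show ?thesis using norm_triangle_ineq2[of 1 "cnj a * w"] by simp
  qed
  have "(1 - (cmod a)\<^sup>2) * (1 - (cmod w)\<^sup>2) / (cmod (1 - cnj a * w))\<^sup>2 \<le> 1 * (1 - (cmod w)\<^sup>2) / (1 - cmod a)\<^sup>2"
  proof (rule frac_le)
    show "(1 - cmod a)\<^sup>2 \<le> (cmod (1 - cnj a * w))\<^sup>2" using n a by (intro power_mono) auto
    show "(1 - (cmod a)\<^sup>2) * (1 - (cmod w)\<^sup>2) \<le> 1 * (1 - (cmod w)\<^sup>2)"
      using one_minus_norm2_pos[OF w] by (intro mult_right_mono) auto
  qed (use a one_minus_norm2_pos[OF w] in auto)
  then show ?thesis using moebius_norm[OF a, of w] w by simp
qed

text \<open>After moving f z1 and B z1 to 0, B is locally invertible and f composed with the local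
  inverse is an isometry fixing 0, hence a rotation; the identity theorem spreads this over \<D>.
  The constant C records that T distorts 1 - |w|^2 only by a bounded factor, which transfers
  estimates from f back to B.\<close>

lemma equal_hyperbolic_derivative:
  assumes f: "holomorphic_selfmap f" and B: "holomorphic_selfmap B" and z1: "z1 \<in> \<D>" "deriv B z1 \<noteq> 0"
    and eq: "\<And>z. z \<in> \<D> \<Longrightarrow> hyp_deriv f z = hyp_deriv B z"
  shows "\<exists>T C. disc_automorphism T \<and> 0 < C \<and>
    (\<forall>z\<in>\<D>. f z = T (B z) \<and> 1 - (cmod (f z))\<^sup>2 \<le> C * (1 - (cmod (B z))\<^sup>2))"
proof -
  define a b where "a = f z1" and "b = B z1"
  have a: "cmod a < 1" and b: "cmod b < 1"
    using selfmap_in_disc[OF f] selfmap_in_disc[OF B] z1 by (auto simp: a_def b_def)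
  define f1 B1 where "f1 = (\<lambda>z. disc_moebius a (f z))" and "B1 = (\<lambda>z. disc_moebius b (B z))"
  have f1: "holomorphic_selfmap f1" and B1: "holomorphic_selfmap B1"
    unfolding f1_def B1_def using f B a b by (auto intro: selfmap_moebius_compose)
  have f1h: "f1 holomorphic_on \<D>" and B1h: "B1 holomorphic_on \<D>"
    using f1 B1 by (auto simp: holomorphic_selfmap_def)
  have eq1: "hyp_deriv f1 z = hyp_deriv B1 z" if "z \<in> \<D>" for z
    unfolding f1_def B1_def using hyp_deriv_moebius_compose[OF f a that] hyp_deriv_moebius_compose[OF B b that] eq[OF that] by simp
  have dB1: "deriv B1 z1 \<noteq> 0"
    unfolding B1_def deriv_moebius_compose[OF B b z1(1)]
    using z1(2) deriv_moebius_nonzero[OF b] selfmap_in_disc[OF B] z1(1) by simp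
  obtain r where r: "r > 0" "ball z1 r \<subseteq> \<D>" "inj_on B1 (ball z1 r)"
    using has_complex_derivative_locally_injective[OF B1h z1(1) open_ball dB1] by blast
  have B1r: "B1 holomorphic_on ball z1 r" by (rule holomorphic_on_subset[OF B1h r(2)])
  obtain g where g: "g holomorphic_on (B1 ` ball z1 r)"
    "\<And>z. z \<in> ball z1 r \<Longrightarrow> deriv B1 z * deriv g (B1 z) = 1" "\<And>z. z \<in> ball z1 r \<Longrightarrow> g (B1 z) = z"
    using holomorphic_has_inverse[OF B1r open_ball r(3)] by blast
  have oV: "open (B1 ` ball z1 r)" by (rule open_mapping_thm3[OF B1r open_ball r(3)])
  have B10: "B1 z1 = 0" by (simp add: B1_def b_def disc_moebius_def)
  have f10: "f1 z1 = 0" by (simp add: f1_def a_def disc_moebius_def)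
  have "0 \<in> B1 ` ball z1 r" using B10 r(1) by (metis centre_in_ball imageI)
  then obtain s0 where s0: "s0 > 0" "ball 0 s0 \<subseteq> B1 ` ball z1 r" using oV open_contains_ball by blast
  define s where "s = min s0 1"
  have s: "0 < s" "s \<le> 1" "ball 0 s \<subseteq> B1 ` ball z1 r"
    using s0 by (auto simp: s_def)
  define \<tau> where "\<tau> = (\<lambda>w. f1 (g w))"
  have gmem: "g w \<in> ball z1 r" "B1 (g w) = w" if "w \<in> ball 0 s" for w
  proof -
    obtain z where z: "z \<in> ball z1 r" "w = B1 z" using s(3) \<open>w \<in> ball 0 s\<close> by blast
    show "g w \<in> ball z1 r" "B1 (g w) = w" using g(3)[OF z(1)] z by auto
  qed
  have gs: "g holomorphic_on ball 0 s" by (rule holomorphic_on_subset[OF g(1) s(3)])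
  have "(f1 \<circ> g) holomorphic_on ball 0 s"
    by (rule holomorphic_on_compose_gen[OF gs f1h]) (use gmem(1) r(2) in blast)
  then have \<tau>h: "\<tau> holomorphic_on ball 0 s" by (simp add: \<tau>_def o_def)
  have \<tau>0: "\<tau> 0 = 0"
    using g(3)[of z1] r(1) B10 f10 by (simp add: \<tau>_def)
  have gD: "g w \<in> \<D>" if "w \<in> ball 0 s" for w using gmem(1)[OF that] r(2) by blast
  have \<tau>1: "cmod (\<tau> w) < 1" if "w \<in> ball 0 s" for w
    unfolding \<tau>_def using selfmap_in_disc[OF f1] gD[OF that] by simp
  have iso: "cmod (deriv \<tau> w) * (1 - (cmod w)\<^sup>2) = 1 - (cmod (\<tau> w))\<^sup>2" if w: "w \<in> ball 0 s" for w
  proof -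
    define z where "z = g w"
    have z: "z \<in> ball z1 r" "B1 z = w" "z \<in> \<D>" using gmem[OF w] gD[OF w] by (auto simp: z_def)
    have dgw: "deriv B1 z * deriv g w = 1" using g(2)[OF z(1)] z(2) by simp
    have "(f1 has_field_derivative deriv f1 (g w)) (at (g w))"
      using holomorphic_derivI[OF f1h open_ball z(3)] by (simp add: z_def)
    moreover have "(g has_field_derivative deriv g w) (at w)"
      using holomorphic_derivI[OF gs open_ball w] .
    ultimately have "deriv \<tau> w = deriv f1 z * deriv g w"
      unfolding \<tau>_def z_def by (intro DERIV_imp_deriv DERIV_chain2[where f = f1])
    then have d: "cmod (deriv \<tau> w) * cmod (deriv B1 z) = cmod (deriv f1 z)"
      using dgw by (metis mult.assoc mult.commute mult.right_neutral norm_mult)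
    have p: "1 - (cmod (f1 z))\<^sup>2 > 0" "1 - (cmod (B1 z))\<^sup>2 > 0" "1 - (cmod z)\<^sup>2 > 0"
      using one_minus_norm2_pos selfmap_in_disc[OF f1] selfmap_in_disc[OF B1] z(3) by auto
    have "cmod (deriv f1 z) / (1 - (cmod (f1 z))\<^sup>2) = cmod (deriv B1 z) / (1 - (cmod (B1 z))\<^sup>2)"
      using eq1[OF z(3)] p(3) unfolding hyp_deriv_def by (simp only: mult_cancel_left) simp
    then have "cmod (deriv \<tau> w) * cmod (deriv B1 z) * (1 - (cmod (B1 z))\<^sup>2) = cmod (deriv B1 z) * (1 - (cmod (f1 z))\<^sup>2)"
      unfolding d using p by (simp add: divide_simps)
    moreover have "cmod (deriv B1 z) \<noteq> 0" using dgw by auto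
    ultimately show ?thesis using z(2) by (simp add: \<tau>_def z_def)
  qed
  obtain \<alpha> where \<alpha>: "cmod \<alpha> = 1" "\<forall>w\<in>ball 0 s. \<tau> w = \<alpha> * w"
    using local_isometry_rotation[OF \<tau>h s(1,2) \<tau>0 \<tau>1 iso] by blast
  define N where "N = g ` ball 0 s"
  have "inj_on g (ball 0 s)" by (rule inj_on_inverseI[of _ B1]) (rule gmem(2))
  then have oN: "open N" unfolding N_def by (rule open_mapping_thm3[OF gs open_ball])
  have N: "N \<noteq> {}" "N \<subseteq> \<D>" using s(1) gD by (auto simp: N_def)
  have fB1: "f1 z = \<alpha> * B1 z" if "z \<in> \<D>" for z
  proof (rule analytic_continuation_open[of N \<D> f1 "\<lambda>z. \<alpha> * B1 z"])
    show "f1 z = \<alpha> * B1 z" if z: "z \<in> N" for z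
    proof -
      obtain w where w: "w \<in> ball 0 s" "z = g w" using z by (auto simp: N_def)
      then show ?thesis using \<alpha>(2) gmem(2)[OF w(1)] by (simp add: \<tau>_def)
    qed
  qed (use oN N f1h B1h that in \<open>auto intro!: holomorphic_intros\<close>)
  define T where "T = (\<lambda>w. disc_moebius (- a) (\<alpha> * disc_moebius b w))"
  have T: "disc_automorphism T" unfolding T_def by (rule moebius_rotation_automorphism[OF a b \<alpha>(1)])
  have fT: "f z = T (B z)" if z: "z \<in> \<D>" for z
    using moebius_inverse[OF a selfmap_in_disc[OF f], of z] fB1[OF z] z
    unfolding T_def f1_def B1_def by simp
  \<comment> \<open>One distortion factor for each of the two Moebius maps in T.\<close>
  define C where "C = 1 / (1 - cmod a)\<^sup>2 * (1 / (1 - cmod b)\<^sup>2)"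
  have C: "C > 0" using a b by (simp add: C_def)
  have bd: "1 - (cmod (f z))\<^sup>2 \<le> C * (1 - (cmod (B z))\<^sup>2)" if z: "z \<in> \<D>" for z
  proof -
    have Bz: "cmod (B z) < 1" using selfmap_in_disc[OF B] z by simp
    have m: "cmod (\<alpha> * disc_moebius b (B z)) < 1" using moebius_in_disc[OF b Bz] \<alpha>(1) by (simp add: norm_mult)
    have "1 - (cmod (f z))\<^sup>2 \<le> 1 / (1 - cmod (- a))\<^sup>2 * (1 - (cmod (\<alpha> * disc_moebius b (B z)))\<^sup>2)"
      unfolding fT[OF z] T_def by (rule moebius_norm_bound[OF _ m]) (use a in simp)
    also have "\<dots> = 1 / (1 - cmod a)\<^sup>2 * (1 - (cmod (disc_moebius b (B z)))\<^sup>2)"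
      using \<alpha>(1) by (simp add: norm_mult)
    also have "\<dots> \<le> 1 / (1 - cmod a)\<^sup>2 * (1 / (1 - cmod b)\<^sup>2 * (1 - (cmod (B z))\<^sup>2))"
      by (intro mult_left_mono moebius_norm_bound[OF b Bz]) auto
    finally show ?thesis by (simp add: C_def)
  qed
  show ?thesis using T C fT bd by blast
qed

section \<open>Infinite Blaschke products and the Riesz factorization\<close>

lemma blaschke_factor_bound_on_cball:
  assumes a: "cmod a < 1" and r: "r < 1" and z: "z \<in> cball 0 r"
  shows "cmod (blaschke_factor a z - 1) \<le> 2 / (1 - r) * (1 - cmod a)"
proof -
  have z1: "cmod z \<le> r" "cmod z < 1" using z r by auto
  have "cmod (blaschke_factor a z - 1) \<le> 2 / (1 - cmod z) * (1 - cmod a)"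
    by (rule blaschke_factor_close_to_1[OF a z1(2)])
  also have "\<dots> \<le> 2 / (1 - r) * (1 - cmod a)"
    using z1 r a by (intro mult_right_mono divide_left_mono) auto
  finally show ?thesis .
qed

context
  fixes a :: "nat \<Rightarrow> complex"
  assumes a1: "\<And>n. cmod (a n) < 1" and summ: "summable (\<lambda>n. 1 - cmod (a n))"
begin

lemma blaschke_convergent:
  assumes z: "cmod z < 1"
  shows "convergent_prod (\<lambda>n. blaschke_factor (a n) z)"
proof -
  have "summable (\<lambda>n. cmod (blaschke_factor (a n) z - 1))"
    by (rule summable_comparison_test'[OF summable_mult[OF summ, of "2 / (1 - cmod z)"], of 0])
      (use blaschke_factor_close_to_1[OF a1 z] in simp)
  then show ?thesis
    using abs_convergent_prod_conv_summable abs_convergent_prod_imp_convergent_prod by blast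
qed

lemma finite_bprod_tendsto:
  assumes z: "cmod z < 1"
  shows "(\<lambda>N. finite_bprod a N z) \<longlonglongrightarrow> (\<Prod>n. blaschke_factor (a n) z)"
  using convergent_prod_LIMSEQ[OF blaschke_convergent[OF z]]
  unfolding finite_bprod_def by (subst LIMSEQ_lessThan_iff_atMost)

lemma infinite_bprod_holomorphic: "(\<lambda>z. \<Prod>n. blaschke_factor (a n) z) holomorphic_on \<D>"
proof (rule holomorphic_uniform_sequence[OF open_ball, of "finite_bprod a"])
  show "finite_bprod a N holomorphic_on \<D>" for N
    by (rule holomorphic_on_subset[OF finite_bprod_holomorphic[OF a1]]) auto
  fix x :: complex assume x: "x \<in> \<D>"
  define d where "d = (1 - cmod x) / 2"
  define r where "r = (1 + cmod x) / 2"
  have dr: "d > 0" "r < 1" "cmod x + d = r" using x by (auto simp: d_def r_def field_simps)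
  have sub: "cball x d \<subseteq> cball 0 r"
  proof
    fix w assume "w \<in> cball x d"
    then have "cmod (w - x) \<le> d" by (simp add: dist_norm norm_minus_commute)
    then have "cmod w \<le> cmod x + d" using norm_triangle_sub[of w x] by simp
    then show "w \<in> cball 0 r" using dr by simp
  qed
  have "uniformly_convergent_on (cball x d) (\<lambda>N z. \<Prod>n<N. blaschke_factor (a n) z)"
  proof (rule uniformly_convergent_on_prod')
    show "continuous_on (cball x d) (blaschke_factor (a n))" for n
      using sub dr by (intro continuous_on_subset[OF holomorphic_on_imp_continuous_on[OF blaschke_factor_holomorphic[OF a1]]])
        force
    show "uniformly_convergent_on (cball x d) (\<lambda>N x. \<Sum>n<N. norm (blaschke_factor (a n) x - 1))"
      by (rule Weierstrass_m_test'[OF _ summable_mult[OF summ, of "2 / (1 - r)"]])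
        (use blaschke_factor_bound_on_cball[OF a1 dr(2)] sub in auto)
  qed simp
  then obtain l where l: "uniform_limit (cball x d) (\<lambda>N z. \<Prod>n<N. blaschke_factor (a n) z) l sequentially"
    unfolding uniformly_convergent_on_def by blast
  have "l z = (\<Prod>n. blaschke_factor (a n) z)" if z: "z \<in> cball x d" for z
  proof -
    have "cmod z < 1" using z sub dr by auto
    from finite_bprod_tendsto[OF this] show ?thesis
      using tendsto_uniform_limitI[OF l z] unfolding finite_bprod_def by (intro LIMSEQ_unique)
  qed
  then have "uniform_limit (cball x d) (finite_bprod a) (\<lambda>z. \<Prod>n. blaschke_factor (a n) z) sequentially"
    using l uniform_limit_cong'[of "cball x d" "finite_bprod a" "\<lambda>N z. \<Prod>n<N. blaschke_factor (a n) z" "\<lambda>z. \<Prod>n. blaschke_factor (a n) z" l]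
    by (simp add: finite_bprod_def)
  then show "\<exists>d>0. cball x d \<subseteq> \<D> \<and> uniform_limit (cball x d) (finite_bprod a) (\<lambda>z. \<Prod>n. blaschke_factor (a n) z) sequentially"
    using dr sub by (intro exI[of _ d]) auto
qed

lemma infinite_bprod_le_1:
  assumes z: "cmod z < 1"
  shows "cmod (\<Prod>n. blaschke_factor (a n) z) \<le> 1"
  using Lim_norm_ubound[OF _ finite_bprod_tendsto[OF z], of 1] finite_bprod_le_1[OF a1 z] by auto

end

lemma finite_bprod_add: "finite_bprod a (N + M) z = finite_bprod a N z * finite_bprod (\<lambda>n. a (n + N)) M z"
  unfolding finite_bprod_def by (induction M) (auto simp: add.commute)

lemma infinite_bprod_split:
  assumes a1: "\<And>n. cmod (a n) < 1" and summ: "summable (\<lambda>n. 1 - cmod (a n))" and z: "cmod z < 1"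
  shows "(\<Prod>n. blaschke_factor (a n) z) = finite_bprod a N z * (\<Prod>n. blaschke_factor (a (n + N)) z)"
proof (rule LIMSEQ_unique)
  have summ': "summable (\<lambda>n. 1 - cmod (a (n + N)))" using summ by (rule summable_ignore_initial_segment)
  show "(\<lambda>M. finite_bprod a (M + N) z) \<longlonglongrightarrow> (\<Prod>n. blaschke_factor (a n) z)"
    by (rule LIMSEQ_ignore_initial_segment[OF finite_bprod_tendsto[OF a1 summ z]])
  have "(\<lambda>M. finite_bprod a N z * finite_bprod (\<lambda>n. a (n + N)) M z) \<longlonglongrightarrow>
      finite_bprod a N z * (\<Prod>n. blaschke_factor (a (n + N)) z)"
    by (intro tendsto_mult_left finite_bprod_tendsto[OF a1 summ' z])
  then show "(\<lambda>M. finite_bprod a (M + N) z) \<longlonglongrightarrow> finite_bprod a N z * (\<Prod>n. blaschke_factor (a (n + N)) z)"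
    by (simp add: finite_bprod_add[symmetric] add.commute)
qed

lemma blaschke_product_cases:
  assumes "blaschke_product B"
  obtains (finite) c a N where "cmod c = 1" "\<And>n. n < N \<Longrightarrow> cmod (a n) < 1" "\<And>z. cmod z < 1 \<Longrightarrow> B z = c * finite_bprod a N z"
  | (infinite) c a where "cmod c = 1" "\<And>n. cmod (a n) < 1" "summable (\<lambda>n. 1 - cmod (a n))"
      "\<And>z. cmod z < 1 \<Longrightarrow> B z = c * (\<Prod>n. blaschke_factor (a n) z)"
  using assms unfolding blaschke_product_def
proof (elim disjE)
  assume "finite_blaschke_product B"
  then obtain c and a :: "nat \<Rightarrow> complex" and N where "cmod c = 1" "\<forall>n<N. a n \<in> \<D>"
      "\<forall>z\<in>\<D>. B z = c * (\<Prod>n<N. blaschke_factor (a n) z)"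
    unfolding finite_blaschke_product_def by blast
  then show thesis by (intro finite[of c N a]) (simp_all add: finite_bprod_def)
next
  assume "infinite_blaschke_product B"
  then obtain c a where "cmod c = 1" "\<forall>n. a n \<in> \<D>" "summable (\<lambda>n. 1 - cmod (a n))"
      "\<forall>z\<in>\<D>. B z = c * (\<Prod>n. blaschke_factor (a n) z)"
    unfolding infinite_blaschke_product_def by blast
  then show thesis by (intro infinite[of c a]) simp_all
qed

lemma blaschke_product_bounds:
  assumes B: "blaschke_product B"
  shows "B holomorphic_on \<D>" "\<And>z. cmod z < 1 \<Longrightarrow> cmod (B z) \<le> 1"
proof -
  have "B holomorphic_on \<D> \<and> (\<forall>z. cmod z < 1 \<longrightarrow> cmod (B z) \<le> 1)"
    using B
  proof (cases rule: blaschke_product_cases)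
    case (finite c a N)
    have "(\<lambda>z. c * finite_bprod a N z) holomorphic_on \<D>"
      by (intro holomorphic_intros holomorphic_on_subset[OF finite_bprod_holomorphic[OF finite(2)]]) auto
    then have "B holomorphic_on \<D>" by (rule holomorphic_transform) (simp add: finite(3))
    then show ?thesis using finite finite_bprod_le_1[of N a] by (simp add: norm_mult)
  next
    case (infinite c a)
    have "(\<lambda>z. c * (\<Prod>n. blaschke_factor (a n) z)) holomorphic_on \<D>"
      by (intro holomorphic_intros infinite_bprod_holomorphic infinite(2,3))
    then have "B holomorphic_on \<D>" by (rule holomorphic_transform) (simp add: infinite(4))
    then show ?thesis using infinite infinite_bprod_le_1[of a] by (simp add: norm_mult)
  qed
  then show "B holomorphic_on \<D>" "\<And>z. cmod z < 1 \<Longrightarrow> cmod (B z) \<le> 1" by auto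
qed

lemma bounded_nonconstant_selfmap:
  assumes B: "B holomorphic_on \<D>" "\<And>z. cmod z < 1 \<Longrightarrow> cmod (B z) \<le> 1" and nc: "\<not> B constant_on \<D>"
  shows "holomorphic_selfmap B"
proof -
  have "cmod (B z) < 1" if z: "z \<in> \<D>" for z
  proof (rule ccontr)
    assume "\<not> cmod (B z) < 1"
    then have "cmod (B w) \<le> cmod (B z)" if "w \<in> \<D>" for w using B(2)[of w] that by simp
    then have "B constant_on \<D>"
      using maximum_modulus_principle[OF B(1) open_ball connected_ball open_ball order_refl z] by blast
    then show False using nc by simp
  qed
  then show ?thesis using B(1) by (auto simp: holomorphic_selfmap_def)
qed

text \<open>The tails of a Blaschke product tend to 1, so \<open>- ln |B|\<close> has no positive harmonic minorant.\<close>

lemma blaschke_product_no_minorant: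
  assumes B: "blaschke_product B" and E: "E holomorphic_on \<D>"
    and bd: "\<And>z. cmod z < 1 \<Longrightarrow> cmod (B z * E z) \<le> 1" and z: "cmod z < 1" "B z \<noteq> 0"
  shows "cmod (E z) \<le> 1"
  using B
proof (cases rule: blaschke_product_cases)
  case (finite c a N)
  show ?thesis
  proof (rule max_modulus_quotient[OF E finite(2) _ z(1)])
    show "cmod (finite_bprod a N w * E w) \<le> 1" if "cmod w < 1" for w
      using bd[OF that] finite(1) finite(3)[OF that] by (simp add: norm_mult)
  qed
next
  case (infinite c a)
  note a1 = infinite(2) and summ = infinite(3)
  define R where "R = (\<lambda>N z. \<Prod>n. blaschke_factor (a (n + N)) z)"
  have summ': "summable (\<lambda>n. 1 - cmod (a (n + N)))" for N using summ by (rule summable_ignore_initial_segment)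
  have R: "R N holomorphic_on \<D>" for N
    unfolding R_def by (rule infinite_bprod_holomorphic[OF a1 summ'])
  have le: "cmod (R N z * E z) \<le> 1" for N
  proof (rule max_modulus_quotient[OF _ a1 _ z(1)])
    show "(\<lambda>z. R N z * E z) holomorphic_on \<D>" by (intro holomorphic_intros R E)
    show "cmod (finite_bprod a N w * (R N w * E w)) \<le> 1" if "cmod w < 1" for w
      using bd[OF that] infinite(1) infinite(4)[OF that] infinite_bprod_split[OF a1 summ that, of N]
      by (simp add: norm_mult R_def mult.assoc)
  qed
  define L where "L = (\<Prod>n. blaschke_factor (a n) z)"
  have L: "L \<noteq> 0" using z(2) infinite(4)[OF z(1)] by (auto simp: L_def)
  have fb: "finite_bprod a N z * R N z = L" for N
    using infinite_bprod_split[OF a1 summ z(1), of N] by (simp add: R_def L_def)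
  then have "R N z = L / finite_bprod a N z" for N
    using L by (metis mult_zero_left nonzero_mult_div_cancel_left)
  moreover have "(\<lambda>N. L / finite_bprod a N z) \<longlonglongrightarrow> L / L"
    using finite_bprod_tendsto[OF a1 summ z(1)] L unfolding L_def by (intro tendsto_divide tendsto_const) auto
  ultimately have "(\<lambda>N. R N z) \<longlonglongrightarrow> 1" using L by simp
  then have "(\<lambda>N. cmod (R N z * E z)) \<longlonglongrightarrow> cmod (1 * E z)" by (intro tendsto_intros)
  then show ?thesis using le LIMSEQ_le_const2 by fastforce
qed

text \<open>Taking S as the limit of the remainders S n avoids dividing f by b at zeros. On |z| < r
  choose M such that all zeros from the M-th on have modulus above r: there the limit is S M divided
  by the tail product R M, both zero-free, which gives holomorphy and zero-freeness at once.\<close>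

lemma riesz_factorization:
  assumes f: "f holomorphic_on \<D>" "\<And>z. cmod z < 1 \<Longrightarrow> cmod (f z) \<le> 1" and nz: "cmod z0 < 1" "f z0 \<noteq> 0"
  shows "\<exists>b S. blaschke_product b \<and> S holomorphic_on \<D> \<and>
     (\<forall>z. cmod z < 1 \<longrightarrow> cmod (b z) \<le> 1 \<and> cmod (S z) \<le> 1 \<and> S z \<noteq> 0 \<and> f z = b z * S z)"
proof -
  have f2: "\<forall>z. cmod z < 1 \<longrightarrow> cmod (f z) \<le> 1" using f(2) by blast
  show ?thesis using successive_zeros[OF f(1) f2 nz]
  proof (elim disjE exE)
    fix N a S
    assume *: "(\<forall>i. cmod (a i) < 1) \<and> S holomorphic_on \<D> \<and>
      (\<forall>z. cmod z < 1 \<longrightarrow> cmod (S z) \<le> 1 \<and> S z \<noteq> 0 \<and> f z = finite_bprod a N z * S z)"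
    have "blaschke_product (finite_bprod a N)"
      unfolding blaschke_product_def finite_blaschke_product_def
      using * by (intro disjI1 exI[of _ 1] exI[of _ a] exI[of _ N]) (auto simp: finite_bprod_def)
    moreover have "cmod (finite_bprod a N z) \<le> 1" if "cmod z < 1" for z
      using finite_bprod_le_1[of N a z] * that by blast
    ultimately show ?thesis using * by (intro exI[of _ "finite_bprod a N"] exI[of _ S]) auto
  next
    fix a S
    assume *: "\<forall>N. cmod (a N) < 1 \<and> S N holomorphic_on \<D> \<and> S N (a N) = 0 \<and>
      (\<forall>z. cmod z < 1 \<longrightarrow> cmod (S N z) \<le> 1 \<and> (S N z = 0 \<longrightarrow> cmod (a N) \<le> cmod z) \<and>
         f z = finite_bprod a N z * S N z \<and> S N z = blaschke_factor (a N) z * S (Suc N) z)"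
    have a1: "cmod (a n) < 1" for n using * by blast
    have Sh: "S n holomorphic_on \<D>" for n using * by blast
    have Sz: "cmod (S n z) \<le> 1" "f z = finite_bprod a n z * S n z" "S n z = blaschke_factor (a n) z * S (Suc n) z"
      if "cmod z < 1" for n z using * that by blast+
    have "cmod (f z0) \<le> cmod (finite_bprod a N z0)" for N
      using Sz(1,2)[OF nz(1), of N] by (simp add: norm_mult mult_left_le)
    then have summ: "summable (\<lambda>n. 1 - cmod (a n))"
      using blaschke_condition[of a z0 "cmod (f z0)"] a1 nz by simp
    have "(\<lambda>n. 1 - cmod (a n)) \<longlonglongrightarrow> 0" using summ by (rule summable_LIMSEQ_zero)
    have summ': "summable (\<lambda>n. 1 - cmod (a (n + N)))" for N using summ by (rule summable_ignore_initial_segment)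
    define R where "R = (\<lambda>N z. \<Prod>n. blaschke_factor (a (n + N)) z)"
    have Rh: "R N holomorphic_on \<D>" for N
      unfolding R_def by (rule infinite_bprod_holomorphic[OF a1 summ'])
    define T where "T = (\<lambda>z. lim (\<lambda>n. S n z))"
    have key: "\<exists>M. \<forall>z. cmod z < r \<longrightarrow> R M z \<noteq> 0 \<and> S M z \<noteq> 0 \<and> (\<lambda>n. S n z) \<longlonglongrightarrow> S M z / R M z"
      if r: "r < 1" for r
    proof -
      have "\<forall>\<^sub>F n in sequentially. 1 - cmod (a n) < 1 - r"
        using \<open>(\<lambda>n. 1 - cmod (a n)) \<longlonglongrightarrow> 0\<close> r by (intro order_tendstoD) auto
      then obtain M where M: "\<And>n. n \<ge> M \<Longrightarrow> r < cmod (a n)"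
        by (auto simp: eventually_sequentially)
      have "R M z \<noteq> 0 \<and> S M z \<noteq> 0 \<and> (\<lambda>n. S n z) \<longlonglongrightarrow> S M z / R M z" if z: "cmod z < r" for z
      proof -
        have z1: "cmod z < 1" using z r by simp
        have bf0: "blaschke_factor (a (n + M)) z \<noteq> 0" for n
          using blaschke_factor_eq_0_iff[OF a1, of z "n + M"] z1 M[of "n + M"] z by auto
        have R0: "R M z \<noteq> 0"
          unfolding R_def by (rule prodinf_nonzero[OF blaschke_convergent[OF a1 summ' z1] bf0])
        have S0: "S M z \<noteq> 0" using * M[of M] z z1 by (meson less_le_not_le order.strict_trans order_refl)
        have fb0: "finite_bprod (\<lambda>n. a (n + M)) n z \<noteq> 0" for n
          unfolding finite_bprod_def using bf0 by auto
        have "S M z = finite_bprod (\<lambda>n. a (n + M)) n z * S (n + M) z" for n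
        proof (induction n)
          case (Suc n)
          then show ?case using Sz(3)[OF z1, of "n + M"] by (simp add: finite_bprod_def mult.assoc)
        qed (simp add: finite_bprod_def)
        then have Sn: "S (n + M) z = S M z / finite_bprod (\<lambda>n. a (n + M)) n z" for n
          using fb0[of n] by (metis nonzero_mult_div_cancel_left)
        have "(\<lambda>n. S M z / finite_bprod (\<lambda>n. a (n + M)) n z) \<longlonglongrightarrow> S M z / R M z"
          using finite_bprod_tendsto[OF a1 summ' z1, of M] R0 unfolding R_def by (intro tendsto_divide tendsto_const) auto
        then have "(\<lambda>n. S (n + M) z) \<longlonglongrightarrow> S M z / R M z" unfolding Sn .
        then have "(\<lambda>n. S n z) \<longlonglongrightarrow> S M z / R M z" by (rule LIMSEQ_offset)
        then show ?thesis using R0 S0 by blast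
      qed
      then show ?thesis by blast
    qed
    have Tlim: "(\<lambda>n. S n z) \<longlonglongrightarrow> T z" "T z \<noteq> 0" if z: "cmod z < 1" for z
    proof -
      obtain r where r: "cmod z < r" "r < 1" using dense z by blast
      obtain M where M: "R M z \<noteq> 0" "S M z \<noteq> 0" "(\<lambda>n. S n z) \<longlonglongrightarrow> S M z / R M z" using key[OF r(2)] r(1) by blast
      have "T z = S M z / R M z" unfolding T_def by (rule limI[OF M(3)])
      then show "(\<lambda>n. S n z) \<longlonglongrightarrow> T z" "T z \<noteq> 0" using M by auto
    qed
    have Th: "T holomorphic_on \<D>"
    proof -
      have "\<exists>f'. (T has_field_derivative f') (at z)" if z: "z \<in> \<D>" for z
      proof -
        obtain r where r: "cmod z < r" "r < 1" using dense z by auto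
        obtain M where M: "\<And>w. cmod w < r \<Longrightarrow> R M w \<noteq> 0 \<and> (\<lambda>n. S n w) \<longlonglongrightarrow> S M w / R M w" using key[OF r(2)] by blast
        have sub: "ball 0 r \<subseteq> \<D>" using r by auto
        have "(\<lambda>w. S M w / R M w) holomorphic_on ball 0 r"
          using M by (intro holomorphic_intros holomorphic_on_subset[OF Sh sub] holomorphic_on_subset[OF Rh sub]) auto
        then have "T holomorphic_on ball 0 r"
        proof (rule holomorphic_transform)
          fix w assume "w \<in> ball (0::complex) r"
          then have "(\<lambda>n. S n w) \<longlonglongrightarrow> S M w / R M w" using M by simp
          then show "S M w / R M w = T w" unfolding T_def by (rule limI[symmetric])
        qed
        then show ?thesis using r(1) by (auto simp: holomorphic_on_open)
      qed
      then show ?thesis by (simp add: holomorphic_on_open)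
    qed
    have T1: "cmod (T z) \<le> 1" if z: "cmod z < 1" for z
      using Lim_norm_ubound[OF _ Tlim(1)[OF z], of 1] Sz(1)[OF z] by auto
    define b where "b = (\<lambda>z. \<Prod>n. blaschke_factor (a n) z)"
    have "blaschke_product b"
      unfolding blaschke_product_def infinite_blaschke_product_def b_def
      using a1 summ by (intro disjI2 exI[of _ 1] exI[of _ a]) auto
    moreover have "cmod (b z) \<le> 1" if "cmod z < 1" for z
      unfolding b_def by (rule infinite_bprod_le_1[OF a1 summ that])
    moreover have "f z = b z * T z" if z: "cmod z < 1" for z
    proof -
      have "(\<lambda>n. finite_bprod a n z * S n z) \<longlonglongrightarrow> b z * T z"
        unfolding b_def by (intro tendsto_mult Tlim(1) z finite_bprod_tendsto[OF a1 summ z])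
      then have "(\<lambda>n. f z) \<longlonglongrightarrow> b z * T z" using Sz(2)[OF z] by simp
      then show ?thesis by (simp add: LIMSEQ_const_iff)
    qed
    ultimately show ?thesis using Th T1 Tlim(2) by (intro exI[of _ b] exI[of _ T]) auto
  qed
qed

lemma blaschke_product_cmult:
  assumes b: "blaschke_product b" and c: "cmod c = 1" and f: "\<And>z. cmod z < 1 \<Longrightarrow> f z = c * b z"
  shows "blaschke_product f"
  using b
proof (cases rule: blaschke_product_cases)
  case (finite d a N)
  have "finite_blaschke_product f" unfolding finite_blaschke_product_def
    using finite c f by (intro exI[of _ "c * d"] exI[of _ a] exI[of _ N]) (auto simp: norm_mult finite_bprod_def)
  then show ?thesis by (simp add: blaschke_product_def)
next
  case (infinite d a)
  have "infinite_blaschke_product f" unfolding infinite_blaschke_product_def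
    using infinite c f by (intro exI[of _ "c * d"] exI[of _ a]) (auto simp: norm_mult)
  then show ?thesis by (simp add: blaschke_product_def)
qed

section \<open>The image of a maximal Blaschke product\<close>

text \<open>Up to the factor \<open>1 / sqrt 2\<close>, \<open>|f'| U\<close> is the pullback of the hyperbolic metric of the disc of radius
  \<open>exp (- \<alpha>)\<close>. That factor and the strict convexity of \<open>\<alpha>\<close> as a function of \<open>Re P\<close> absorb the terms that
  come from the variation of the radius; that \<open>\<alpha>\<close> grows at most like \<open>Re P / 8\<close> keeps \<open>f\<close> well inside.\<close>

lemma sk_metric_disc_of_varying_radius:
  assumes f: "holomorphic_selfmap f" and P: "P holomorphic_on \<D>"
    and p0: "\<And>z. z \<in> \<D> \<Longrightarrow> Re (P z) \<ge> 0" and fp: "\<And>z. z \<in> \<D> \<Longrightarrow> cmod (f z) \<le> exp (- Re (P z))"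
  defines "\<alpha> \<equiv> (\<lambda>z. (Re (P z) - ln (1 + Re (P z))) / 8)"
  defines "U \<equiv> (\<lambda>z. exp (\<alpha> z) / (sqrt 2 * (1 - (cmod (f z))\<^sup>2 * exp (2 * \<alpha> z))))"
  shows "sk_metric (deriv f) U"
    and "\<And>z. z \<in> \<D> \<Longrightarrow> exp (\<alpha> z) / sqrt 2 \<le> U z"
proof -
  have fh: "f holomorphic_on \<D>" using f by (simp add: holomorphic_selfmap_def)
  define y where "y = (\<lambda>z. (cmod (f z))\<^sup>2 * exp (2 * \<alpha> z))"
  have y_eq: "(cmod (f z))\<^sup>2 * exp (2 * \<alpha> z) = y z" for z by (simp only: y_def)
  have \<alpha>: "0 \<le> \<alpha> z" "2 * \<alpha> z \<le> Re (P z)" if z: "z \<in> \<D>" for z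
  proof -
    have "ln (1 + Re (P z)) \<le> Re (P z)" using ln_add_one_self_le_self[OF p0[OF z]] .
    then show "0 \<le> \<alpha> z" by (simp add: \<alpha>_def)
    have "2 * ((p - l) / 8) \<le> p" if "0 \<le> l" "0 \<le> p" for p l :: real using that by simp
    then show "2 * \<alpha> z \<le> Re (P z)" using p0[OF z] unfolding \<alpha>_def by (simp only: ln_ge_zero le_add_same_cancel1)
  qed
  have y0: "0 \<le> y z" for z by (simp add: y_def)
  have y1: "y z < 1" "y z \<le> exp (- Re (P z))" if z: "z \<in> \<D>" for z
  proof -
    have f1: "cmod (f z) < 1" using selfmap_in_disc[OF f] z by simp
    have "cmod (f z) * exp (2 * \<alpha> z) \<le> exp (- Re (P z)) * exp (Re (P z))"
      using fp[OF z] \<alpha>(2)[OF z] by (intro mult_mono) auto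
    then have 1: "cmod (f z) * exp (2 * \<alpha> z) \<le> 1" by (simp add: exp_minus)
    have "y z = cmod (f z) * (cmod (f z) * exp (2 * \<alpha> z))" by (simp add: y_def power2_eq_square)
    also have "\<dots> \<le> cmod (f z) * 1" using 1 by (intro mult_left_mono) auto
    finally have 2: "y z \<le> cmod (f z)" by simp
    then show "y z < 1" using f1 by simp
    show "y z \<le> exp (- Re (P z))" using 2 fp[OF z] by simp
  qed
  have Upos: "U z > 0" if z: "z \<in> \<D>" for z
    using y1(1)[OF z] by (simp add: U_def y_def)
  show "exp (\<alpha> z) / sqrt 2 \<le> U z" if z: "z \<in> \<D>" for z
    unfolding U_def y_eq
  proof (rule divide_left_mono)
    show "sqrt 2 * (1 - y z) \<le> sqrt 2" using y0[of z] by simp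
  qed (use y1(1)[OF z] in simp_all)
  have lap: "\<exists>g L. has_lap (\<lambda>w. ln (U w)) g L z \<and> 4 * (cmod (deriv f z))\<^sup>2 * (U z)\<^sup>2 \<le> L" if z: "z \<in> \<D>" for z
  proof -
    define p where "p = Re (P z)"
    define Q where "Q = deriv P z"
    define F where "F = f z"
    define D where "D = deriv f z"
    define E where "E = exp (2 * \<alpha> z)"
    define Y where "Y = y z"
    have p: "p \<ge> 0" using p0[OF z] by (simp add: p_def)
    have Y: "Y = (cmod F)\<^sup>2 * E" "0 \<le> Y" "Y < 1" "Y \<le> exp (- p)"
      using y0[of z] y1[OF z] by (simp_all add: Y_def y_def F_def E_def p_def)
    \<comment> \<open>First and second derivative of \<alpha> as a function of p; they satisfy A1^2
      = A2 p^2 / 8.\<close>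
    define A1 A2 where "A1 = p / (8 * (1 + p))" and "A2 = 1 / (8 * (1 + p)\<^sup>2)"
    have ev: "\<forall>\<^sub>F s in nhds (Re (P z)). ((\<lambda>s. (s - ln (1 + s)) / 8) has_real_derivative s / (8 * (1 + s))) (at s)"
    proof -
      have "Re (P z) \<in> {-1<..}" using p by (simp add: p_def)
      from eventually_nhds_in_open[OF open_greaterThan this] show ?thesis
        by eventually_elim (auto intro!: derivative_eq_intros simp: field_simps)
    qed
    have d2: "((\<lambda>s. s / (8 * (1 + s))) has_real_derivative A2) (at (Re (P z)))"
    proof -
      have "((\<lambda>s. s / (8 * (1 + s))) has_real_derivative
          (1 * (8 * (1 + p)) - p * 8) / ((8 * (1 + p)) * (8 * (1 + p)))) (at p)"
        using p by (intro DERIV_divide) (auto intro!: derivative_eq_intros)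
      also have "1 * (8 * (1 + p)) - p * 8 = 8" by (simp add: algebra_simps)
      also have "8 / ((8 * (1 + p)) * (8 * (1 + p))) = A2"
      proof -
        have "8 / ((8 * x) * (8 * x)) = 1 / (8 * x\<^sup>2)" for x :: real by (simp add: power2_eq_square)
        then show ?thesis by (simp only: A2_def)
      qed
      finally show ?thesis by (simp only: p_def)
    qed
    have l\<alpha>: "has_lap \<alpha> (of_real A1 * Q) (A2 * (cmod Q)\<^sup>2) z"
      using has_lap_compose[OF has_lap_Re[OF P open_ball z] ev d2]
      unfolding \<alpha>_def A1_def p_def Q_def by simp
    define q where "q = of_real A1 * Q"
    define La where "La = A2 * (cmod Q)\<^sup>2"
    have l\<alpha>: "has_lap \<alpha> q La z" using l\<alpha> by (simp add: q_def La_def)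
    have lE: "has_lap (\<lambda>w. exp (2 * \<alpha> w)) (of_real (2 * E) * q) (2 * E * La + 4 * E * (cmod q)\<^sup>2) z"
    proof -
      have "\<forall>\<^sub>F s in nhds (\<alpha> z). ((\<lambda>s. exp (2 * s)) has_real_derivative 2 * exp (2 * s)) (at s)"
        by (intro always_eventually allI) (auto intro!: derivative_eq_intros)
      moreover have "((\<lambda>s. 2 * exp (2 * s)) has_real_derivative 4 * E) (at (\<alpha> z))"
        by (auto intro!: derivative_eq_intros simp: E_def)
      ultimately show ?thesis using has_lap_compose[OF l\<alpha>] by (force simp: E_def)
    qed
    \<comment> \<open>Through the twisted derivative D + F q both the gradient and the Laplacian of
      y become expressible; q is the gradient caused by the varying radius.\<close>
    define X where "X = (cmod (D + F * q))\<^sup>2"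
    have X: "X = (cmod D)\<^sup>2 + 2 * Re (cnj F * D * cnj q) + (cmod F)\<^sup>2 * (cmod q)\<^sup>2"
      unfolding X_def cmod_power2 by (simp add: algebra_simps power2_eq_square)
    have ly: "has_lap y (of_real (2 * E) * cnj F * (D + F * q)) (4 * E * X + 2 * Y * La) z"
    proof -
      have g: "of_real (exp (2 * \<alpha> z)) * (2 * cnj (f z) * deriv f z) + of_real ((cmod (f z))\<^sup>2) * (of_real (2 * E) * q)
          = of_real (2 * E) * cnj F * (D + F * q)"
      proof -
        have "of_real ((cmod (f z))\<^sup>2) = cnj F * F"
          using complex_norm_square[of F] by (simp add: F_def mult.commute)
        then show ?thesis by (simp add: E_def F_def D_def algebra_simps)
      qed
      have L: "exp (2 * \<alpha> z) * (4 * (cmod (deriv f z))\<^sup>2) + (cmod (f z))\<^sup>2 * (2 * E * La + 4 * E * (cmod q)\<^sup>2)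
          + 2 * Re (2 * cnj (f z) * deriv f z * cnj (of_real (2 * E) * q)) = 4 * E * X + 2 * Y * La"
      proof -
        have "Re (2 * cnj F * D * cnj (of_real (2 * E) * q)) = 4 * E * Re (cnj F * D * cnj q)"
          by (simp add: algebra_simps)
        then show ?thesis unfolding X Y(1) by (simp add: E_def F_def D_def algebra_simps)
      qed
      show ?thesis
        using has_lap_mult[OF has_lap_norm2[OF fh open_ball z] lE] unfolding g L y_eq .
    qed
    have gn: "(cmod (of_real (2 * E) * cnj F * (D + F * q)))\<^sup>2 = 4 * E * Y * X"
      unfolding X_def Y(1) by (simp add: norm_mult power_mult_distrib power2_eq_square)
    define L where "L = La + ((4 * E * X + 2 * Y * La) / (1 - Y) + 4 * E * Y * X / (1 - Y)\<^sup>2)"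
    have "\<exists>g. has_lap (\<lambda>w. - ln (sqrt 2) + (\<alpha> w + - ln (1 - y w))) g L z"
      using has_lap_add[OF has_lap_const[of "- ln (sqrt 2)"] has_lap_add[OF l\<alpha> has_lap_uminus[OF has_lap_ln_one_minus[OF ly y1(1)[OF z]]]]]
      unfolding gn Y_def[symmetric] L_def minus_minus add_0_left by (rule exI)
    then obtain g where "has_lap (\<lambda>w. - ln (sqrt 2) + (\<alpha> w + - ln (1 - y w))) g L z" by blast
    then have 1: "has_lap (\<lambda>w. ln (U w)) g L z"
    proof (rule has_lap_cong)
      show "\<forall>\<^sub>F w in nhds z. - ln (sqrt 2) + (\<alpha> w + - ln (1 - y w)) = ln (U w)"
        using eventually_nhds_in_open[OF open_ball z]
      proof eventually_elim
        case (elim w)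
        then show ?case using y1(1)[OF elim] unfolding U_def y_eq by (simp add: ln_div ln_mult)
      qed
    qed
    have Y1: "1 - Y > 0" using Y by simp
    have E0: "E > 0" by (simp add: E_def)
    have L_eq: "L * (1 - Y)\<^sup>2 = La * (1 - Y\<^sup>2) + 4 * E * X"
      unfolding L_def using Y1 by (simp add: divide_simps) (simp add: algebra_simps power2_eq_square)
    have U2: "(U z)\<^sup>2 = E / (2 * (1 - Y)\<^sup>2)"
      unfolding U_def y_eq Y_def[symmetric]
      by (simp add: power_divide power_mult_distrib E_def exp_double)
    \<comment> \<open>Returning from the twisted derivative to D costs a factor 2, which the 1 /
      sqrt 2 in \<open>U\<close> pays for. The remaining |F q|^2 is left to the convexity of
      \<alpha>.\<close>
    have Dle: "(cmod D)\<^sup>2 \<le> 2 * X + 2 * ((cmod F)\<^sup>2 * (cmod q)\<^sup>2)"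
    proof -
      have "cmod D \<le> cmod (D + F * q) + cmod (F * q)"
        using norm_triangle_ineq4[of "D + F * q" "F * q"] by simp
      then have "(cmod D)\<^sup>2 \<le> (cmod (D + F * q) + cmod (F * q))\<^sup>2" by (intro power_mono) auto
      also have "\<dots> \<le> 2 * (cmod (D + F * q))\<^sup>2 + 2 * (cmod (F * q))\<^sup>2"
        using sum_squares_bound[of "cmod (D + F * q)" "cmod (F * q)"] by (simp add: power2_sum)
      finally show ?thesis by (simp add: X_def norm_mult power_mult_distrib)
    qed
    \<comment> \<open>By A1^2 = A2 p^2 / 8 this reduces to Y p^2 / 2 <= 1 - Y^2. It follows from Y
      <= exp (- p) and the quadratic lower bound for exp p; this is where the slow growth of
      \<alpha> is spent.\<close>
    have key: "4 * Y * A1\<^sup>2 \<le> A2 * (1 - Y\<^sup>2)"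
    proof -
      have "1 + p + p\<^sup>2 / 2 \<le> exp p" by (rule exp_lower_Taylor_quadratic[OF p])
      then have "Y * (1 + p + p\<^sup>2 / 2) \<le> exp (- p) * exp p" using Y(2,4) p by (intro mult_mono) auto
      then have a: "Y * (1 + p + p\<^sup>2 / 2) \<le> 1" by (simp add: exp_minus)
      have b: "0 \<le> Y * p" "0 \<le> Y * (1 - Y)" using Y p by auto
      have "Y * p\<^sup>2 / 2 \<le> 1 - Y\<^sup>2" using a b by (simp add: algebra_simps power2_eq_square)
      then have "A2 * (Y * p\<^sup>2 / 2) \<le> A2 * (1 - Y\<^sup>2)" by (intro mult_left_mono) (auto simp: A2_def)
      moreover have "4 * Y * A1\<^sup>2 = A2 * (Y * p\<^sup>2 / 2)"
      proof -
        have "4 * Y * (p / (8 * x))\<^sup>2 = 1 / (8 * x\<^sup>2) * (Y * p\<^sup>2 / 2)" for x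
          by (simp add: power_divide power_mult_distrib)
        then show ?thesis by (simp only: A1_def A2_def)
      qed
      ultimately show ?thesis by (simp only:)
    qed
    have "2 * E * (cmod D)\<^sup>2 \<le> 2 * E * (2 * X + 2 * ((cmod F)\<^sup>2 * (cmod q)\<^sup>2))"
      using Dle E0 by (intro mult_left_mono) auto
    also have "\<dots> = 4 * E * X + 4 * Y * A1\<^sup>2 * (cmod Q)\<^sup>2"
      unfolding Y(1) q_def by (simp add: norm_mult power_mult_distrib algebra_simps)
    also have "\<dots> \<le> 4 * E * X + A2 * (1 - Y\<^sup>2) * (cmod Q)\<^sup>2"
      using key by (intro add_left_mono mult_right_mono) auto
    also have "\<dots> = L * (1 - Y)\<^sup>2" unfolding L_eq La_def by (simp add: algebra_simps)
    finally have "2 * E * (cmod D)\<^sup>2 / (1 - Y)\<^sup>2 \<le> L" using Y1 by (simp add: divide_simps)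
    moreover have "4 * (cmod (deriv f z))\<^sup>2 * (U z)\<^sup>2 = 2 * E * (cmod D)\<^sup>2 / (1 - Y)\<^sup>2"
      unfolding U2 D_def by (simp add: mult.commute)
    ultimately show ?thesis using 1 by auto
  qed
  have cont: "continuous_on \<D> U"
  proof -
    have "continuous_on \<D> P" "continuous_on \<D> f" using P fh holomorphic_on_imp_continuous_on by auto
    moreover have "1 + Re (P z) \<noteq> 0" if "z \<in> \<D>" for z using p0[OF that] by simp
    ultimately have "continuous_on \<D> \<alpha>" unfolding \<alpha>_def by (intro continuous_intros) auto
    then show ?thesis
      unfolding U_def using \<open>continuous_on \<D> f\<close> y1(1)
      by (intro continuous_intros) (force simp: y_def)+
  qed
  show "sk_metric (deriv f) U"
    unfolding sk_metric_def using lap Upos cont fh by (auto intro: holomorphic_deriv)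
qed

text \<open>The point is to exclude a zero-free factor S in f. Once p = - ln |S| is bounded, 1 - exp
  (- 2 p) is at least a multiple of p. This bounds 1 - |f|^2, and through C also 1 - |B|^2, from
  below by a multiple of p, which is what a minorant of - ln |B| requires.\<close>

lemma maximal_blaschke_moebius_blaschke:
  assumes max: "maximal_blaschke_product B" and B: "holomorphic_selfmap B" and f: "holomorphic_selfmap f"
    and fnz: "z0 \<in> \<D>" "f z0 \<noteq> 0"
    and h: "h holomorphic_on \<D>" "\<And>z. z \<in> \<D> \<Longrightarrow> deriv f z = h z * deriv B z"
    and eq: "\<And>z. z \<in> \<D> \<Longrightarrow> cmod (h z) * (1 - (cmod (B z))\<^sup>2) = 1 - (cmod (f z))\<^sup>2"
    and C: "C > 0" "\<And>z. z \<in> \<D> \<Longrightarrow> 1 - (cmod (f z))\<^sup>2 \<le> C * (1 - (cmod (B z))\<^sup>2)"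
  shows "blaschke_product f"
proof -
  have fh: "f holomorphic_on \<D>" using f by (simp add: holomorphic_selfmap_def)
  have Bbl: "blaschke_product B" and Bnc: "\<not> B constant_on \<D>"
    using max by (auto simp: maximal_blaschke_product_def)
  have f1: "cmod (f z) < 1" if "cmod z < 1" for z by (rule selfmap_in_disc[OF f that])
  have fle: "cmod (f z) \<le> 1" if "cmod z < 1" for z using f1[OF that] by simp
  have z01: "cmod z0 < 1" using fnz(1) by simp
  obtain b S where b: "blaschke_product b" and S: "S holomorphic_on \<D>"
    and bS: "\<And>z. cmod z < 1 \<Longrightarrow> cmod (b z) \<le> 1 \<and> cmod (S z) \<le> 1 \<and> S z \<noteq> 0 \<and> f z = b z * S z"
    using riesz_factorization[OF fh fle z01 fnz(2)] by blast
  obtain P0 where P0: "P0 holomorphic_on \<D>" "\<And>z. z \<in> \<D> \<Longrightarrow> exp (P0 z) = S z"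
    using holomorphic_logarithm_exists[OF convex_ball open_ball S _ fnz(1)] bS by auto
  define P where "P = (\<lambda>z. - P0 z)"
  have P: "P holomorphic_on \<D>" unfolding P_def using P0(1) by (intro holomorphic_intros)
  have nS: "cmod (S z) = exp (- Re (P z))" if "z \<in> \<D>" for z
    using P0(2)[OF that, symmetric] by (simp add: P_def)
  have p0: "Re (P z) \<ge> 0" if z: "z \<in> \<D>" for z
    using bS[of z] nS[OF z] z by simp
  have fp: "cmod (f z) \<le> exp (- Re (P z))" if z: "z \<in> \<D>" for z
    using bS[of z] nS[OF z] z by (simp add: norm_mult mult_left_le_one_le)
  define \<alpha> where "\<alpha> = (\<lambda>z. (Re (P z) - ln (1 + Re (P z))) / 8)"
  define U where "U = (\<lambda>z. exp (\<alpha> z) / (sqrt 2 * (1 - (cmod (f z))\<^sup>2 * exp (2 * \<alpha> z))))"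
  have sk: "sk_metric (deriv f) U" and Uge: "\<And>z. z \<in> \<D> \<Longrightarrow> exp (\<alpha> z) / sqrt 2 \<le> U z"
    using sk_metric_disc_of_varying_radius[OF f P p0 fp] unfolding U_def \<alpha>_def by auto
  have dom: "exp (\<alpha> z) * (1 - exp (- 2 * Re (P z))) \<le> sqrt 2" if z: "z \<in> \<D>" for z
  proof -
    have "cmod (h z) * U z * (1 - (cmod (B z))\<^sup>2) \<le> 1"
      by (rule maximal_dominates[OF max B sk h z])
    then have 1: "U z * (1 - (cmod (f z))\<^sup>2) \<le> 1" using eq[OF z] by (simp add: mult_ac)
    have fpos: "0 < 1 - (cmod (f z))\<^sup>2" using one_minus_norm2_pos f1 z by simp
    have "(cmod (f z))\<^sup>2 \<le> (exp (- Re (P z)))\<^sup>2" using fp[OF z] by (intro power_mono) auto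
    also have "\<dots> = exp (- 2 * Re (P z))" by (simp add: exp_double[symmetric])
    finally have "exp (\<alpha> z) / sqrt 2 * (1 - exp (- 2 * Re (P z))) \<le> exp (\<alpha> z) / sqrt 2 * (1 - (cmod (f z))\<^sup>2)"
      by (intro mult_left_mono) auto
    also have "\<dots> \<le> U z * (1 - (cmod (f z))\<^sup>2)" using Uge[OF z] fpos by (intro mult_right_mono) auto
    finally have "exp (\<alpha> z) / sqrt 2 * (1 - exp (- 2 * Re (P z))) \<le> 1" using 1 by linarith
    then show ?thesis by (simp add: divide_simps)
  qed
  \<comment> \<open>Since \<alpha> grows linearly in p, the inequality \<open>dom\<close> fails for
    all large p, so p is bounded on \<D>.\<close>
  have "\<forall>\<^sub>F p in at_top. exp ((p - ln (1 + p)) / 8) * (1 - exp (- 2 * p)) > sqrt (2::real)"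
    by real_asymp
  then obtain M0 where M0: "\<And>p. p \<ge> M0 \<Longrightarrow> exp ((p - ln (1 + p)) / 8) * (1 - exp (- 2 * p)) > sqrt (2::real)"
    by (auto simp: eventually_at_top_linorder)
  define M where "M = max M0 1"
  have M: "M \<ge> 1" by (simp add: M_def)
  have pM: "Re (P z) \<le> M" if z: "z \<in> \<D>" for z
    using dom[OF z] M0[of "Re (P z)"] by (force simp: M_def \<alpha>_def)
  \<comment> \<open>From 1 - exp (- 2 p) >= 2 p / (1 + 2 p) >= 2 p / (1 + 2 M), divided by the
    distortion constant C.\<close>
  define c where "c = 2 / (1 + 2 * M) / C"
  have c: "c > 0" using M C by (simp add: c_def)
  have Bp: "(cmod (B z))\<^sup>2 \<le> exp (- (c * Re (P z)))" if z: "z \<in> \<D>" for z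
  proof -
    define p where "p = Re (P z)"
    have p: "0 \<le> p" "p \<le> M" using p0[OF z] pM[OF z] by (auto simp: p_def)
    have "exp (- (2 * p)) \<le> 1 / (1 + 2 * p)"
      using exp_ge_add_one_self[of "2 * p"] p by (simp add: exp_minus field_simps)
    then have "2 * p / (1 + 2 * p) \<le> 1 - exp (- (2 * p))" using p by (simp add: field_simps)
    moreover have "2 * p / (1 + 2 * M) \<le> 2 * p / (1 + 2 * p)" using p M by (intro divide_left_mono) auto
    moreover have "exp (- (2 * p)) \<ge> (cmod (f z))\<^sup>2"
    proof -
      have "(cmod (f z))\<^sup>2 \<le> (exp (- p))\<^sup>2" using fp[OF z] by (intro power_mono) (auto simp: p_def)
      then show ?thesis by (simp add: exp_double[symmetric])
    qed
    ultimately have "2 * p / (1 + 2 * M) \<le> C * (1 - (cmod (B z))\<^sup>2)" using C(2)[OF z] by linarith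
    then have "2 * p / (1 + 2 * M) / C \<le> 1 - (cmod (B z))\<^sup>2"
      unfolding pos_divide_le_eq[OF C(1)] by (simp only: mult.commute[of _ C])
    then have "c * p \<le> 1 - (cmod (B z))\<^sup>2" by (simp add: c_def)
    then show ?thesis using exp_ge_add_one_self[of "- (c * p)"] by (simp add: p_def)
  qed
  \<comment> \<open>The holomorphic function of modulus exp (c p / 2): the bound |B E| <= 1 states
    the minorant property, and |E| <= 1 then forces p to vanish at a point where B does not.\<close>
  define E where "E = (\<lambda>z. exp (of_real (c / 2) * P z))"
  have E: "E holomorphic_on \<D>" unfolding E_def by (intro holomorphic_intros P)
  have nE: "cmod (E z) = exp (c / 2 * Re (P z))" for z by (simp add: E_def)
  have BE: "cmod (B z * E z) \<le> 1" if z: "cmod z < 1" for z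
  proof (rule power2_le_imp_le)
    have "(cmod (B z * E z))\<^sup>2 = (cmod (B z))\<^sup>2 * exp (c * Re (P z))"
      unfolding norm_mult nE power_mult_distrib by (simp add: exp_double[symmetric])
    also have "\<dots> \<le> exp (- (c * Re (P z))) * exp (c * Re (P z))"
      using Bp[of z] z by (intro mult_right_mono) auto
    also have "\<dots> = 1\<^sup>2" by (simp add: exp_minus)
    finally show "(cmod (B z * E z))\<^sup>2 \<le> 1\<^sup>2" .
  qed simp
  obtain z2 where z2: "z2 \<in> \<D>" "B z2 \<noteq> 0"
    using Bnc unfolding constant_on_def by blast
  have "cmod (E z2) \<le> 1" using blaschke_product_no_minorant[OF Bbl E BE _ z2(2)] z2(1) by simp
  then have "Re (P z2) \<le> 0" using c unfolding nE by (simp add: mult_le_0_iff)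
  then have S2: "cmod (S z2) = 1" using p0[OF z2(1)] nS[OF z2(1)] by simp
  have "S constant_on \<D>"
    using maximum_modulus_principle[OF S open_ball connected_ball open_ball order_refl z2(1)] bS S2 by simp
  then obtain s where s: "\<And>z. z \<in> \<D> \<Longrightarrow> S z = s" by (auto simp: constant_on_def)
  then have "cmod s = 1" using S2 z2(1) by metis
  then show ?thesis
    by (rule blaschke_product_cmult[OF b]) (use bS s in auto)
qed

section \<open>The quotient of hyperbolic derivatives and the conclusion\<close>

lemma hyp_deriv_quotient_eq:
  assumes f: "holomorphic_selfmap f" and B: "holomorphic_selfmap B" and z0: "z0 \<in> \<D>" "deriv B z0 \<noteq> 0"
    and h: "h holomorphic_on \<D>" "\<And>z. z \<in> \<D> \<Longrightarrow> deriv f z = h z * deriv B z" and z: "z \<in> \<D>"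
  shows "hyp_deriv_quotient f B z = cmod (h z) * (1 - (cmod (B z))\<^sup>2) / (1 - (cmod (f z))\<^sup>2)"
proof -
  define q where "q = (\<lambda>z. cmod (h z) * (1 - (cmod (B z))\<^sup>2) / (1 - (cmod (f z))\<^sup>2))"
  have fh: "f holomorphic_on \<D>" and Bh: "B holomorphic_on \<D>" using f B by (auto simp: holomorphic_selfmap_def)
  have Bp: "1 - (cmod (B w))\<^sup>2 > 0" if "w \<in> \<D>" for w
    using one_minus_norm2_pos[OF selfmap_in_disc[OF B]] that by simp
  have fp: "1 - (cmod (f w))\<^sup>2 > 0" if "w \<in> \<D>" for w
    using one_minus_norm2_pos[OF selfmap_in_disc[OF f]] that by simp
  have quot: "hyp_deriv f w / hyp_deriv B w = q w" if w: "w \<in> \<D>" "deriv B w \<noteq> 0" for w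
  proof -
    have "1 - (cmod w)\<^sup>2 > 0" using one_minus_norm2_pos w by simp
    then show ?thesis
      unfolding hyp_deriv_def q_def h(2)[OF w(1)] norm_mult
      using Bp[OF w(1)] fp[OF w(1)] w(2) by (simp add: divide_simps)
  qed
  show ?thesis
  proof (cases "deriv B z = 0")
    case True
    have "deriv B holomorphic_on \<D>" using Bh by (intro holomorphic_deriv) auto
    then have ev: "\<forall>\<^sub>F w in at z. deriv B w \<noteq> 0 \<and> w \<in> \<D>"
      using non_zero_neighbour_alt[of "deriv B" \<D> z z0] z z0 by auto
    \<comment> \<open>With B' cancelled the expression is continuous, so its value at a critical
      point is the limit that defines the quotient there.\<close>
    have "isCont q z" unfolding q_def
      using holomorphic_disc_isCont[OF h(1) z] holomorphic_disc_isCont[OF Bh z] holomorphic_disc_isCont[OF fh z] fp[OF z]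
      by (intro continuous_intros) auto
    then have "(q \<longlongrightarrow> q z) (at z)" by (simp add: isCont_def)
    moreover have "\<forall>\<^sub>F w in at z. q w = hyp_deriv f w / hyp_deriv B w"
      using ev by eventually_elim (use quot in simp)
    ultimately have "((\<lambda>w. hyp_deriv f w / hyp_deriv B w) \<longlongrightarrow> q z) (at z)"
      by (rule Lim_transform_eventually)
    then have "Lim (at z) (\<lambda>w. hyp_deriv f w / hyp_deriv B w) = q z"
      by (intro tendsto_Lim) auto
    then show ?thesis using True by (simp add: hyp_deriv_quotient_def q_def)
  next
    case False
    then show ?thesis using quot[OF z False] by (simp add: hyp_deriv_quotient_def q_def)
  qed
qed

theorem theorem2p10:
  fixes f B :: "complex \<Rightarrow> complex" and z :: "nat \<Rightarrow> complex"
  assumes "holomorphic_selfmap f"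
    and "maximal_blaschke_product B"
    and "\<exists>h. h holomorphic_on \<D> \<and> (\<forall>w\<in>\<D>. deriv B w \<noteq> 0 \<longrightarrow> h w = deriv f w / deriv B w)"
    and "\<And>n. z n \<in> \<D>"
    and "(\<lambda>n. cmod (z n)) \<longlonglongrightarrow> 1"
    and "(\<lambda>n. hyp_deriv_quotient f B (z n) - 1) \<in> o(\<lambda>n. (1 - cmod (z n))\<^sup>2)"
  shows "(\<exists>T. disc_automorphism T \<and> (\<forall>w\<in>\<D>. f w = T (B w))) \<and> maximal_blaschke_product f"
proof -
  note f = assms(1) and max = assms(2)
  have Bbl: "blaschke_product B" and Bnc: "\<not> B constant_on \<D>"
    using max by (auto simp: maximal_blaschke_product_def)
  have Bh: "B holomorphic_on \<D>" by (rule blaschke_product_bounds(1)[OF Bbl])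
  have B: "holomorphic_selfmap B"
    by (rule bounded_nonconstant_selfmap[OF Bh blaschke_product_bounds(2)[OF Bbl] Bnc])
  have fh: "f holomorphic_on \<D>" using f by (simp add: holomorphic_selfmap_def)
  have dfh: "deriv f holomorphic_on \<D>" and dBh: "deriv B holomorphic_on \<D>"
    using fh Bh by (auto intro: holomorphic_deriv)
  obtain z0 where z0: "z0 \<in> \<D>" "deriv B z0 \<noteq> 0" using nonconstant_deriv_nonzero[OF Bh Bnc] by blast
  obtain h where h: "h holomorphic_on \<D>" and hq: "\<And>w. w \<in> \<D> \<Longrightarrow> deriv B w \<noteq> 0 \<Longrightarrow> h w = deriv f w / deriv B w"
    using assms(3) by blast
  \<comment> \<open>The hypothesis fixes h only off the critical points of B; these are isolated, so
    continuity gives the product formula everywhere.\<close>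
  have hd: "deriv f w = h w * deriv B w" if w: "w \<in> \<D>" for w
  proof (rule LIM_unique)
    show "deriv f \<midarrow>w\<rightarrow> deriv f w"
      using holomorphic_disc_isCont[OF dfh w] by (simp add: isCont_def)
    have "(\<lambda>v. h v * deriv B v) \<midarrow>w\<rightarrow> h w * deriv B w"
      using holomorphic_disc_isCont[OF h w] holomorphic_disc_isCont[OF dBh w]
      by (intro tendsto_mult) (auto simp: isCont_def)
    moreover have "\<forall>\<^sub>F v in at w. deriv B v \<noteq> 0 \<and> v \<in> \<D>"
      using non_zero_neighbour_alt[OF dBh open_ball connected_ball w z0] by simp
    then have "\<forall>\<^sub>F v in at w. h v * deriv B v = deriv f v"
      by eventually_elim (simp add: hq)
    ultimately show "deriv f \<midarrow>w\<rightarrow> h w * deriv B w" by (rule Lim_transform_eventually)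
  qed
  define q where "q = (\<lambda>w. cmod (h w) * (1 - (cmod (B w))\<^sup>2) / (1 - (cmod (f w))\<^sup>2))"
  have fp: "1 - (cmod (f w))\<^sup>2 > 0" if "w \<in> \<D>" for w
    using one_minus_norm2_pos[OF selfmap_in_disc[OF f]] that by simp
  have Bp: "1 - (cmod (B w))\<^sup>2 > 0" if "w \<in> \<D>" for w
    using one_minus_norm2_pos[OF selfmap_in_disc[OF B]] that by simp
  have q1: "q w \<le> 1" if w: "w \<in> \<D>" for w
    using maximal_dominates[OF max B sk_metric_selfmap[OF f] h hd w] by (simp add: q_def)
  have qz: "hyp_deriv_quotient f B w = q w" if "w \<in> \<D>" for w
    unfolding q_def by (rule hyp_deriv_quotient_eq[OF f B z0 h hd that])
  have q_eq: "q a = 1" if a: "a \<in> \<D>" for a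
  proof (rule ccontr)
    assume "q a \<noteq> 1"
    then have "q a < 1" using q1[OF a] by simp
    then obtain c \<rho> where c: "c > 0" "\<rho> < 1"
      "\<And>w. \<rho> \<le> cmod w \<Longrightarrow> cmod w < 1 \<Longrightarrow> q w \<le> 1 - c * (1 - cmod w)\<^sup>2"
      using boundary_decay[OF f B h hd q_def q1 a] by blast
    \<comment> \<open>The little-o hypothesis with constant c / 2 contradicts the decay with
      constant c along the sequence.\<close>
    have "\<forall>\<^sub>F n in sequentially. norm (hyp_deriv_quotient f B (z n) - 1) \<le> c / 2 * norm ((1 - cmod (z n))\<^sup>2)"
      by (rule landau_o.smallD[OF assms(6)]) (use c(1) in simp)
    moreover have "\<forall>\<^sub>F n in sequentially. \<rho> < cmod (z n)"
      using assms(5) c(2) by (rule order_tendstoD)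
    ultimately have "\<forall>\<^sub>F n in sequentially. False"
    proof eventually_elim
      case (elim n)
      have zn: "z n \<in> \<D>" "cmod (z n) < 1" using assms(4)[of n] by auto
      have "q (z n) \<le> 1 - c * (1 - cmod (z n))\<^sup>2" using c(3)[of "z n"] elim(2) zn by simp
      moreover have "\<bar>q (z n) - 1\<bar> \<le> c / 2 * (1 - cmod (z n))\<^sup>2"
        using elim(1) qz[OF zn(1)] by simp
      moreover have "c * (1 - cmod (z n))\<^sup>2 > 0" using c zn by simp
      ultimately show False by (simp add: abs_le_iff)
    qed
    then show False by simp
  qed
  have eq: "cmod (h w) * (1 - (cmod (B w))\<^sup>2) = 1 - (cmod (f w))\<^sup>2" if "w \<in> \<D>" for w
    using q_eq[OF that] fp[OF that] by (simp add: q_def divide_simps)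
  have h0: "h w \<noteq> 0" if "w \<in> \<D>" for w using eq[OF that] fp[OF that] by auto
  have hyp: "hyp_deriv f w = hyp_deriv B w" if w: "w \<in> \<D>" for w
  proof -
    have "cmod (deriv f w) * (1 - (cmod (B w))\<^sup>2) = cmod (deriv B w) * (1 - (cmod (f w))\<^sup>2)"
      unfolding hd[OF w] eq[OF w, symmetric] by (simp add: norm_mult)
    then show ?thesis using fp[OF w] Bp[OF w] by (simp add: hyp_deriv_def frac_eq_eq mult.commute)
  qed
  obtain T C where T: "disc_automorphism T" and C: "0 < C"
    and fT: "\<And>w. w \<in> \<D> \<Longrightarrow> f w = T (B w)"
    and fC: "\<And>w. w \<in> \<D> \<Longrightarrow> 1 - (cmod (f w))\<^sup>2 \<le> C * (1 - (cmod (B w))\<^sup>2)"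
    using equal_hyperbolic_derivative[OF f B z0 hyp] by blast
  have df0: "deriv f z0 \<noteq> 0" using hd[OF z0(1)] h0[OF z0(1)] z0(2) by simp
  have fnc: "\<not> f constant_on \<D>" using constant_on_disc_deriv[OF _ z0(1)] df0 by blast
  then obtain z1 where "z1 \<in> \<D>" "f z1 \<noteq> 0" unfolding constant_on_def by blast
  then have fbl: "blaschke_product f"
    by (rule maximal_blaschke_moebius_blaschke[OF max B f _ _ h hd eq C fC])
  \<comment> \<open>Since h has no zeros, f and B have the same critical points with multiplicity,
    hence the same competitors. Their hyperbolic derivatives agree, so maximality passes from B to
    f.\<close>
  have "hyp_deriv g w \<le> hyp_deriv f w"
    if g: "holomorphic_selfmap g \<and> \<not> g constant_on \<D> \<and> same_critical_points g f" and w: "w \<in> \<D>" for g w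
  proof -
    have "zorder (deriv f) v = zorder (deriv B) v" if v: "v \<in> \<D>" for v
      by (rule zorder_mult_nonvanishing[OF open_ball v dBh h h0[OF v] connected_ball z0 hd])
    then have "same_critical_points g B" using g unfolding same_critical_points_def by simp
    then have "hyp_deriv g w \<le> hyp_deriv B w"
      using g max w unfolding maximal_blaschke_product_def by blast
    then show ?thesis using hyp[OF w] by simp
  qed
  then have "maximal_blaschke_product f"
    unfolding maximal_blaschke_product_def using fbl fnc by blast
  then show ?thesis using T fT by blast
qed

end
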